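(* Let $1<p<\infty$. Suppose that $\zeta\in\mathring{L}^p(\mathbb S^2)$ satisfies $$\zeta(\mathbf x)=g\big(\mathcal G\zeta(\mathbf x)+\beta\,\mathbf p\cdot\mathbf x\big)\quad\text{for a.e. }\mathbf x\in\mathbb S^2$$ for some function $g$, some unit vector $\mathbf p\in\mathbb R^3$ and some $\beta\in\mathbb R$. (i) Suppose that $g:\mathbb R\to\mathbb R\cup\{\pm\infty\}$ is decreasing (i.e. $g(s_1)\ge g(s_2)$ whenever $s_1\le s_2$). Then $\zeta$ is rotationally invariant around some unit vector $\mathbf q\in\mathbb R^3$, i.e. $\zeta=\zeta\circ\mathsf R^{\mathbf q}_\theta$ for all $\theta\in\mathbb R$. Moreover, one can take $\mathbf q=\mathbf p$ if $\beta\ne0$. (ii) Suppose that $g\in C^1(\mathbb R)$ and $0\le g'\le 6$ on $\mathbb R$. Then $\zeta$ can be decomposed as $\zeta=\zeta_e+\zeta_z$, where $\zeta_e\in\mathbb E_2$ and there exists some unit vector $\mathbf q\in\mathbb R^3$ such that $\zeta_z\circ\mathsf R^{\mathbf q}_\theta=\zeta_z$ for all $\theta\in\mathbb R$. Moreover, one can take $\mathbf q=\mathbf p$ if $\beta\neq0$. (iii) Suppose that $g\in C^1(\mathbb R)$, $g'\ge0$, and there is $c>0$ such that $$\int_{\mathbb S^2}\Big(|\nabla\varphi|^2-g'(\mathcal G\zeta+\beta\,\mathbf p\cdot\mathbf x)\,\varphi^2\Big)\mathrm d\sigma\ \ge\ c\int_{\mathbb S^2}\varphi^2\,\mathrm d\sigma$$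 for every $\varphi\in C^\infty(\mathbb S^2)$ with $\int_{\mathbb S^2}\varphi\,\mathrm d\sigma=0$ and $\mathbf m(\varphi)=\mathbf 0$. Then $\zeta$ is rotationally invariant around some unit vector $\mathbf q\in\mathbb R^3$, i.e. $\zeta=\zeta\circ\mathsf R^{\mathbf q}_\theta$ for all $\theta\in\mathbb R$. Moreover, one can take $\mathbf q=\mathbf p$ if $\beta\ne0$.
   Context: $\mathbb S^2\subset\mathbb R^3$ is the unit sphere centered at the origin with the standard induced metric, area element $\mathrm d\sigma$, gradient $\nabla$ and Laplace-Beltrami operator $\Delta$. $\mathring{L}^p(\mathbb S^2)=\{v\in L^p(\mathbb S^2): \int_{\mathbb S^2}v\,\mathrm d\sigma=0\}$. For $v\in\mathring{L}^p(\mathbb S^2)$, $1<p<\infty$, $\mathcal Gv$ denotes the unique function in $W^{2,p}(\mathbb S^2)$ (taken continuous) with $-\Delta(\mathcal Gv)=v$ on $\mathbb S^2$ and $\int_{\mathbb S^2}\mathcal Gv\,\mathrm d\sigma=0$. For a unit vector $\mathbf q$ and $\theta\in\mathbb R$, $\mathsf R^{\mathbf q}_\theta$ is the rotation by angle $\theta$ around $\mathbf q$: $\mathsf R^{\mathbf q}_\theta\mathbf x=(\cos\theta)\mathbf x+\sin\theta\,(\mathbf q\times\mathbf x)+(1-\cos\theta)(\mathbf q\cdot\mathbf x)\mathbf q$. For an integrable function $v$ on $\mathbb S^2$, $\mathbf m(v)=\int_{\mathbb S^2}\mathbf x\,v(\mathbf x)\,\mathrm d\sigma\in\mathbb R^3$.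 $\mathbb E_2=\mathrm{span}\{x_1x_2,\,x_1x_3,\,x_2x_3,\,x_1^2-x_2^2,\,3x_3^2-1\}$ (restricted to $\mathbb S^2$) is the eigenspace of $-\Delta$ for the eigenvalue $6$. Equalities between functions are understood a.e. on $\mathbb S^2$. *)

theory Defs
  imports "HOL-Analysis.Analysis"
begin

text \<open>
  Functions and vector fields on the unit sphere are given as functions on \<open>real ^ 3\<close>; only their
  values on \<open>sphere 0 1\<close> matter.  Differential operators on the sphere are computed from the
  extension \<open>f \<circ> sgn\<close>, i.e. \<open>y \<mapsto> f (y / norm y)\<close>, which is constant along rays.
\<close>

text \<open>
  The surface measure is the one given by polar coordinates \<open>dy = r\<^sup>2 dr d\<sigma>\<close>: the area of a
  set \<open>A\<close> is three times the volume of the cone \<open>{r *\<^sub>R x | x \<in> A, 0 < r \<le> 1}\<close>.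
\<close>

definition sphere_area :: "(real ^ 3) measure" where
  "sphere_area = scale_measure 3
     (distr (restrict_space lborel (cball 0 1 - {0})) (restrict_space borel (sphere 0 1)) sgn)"

subsection \<open>Differential operators\<close>

primrec Ck_on :: "nat \<Rightarrow> (real ^ 3) set \<Rightarrow> (real ^ 3 \<Rightarrow> real) \<Rightarrow> bool" where
  "Ck_on 0 S f \<longleftrightarrow> continuous_on S f"
| "Ck_on (Suc k) S f \<longleftrightarrow> (\<forall>x\<in>S. f differentiable (at x)) \<and>
     (\<forall>i. Ck_on k S (\<lambda>x. frechet_derivative f (at x) (axis i 1)))"

definition sphere_smooth :: "(real ^ 3 \<Rightarrow> real) \<Rightarrow> bool" where
  "sphere_smooth f \<longleftrightarrow> (\<forall>k. Ck_on k (- {0}) (f \<circ> sgn))"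

text \<open>
  The radial derivative of \<open>f \<circ> sgn\<close> vanishes, so its Euclidean gradient at a point of the sphere is
  tangential, and the Euclidean trace of the derivative of \<open>X \<circ> sgn\<close> is the trace over the tangent
  plane, which is the Riemannian divergence of a tangential field \<open>X\<close>.
\<close>

definition surf_grad :: "(real ^ 3 \<Rightarrow> real) \<Rightarrow> real ^ 3 \<Rightarrow> real ^ 3" where
  "surf_grad f x = (\<chi> i. frechet_derivative (f \<circ> sgn) (at x) (axis i 1))"

definition surf_div :: "(real ^ 3 \<Rightarrow> real ^ 3) \<Rightarrow> real ^ 3 \<Rightarrow> real" where
  "surf_div X x = trace (matrix (frechet_derivative (X \<circ> sgn) (at x)))"

definition surf_laplacian :: "(real ^ 3 \<Rightarrow> real) \<Rightarrow> real ^ 3 \<Rightarrow> real" where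
  "surf_laplacian f x = surf_div (surf_grad f) x"

text \<open>
  The covariant derivative of the gradient field: its ambient derivative followed by the orthogonal
  projection \<open>1 - x x\<^sup>T\<close> onto the tangent plane.  The norm on \<open>real ^ 3 ^ 3\<close> is the
  Hilbert-Schmidt norm.
\<close>

definition surf_hess :: "(real ^ 3 \<Rightarrow> real) \<Rightarrow> real ^ 3 \<Rightarrow> real ^ 3 ^ 3" where
  "surf_hess f x =
     (mat 1 - (\<chi> i j. x $ i * x $ j)) ** matrix (frechet_derivative (surf_grad f \<circ> sgn) (at x))"

subsection \<open>Function spaces\<close>

definition Lp :: "real \<Rightarrow> (real ^ 3 \<Rightarrow> real) set" where
  "Lp p = {v \<in> borel_measurable sphere_area. integrable sphere_area (\<lambda>x. \<bar>v x\<bar> powr p)}"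

definition Lp_mean_zero :: "real \<Rightarrow> (real ^ 3 \<Rightarrow> real) set" where
  "Lp_mean_zero p = {v \<in> Lp p. (LINT x|sphere_area. v x) = 0}"

definition Lp_norm :: "real \<Rightarrow> (real ^ 3 \<Rightarrow> 'b :: real_normed_vector) \<Rightarrow> real" where
  "Lp_norm p f = (LINT x|sphere_area. norm (f x) powr p) powr (1 / p)"

definition W2p_norm :: "real \<Rightarrow> (real ^ 3 \<Rightarrow> real) \<Rightarrow> real" where
  "W2p_norm p f = Lp_norm p f + Lp_norm p (surf_grad f) + Lp_norm p (surf_hess f)"

text \<open>
  \<open>W\<^sup>2\<^sup>,\<^sup>p\<close> as the completion of the smooth functions with respect to \<open>W2p_norm\<close>, realised
  inside \<open>L\<^sup>p\<close>.
\<close>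

definition W2p :: "real \<Rightarrow> (real ^ 3 \<Rightarrow> real) set" where
  "W2p p = {u \<in> Lp p. \<exists>F. (\<forall>n::nat. sphere_smooth (F n)) \<and>
      (\<lambda>n. Lp_norm p (\<lambda>x. F n x - u x)) \<longlonglongrightarrow> 0 \<and>
      (\<forall>e>0. \<exists>N. \<forall>m\<ge>N. \<forall>n\<ge>N. W2p_norm p (\<lambda>x. F m x - F n x) < e)}"

definition has_weak_laplacian :: "(real ^ 3 \<Rightarrow> real) \<Rightarrow> (real ^ 3 \<Rightarrow> real) \<Rightarrow> bool" where
  "has_weak_laplacian u w \<longleftrightarrow> (\<forall>f. sphere_smooth f \<longrightarrow>
     (LINT x|sphere_area. u x * surf_laplacian f x) = (LINT x|sphere_area. w x * f x))"

text \<open>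
  \<open>is_green p v u\<close> says that \<open>u\<close> is (the continuous representative of) \<open>\<G> v\<close>, the unique
  mean-zero solution of \<open>- \<Delta> u = v\<close> in \<open>W\<^sup>2\<^sup>,\<^sup>p\<close>; it determines \<open>u\<close> on the sphere.
\<close>

definition is_green :: "real \<Rightarrow> (real ^ 3 \<Rightarrow> real) \<Rightarrow> (real ^ 3 \<Rightarrow> real) \<Rightarrow> bool" where
  "is_green p v u \<longleftrightarrow> u \<in> W2p p \<and> continuous_on (sphere 0 1) u \<and>
     has_weak_laplacian u (\<lambda>x. - v x) \<and> (LINT x|sphere_area. u x) = 0"

subsection \<open>Rotations, moments and the second eigenspace\<close>

definition rot :: "real ^ 3 \<Rightarrow> real \<Rightarrow> real ^ 3 \<Rightarrow> real ^ 3" where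
  "rot q \<theta> x = cos \<theta> *\<^sub>R x + sin \<theta> *\<^sub>R cross3 q x + ((1 - cos \<theta>) * (q \<bullet> x)) *\<^sub>R q"

definition rot_invariant :: "real ^ 3 \<Rightarrow> (real ^ 3 \<Rightarrow> real) \<Rightarrow> bool" where
  "rot_invariant q v \<longleftrightarrow> (\<forall>\<theta>. AE x in sphere_area. v (rot q \<theta> x) = v x)"

definition moment :: "(real ^ 3 \<Rightarrow> real) \<Rightarrow> real ^ 3" where
  "moment v = (LINT x|sphere_area. v x *\<^sub>R x)"

definition E2 :: "(real ^ 3 \<Rightarrow> real) set" where
  "E2 = {(\<lambda>x. a * (x$1 * x$2) + b * (x$1 * x$3) + c * (x$2 * x$3)
            + d * ((x$1)\<^sup>2 - (x$2)\<^sup>2) + e * (3 * (x$3)\<^sup>2 - 1)) | a b c d e. True}"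

end

theory Submission
  imports Defs "HOL-Computational_Algebra.Polynomial"
begin

text \<open>
  Let \<open>R\<close> be a rotation about an axis \<open>q\<close> that fixes the perturbation \<open>\<beta> p \<bullet> x\<close>.  The difference
  \<open>w = \<psi> \<circ> R - \<psi>\<close> solves \<open>- \<Delta> w = h\<close> with \<open>h = g (u \<circ> R) - g u\<close>, \<open>u = \<psi> + \<beta> p \<bullet> x\<close>, and
  \<open>w = u \<circ> R - u\<close>.  The integral of \<open>h w\<close> is bounded below by spectral gap inequalities and bounded
  above by the hypothesis on \<open>g\<close>.  For decreasing \<open>g\<close> it is nonpositive, so \<open>w = 0\<close>.  For
  \<open>0 \<le> g' \<le> 6\<close> the function \<open>w\<close> has to be an eigenfunction for the eigenvalue 6, provided that \<open>w\<close>
  has no component of degree one; in the third case the stability condition forces \<open>w = 0\<close> for small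
  angles, hence for all.  The component of degree one vanishes if \<open>R\<close> fixes the moment of \<open>\<zeta>\<close>.  For
  \<open>\<beta> \<noteq> 0\<close> and \<open>q = p\<close> this holds because the moment is parallel to \<open>p\<close>, which follows by integrating
  the derivative of a primitive of \<open>g\<close>, evaluated at \<open>u\<close>, along a rotation field.

  All functions are approximated by convolution with polynomial zonal kernels \<open>k (x \<bullet> y)\<close>.  On the
  kernels the Laplacian acts as the Legendre operator, and a polynomial splits into eigenvectors of that
  operator; this replaces the decomposition into spherical harmonics.
\<close>

text \<open>The eigenvalues of -\<Delta> are l (l + 1) = 0, 2, 6, 12, ... The vanishing mean of w
  removes l = 0 and the fixed moment removes l = 1. The slope bound 6 is therefore exactly the
  lowest eigenvalue left to w, and w falls into the equality case of the spectral inequality. The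
  function in the second eigenspace must be the same for all angles; it is obtained as one fixed
  zonal convolution of \<psi>, and such convolutions commute with rotations. The obstacle is
  regularity: \<psi> is continuous and solves the equation only weakly, while the moment argument
  differentiates \<psi> along a rotation field. Every identity is therefore proved for smoothed
  functions. The error terms are a uniformly small factor times a rotational derivative, which is
  bounded in the mean by the Dirichlet energy; that energy converges to the integral of \<zeta>
  \<psi>. Polynomial kernels keep this elementary: their convolutions are polynomials in the free
  variable, so no derivative has to be moved under an integral, and all spectral sums are
  finite.\<close>

abbreviation S2 :: "(real ^ 3) set" where
  "S2 \<equiv> sphere 0 1"

section \<open>The surface measure: finiteness, orthogonal invariance, positivity on open
  sets\<close>

lemma space_sphere_area [simp]: "space sphere_area = S2"
  by (simp add: sphere_area_def space_scale_measure)

lemma sets_sphere_area [simp, measurable_cong]: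
  "sets sphere_area = sets (restrict_space borel S2)"
  by (simp add: sphere_area_def)

lemma measurable_sgn_punctured_ball:
  "sgn \<in> restrict_space lborel (cball 0 1 - {0}) \<rightarrow>\<^sub>M restrict_space borel S2"
proof (rule measurable_restrict_space2)
  have "continuous_on (cball 0 1 - {0::real^3}) sgn"
    by (intro continuous_on_sgn continuous_on_id) auto
  then have "sgn \<in> borel_measurable (restrict_space borel (cball 0 1 - {0::real^3}))"
    by (rule borel_measurable_continuous_on_restrict)
  then show "sgn \<in> borel_measurable (restrict_space lborel (cball 0 1 - {0::real^3}))"
    by (simp cong: measurable_cong_sets add: sets_restrict_space)
qed (auto simp: space_restrict_space norm_sgn)

lemma emeasure_sphere_area:
  assumes "A \<in> sets (restrict_space borel S2)"
  shows "emeasure sphere_area A = 3 * emeasure lborel {y. norm y \<le> 1 \<and> y \<noteq> 0 \<and> sgn y \<in> A}"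
proof -
  have "sgn -` A \<inter> (cball 0 1 - {0}) = {y. norm y \<le> 1 \<and> y \<noteq> 0 \<and> sgn y \<in> A}"
    by auto
  then show ?thesis
    using assms measurable_sgn_punctured_ball
    by (simp add: sphere_area_def emeasure_distr space_restrict_space)
       (subst emeasure_restrict_space, auto)
qed

lemma cone_measurable:
  assumes "A \<in> sets (restrict_space borel S2)"
  shows "{y. norm y \<le> 1 \<and> y \<noteq> 0 \<and> sgn y \<in> A} \<in> sets lborel"
proof -
  have "sgn -` A \<inter> space (restrict_space lborel (cball 0 1 - {0}))
      \<in> sets (restrict_space lborel (cball 0 1 - {0::real^3}))"
    using measurable_sgn_punctured_ball assms by (rule measurable_sets)
  then have "sgn -` A \<inter> (cball 0 1 - {0}) \<in> sets lborel"
    by (subst (asm) sets_restrict_space_iff) (auto simp: space_restrict_space)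
  moreover have "sgn -` A \<inter> (cball 0 1 - {0}) = {y. norm y \<le> 1 \<and> y \<noteq> 0 \<and> sgn y \<in> A}"
    by auto
  ultimately show ?thesis by simp
qed

lemma finite_measure_sphere_area: "finite_measure sphere_area"
proof
  have "emeasure lborel {y::real^3. norm y \<le> 1 \<and> y \<noteq> 0 \<and> sgn y \<in> S2}
      \<le> emeasure lborel (cball (0::real^3) 1)"
    by (rule emeasure_mono) auto
  also have "\<dots> < \<infinity>" by (rule emeasure_lborel_cball_finite)
  finally show "emeasure sphere_area (space sphere_area) \<noteq> \<infinity>"
    by (subst emeasure_sphere_area)
       (auto simp: sets_restrict_space ennreal_mult_eq_top_iff)
qed

interpretation sphere_area: finite_measure sphere_area
  by (rule finite_measure_sphere_area)

lemma emeasure_lborel_orthogonal_image: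
  fixes f :: "real^3 \<Rightarrow> real^3"
  assumes f: "orthogonal_transformation f" and S: "S \<in> sets lborel" "bounded S"
    and fS: "f ` S \<in> sets lborel"
  shows "emeasure lborel (f ` S) = emeasure lborel S"
proof -
  have L: "S \<in> lmeasurable"
    using S by (metis bounded_set_imp_lmeasurable sets_completionI_sets)
  then have "measure lebesgue (f ` S) = measure lebesgue S" "f ` S \<in> lmeasurable"
    using measure_orthogonal_image[OF f L] measurable_orthogonal_image[OF f L] by auto
  then have "emeasure lebesgue (f ` S) = emeasure lebesgue S"
    using L by (simp add: emeasure_eq_measure2)
  then show ?thesis using S fS by simp
qed

lemma measurable_orthogonal_sphere_area:
  assumes f: "orthogonal_transformation f"
  shows "f \<in> sphere_area \<rightarrow>\<^sub>M sphere_area"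
proof -
  have "f \<in> borel_measurable (restrict_space borel S2)"
    using f by (intro borel_measurable_continuous_on_restrict linear_continuous_on)
      (simp add: orthogonal_transformation_linear linear_conv_bounded_linear[symmetric])
  then have "f \<in> restrict_space borel S2 \<rightarrow>\<^sub>M restrict_space borel S2"
    using f by (intro measurable_restrict_space2)
      (auto simp: space_restrict_space orthogonal_transformation_norm)
  then show ?thesis by (simp cong: measurable_cong_sets)
qed

text \<open>An orthogonal map preserves the norm and commutes with \<open>sgn\<close>, so it carries
  the cone over the preimage of a set onto the cone over that set. Orthogonal invariance of volume
  in the ball then passes to the sphere.\<close>

lemma distr_sphere_area_orthogonal:
  assumes f: "orthogonal_transformation f"
  shows "distr sphere_area sphere_area f = sphere_area"
proof (rule measure_eqI)
  fix A assume "A \<in> sets (distr sphere_area sphere_area f)"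
  then have A: "A \<in> sets (restrict_space borel S2)" by simp
  have lin: "linear f" using f by (rule orthogonal_transformation_linear)
  have nf: "norm (f y) = norm y" for y using f by (rule orthogonal_transformation_norm)
  have surj: "surj f" using f by (rule orthogonal_transformation_surj)
  have "A \<subseteq> S2" using A by (auto simp: sets_restrict_space)
  define B where "B = f -` A \<inter> S2"
  have B: "B \<in> sets (restrict_space borel S2)"
    using measurable_sets[OF measurable_orthogonal_sphere_area[OF f], of A] A
    by (simp add: B_def)
  define CA where "CA = {y. norm y \<le> 1 \<and> y \<noteq> 0 \<and> sgn y \<in> A}"
  define CB where "CB = {y. norm y \<le> 1 \<and> y \<noteq> 0 \<and> sgn y \<in> B}"
  have sgn_f: "sgn (f y) = f (sgn y)" for y
    by (simp add: sgn_div_norm nf linear_scale[OF lin])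
  have eq: "f y \<in> CA \<longleftrightarrow> y \<in> CB" for y
  proof -
    have "f y = 0 \<longleftrightarrow> y = 0" using nf[of y] by (metis norm_eq_zero)
    then show ?thesis by (auto simp: CA_def CB_def B_def sgn_f nf norm_sgn)
  qed
  have "CA = f ` CB"
  proof (intro set_eqI iffI)
    fix z assume "z \<in> CA"
    moreover obtain y where "z = f y" using surj by (metis surjD)
    ultimately show "z \<in> f ` CB" using eq by auto
  qed (use eq in auto)
  moreover have "CB \<in> sets lborel" "CA \<in> sets lborel"
    using cone_measurable A B by (simp_all add: CA_def CB_def)
  moreover have "bounded CB"
    by (rule bounded_subset[OF bounded_cball[of 0 1]]) (auto simp: CB_def)
  ultimately have "emeasure lborel CA = emeasure lborel CB"
    using emeasure_lborel_orthogonal_image[OF f] by auto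
  then show "emeasure (distr sphere_area sphere_area f) A = emeasure sphere_area A"
    using A B emeasure_sphere_area[of A] emeasure_sphere_area[of B]
      measurable_orthogonal_sphere_area[OF f]
    by (simp add: emeasure_distr B_def[symmetric] CA_def CB_def)
qed simp

lemma integral_sphere_orthogonal:
  fixes g :: "real^3 \<Rightarrow> 'b::{banach, second_countable_topology}"
  assumes f: "orthogonal_transformation f" and g: "g \<in> borel_measurable sphere_area"
  shows "(LINT x|sphere_area. g (f x)) = (LINT x|sphere_area. g x)"
  using integral_distr[OF measurable_orthogonal_sphere_area[OF f] g]
  by (simp add: distr_sphere_area_orthogonal[OF f])

lemma integrable_sphere_orthogonal:
  fixes g :: "real^3 \<Rightarrow> 'b::{banach, second_countable_topology}"
  assumes f: "orthogonal_transformation f" and g: "integrable sphere_area g"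
  shows "integrable sphere_area (\<lambda>x. g (f x))"
  using integrable_distr[OF measurable_orthogonal_sphere_area[OF f], of g] g
  by (simp add: distr_sphere_area_orthogonal[OF f])

lemma AE_sphere_orthogonal:
  assumes f: "orthogonal_transformation f" and P: "AE x in sphere_area. P x"
  shows "AE x in sphere_area. P (f x)"
proof -
  have "AE x in distr sphere_area sphere_area f. P x"
    unfolding distr_sphere_area_orthogonal[OF f] by (rule P)
  then show ?thesis
    using AE_distrD[OF measurable_orthogonal_sphere_area[OF f]] by blast
qed

lemma borel_measurable_sphere_continuous:
  fixes f :: "real^3 \<Rightarrow> 'b::topological_space"
  assumes "continuous_on S2 f"
  shows "f \<in> borel_measurable sphere_area"
  using borel_measurable_continuous_on_restrict[OF assms]
  by (simp cong: measurable_cong_sets)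

lemma continuous_on_sphere_bounded:
  fixes f :: "real^3 \<Rightarrow> 'b::real_normed_vector"
  assumes "continuous_on S2 f"
  obtains C where "0 \<le> C" "\<And>x. x \<in> S2 \<Longrightarrow> norm (f x) \<le> C"
proof -
  have "bounded (f ` S2)"
    using assms by (intro compact_imp_bounded compact_continuous_image) auto
  then obtain C where C: "\<And>x. x \<in> S2 \<Longrightarrow> norm (f x) \<le> C" by (metis bounded_iff imageI)
  have "axis 1 1 \<in> S2" by simp
  then have "0 \<le> C" using C[of "axis 1 1"] norm_ge_zero order_trans by blast
  then show ?thesis using C that by blast
qed

lemma integrable_sphere_mult:
  fixes f :: "real^3 \<Rightarrow> real" and g :: "real^3 \<Rightarrow> 'b::{banach, second_countable_topology}"
  assumes f: "continuous_on S2 f" and g: "integrable sphere_area g"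
  shows "integrable sphere_area (\<lambda>x. f x *\<^sub>R g x)"
proof -
  obtain C where C: "\<And>x. x \<in> S2 \<Longrightarrow> norm (f x) \<le> C"
    using continuous_on_sphere_bounded[OF f] by metis
  show ?thesis
  proof (rule Bochner_Integration.integrable_bound)
    show "integrable sphere_area (\<lambda>x. C * norm (g x))" using g by simp
    show "(\<lambda>x. f x *\<^sub>R g x) \<in> borel_measurable sphere_area"
      using borel_measurable_sphere_continuous[OF f] g by simp
    show "AE x in sphere_area. norm (f x *\<^sub>R g x) \<le> norm (C * norm (g x))"
    proof (rule AE_I2)
      fix x assume "x \<in> space sphere_area"
      then have "norm (f x) \<le> C" "0 \<le> C" using C[of x] norm_ge_zero[of "f x"] by auto
      then show "norm (f x *\<^sub>R g x) \<le> norm (C * norm (g x))"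
        by (simp add: abs_mult mult_right_mono)
    qed
  qed
qed

lemma integrable_sphere_continuous:
  fixes f :: "real^3 \<Rightarrow> real"
  assumes "continuous_on S2 f"
  shows "integrable sphere_area f"
  using integrable_sphere_mult[OF assms, of "\<lambda>_. 1::real"] by simp

text \<open>The cone over \<open>U\<close> contains a nonempty open subset of the ball, with
  \<open>x / 2\<close> as a point, and such a set is not negligible. This turns almost everywhere
  statements about continuous functions into pointwise ones and gives spherical caps positive
  area.\<close>

lemma emeasure_sphere_area_open_pos:
  assumes "open U" "x \<in> U" "x \<in> S2"
  shows "0 < emeasure sphere_area (U \<inter> S2)"
proof -
  define V where "V = {y \<in> ball 0 1 - {0}. sgn y \<in> U}"
  have "open V"
  proof -
    have "continuous_on (ball 0 1 - {0::real^3}) sgn"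
      by (intro continuous_on_sgn continuous_on_id) auto
    then have "open ((ball 0 1 - {0::real^3}) \<inter> sgn -` U)"
      using assms(1) by (intro continuous_open_preimage) auto
    moreover have "V = (ball 0 1 - {0::real^3}) \<inter> sgn -` U" by (auto simp: V_def)
    ultimately show ?thesis by simp
  qed
  moreover have "(1/2) *\<^sub>R x \<in> V"
  proof -
    have "sgn ((1/2) *\<^sub>R x) = x" using assms by (simp add: sgn_div_norm)
    then show ?thesis using assms by (auto simp: V_def)
  qed
  ultimately have "\<not> negligible V" using open_not_negligible by blast
  then have "emeasure lborel V \<noteq> 0"
    using \<open>open V\<close> by (auto simp: negligible_iff_null_sets null_sets_def)
  moreover have A: "U \<inter> S2 \<in> sets (restrict_space borel S2)"
    using assms(1) by (auto simp: sets_restrict_space)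
  moreover have "emeasure lborel V \<le> emeasure lborel {y. norm y \<le> 1 \<and> y \<noteq> 0 \<and> sgn y \<in> U \<inter> S2}"
    using cone_measurable[OF A] by (intro emeasure_mono) (auto simp: V_def norm_sgn)
  ultimately show ?thesis
    by (subst emeasure_sphere_area) (auto simp: ennreal_zero_less_mult_iff zero_less_iff_neq_zero)
qed

lemma AE_sphere_continuous_eq:
  fixes f g :: "real^3 \<Rightarrow> real"
  assumes f: "continuous_on S2 f" and g: "continuous_on S2 g"
    and ae: "AE x in sphere_area. f x = g x" and x: "x \<in> S2"
  shows "f x = g x"
proof (rule ccontr)
  assume ne: "f x \<noteq> g x"
  have "continuous_on S2 (\<lambda>x. f x - g x)" using f g by (intro continuous_intros)
  then have "openin (top_of_set S2) (S2 \<inter> (\<lambda>x. f x - g x) -` (- {0}))"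
    by (rule continuous_openin_preimage_gen) auto
  then obtain U where U: "open U" "S2 \<inter> (\<lambda>x. f x - g x) -` (- {0}) = U \<inter> S2"
    by (auto simp: openin_open)
  have "x \<in> S2 \<inter> (\<lambda>x. f x - g x) -` (- {0})" using ne x by simp
  then have "x \<in> U" unfolding U(2) by simp
  then have "0 < emeasure sphere_area (U \<inter> S2)"
    using U(1) x by (intro emeasure_sphere_area_open_pos)
  moreover have "U \<inter> S2 \<in> sets sphere_area" using U(1) by (auto simp: sets_restrict_space)
  moreover have "AE x in sphere_area. x \<notin> U \<inter> S2"
    unfolding U(2)[symmetric] using ae by eventually_elim simp
  ultimately have "U \<inter> S2 \<in> null_sets sphere_area"
    using AE_iff_null_sets by blast
  with \<open>0 < emeasure sphere_area (U \<inter> S2)\<close> show False by (simp add: null_sets_def)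
qed

section \<open>Rotations\<close>

lemma linear_rot: "linear (rot q \<theta>)"
  unfolding rot_def
  by (intro linearI) (simp_all add: cross_add_right cross_mult_right inner_add_right algebra_simps)

lemma cross_cross_unit:
  assumes "norm q = 1"
  shows "cross3 q (cross3 q x) = (q \<bullet> x) *\<^sub>R q - x"
proof -
  have "q \<bullet> q = 1" using assms by (simp add: dot_square_norm)
  have "cross3 q (cross3 q x) = (q \<bullet> x) *\<^sub>R q - (q \<bullet> q) *\<^sub>R x"
    by (simp add: cross3_simps forall_3) 
  then show ?thesis using \<open>q \<bullet> q = 1\<close> by simp
qed

lemma rot_add:
  assumes q: "norm q = 1"
  shows "rot q a (rot q b x) = rot q (a + b) x"
proof -
  have qq: "q \<bullet> q = 1" using q by (simp add: dot_square_norm)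
  define c where "c = q \<bullet> x"
  have 1: "q \<bullet> rot q b x = c"
    by (simp add: rot_def c_def inner_add_right dot_cross_self qq algebra_simps)
  have 2: "cross3 q (rot q b x) = cos b *\<^sub>R cross3 q x + sin b *\<^sub>R (c *\<^sub>R q - x)"
    by (simp add: rot_def cross_add_right cross_mult_right cross_cross_unit[OF q] c_def)
  have "rot q a (rot q b x) = cos a *\<^sub>R (cos b *\<^sub>R x + sin b *\<^sub>R cross3 q x + ((1 - cos b) * c) *\<^sub>R q)
     + sin a *\<^sub>R (cos b *\<^sub>R cross3 q x + sin b *\<^sub>R (c *\<^sub>R q - x)) + ((1 - cos a) * c) *\<^sub>R q"
    unfolding rot_def[of q a] 1 2 by (simp add: rot_def c_def)
  also have "\<dots> = rot q (a + b) x"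
    by (simp add: rot_def c_def cos_add sin_add vec_eq_iff) (simp add: algebra_simps)
  finally show ?thesis .
qed

lemma rot_0 [simp]: "rot q 0 x = x"
  by (simp add: rot_def)

lemma orthogonal_transformation_rot:
  assumes q: "norm q = 1"
  shows "orthogonal_transformation (rot q \<theta>)"
  unfolding orthogonal_transformation
proof (intro conjI linear_rot allI)
  fix x
  have qq: "q \<bullet> q = 1" using q by (simp add: dot_square_norm)
  have cc: "cross3 q x \<bullet> cross3 q x = x \<bullet> x - (q \<bullet> x)\<^sup>2"
    using norm_cross_dot[of q x] q by (simp add: power2_norm_eq_inner power_mult_distrib)
  have "rot q \<theta> x \<bullet> rot q \<theta> x = (cos \<theta>)\<^sup>2 * (x \<bullet> x) + (sin \<theta>)\<^sup>2 * (x \<bullet> x - (q \<bullet> x)\<^sup>2)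
      + (1 - cos \<theta>)\<^sup>2 * (q \<bullet> x)\<^sup>2 + 2 * cos \<theta> * (1 - cos \<theta>) * (q \<bullet> x)\<^sup>2"
    by (simp add: rot_def inner_add_left inner_add_right dot_cross_self cc qq
        inner_commute[of x q] inner_commute[of x "cross3 q x"] power2_eq_square algebra_simps)
  also have "\<dots> = ((cos \<theta>)\<^sup>2 + (sin \<theta>)\<^sup>2) * (x \<bullet> x) + (1 - ((cos \<theta>)\<^sup>2 + (sin \<theta>)\<^sup>2)) * (q \<bullet> x)\<^sup>2"
    by algebra
  finally show "norm (rot q \<theta> x) = norm x" by (simp add: norm_eq_sqrt_inner)
qed

lemma norm_rot [simp]: "norm q = 1 \<Longrightarrow> norm (rot q \<theta> x) = norm x"
  using orthogonal_transformation_rot orthogonal_transformation_norm by blast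

lemma continuous_on_rot [continuous_intros]: "continuous_on A (rot q \<theta>)"
  by (intro linear_continuous_on) (simp add: linear_rot linear_conv_bounded_linear[symmetric])

lemma continuous_on_sphere_compose_rot:
  assumes "norm q = 1" "continuous_on S2 f"
  shows "continuous_on S2 (\<lambda>x. f (rot q \<theta> x))"
  using assms by (intro continuous_on_compose2[OF assms(2) continuous_on_rot]) auto

lemma rot_axis: "norm q = 1 \<Longrightarrow> rot q \<theta> (c *\<^sub>R q) = c *\<^sub>R q"
  by (simp add: rot_def cross_mult_right dot_square_norm vec_eq_iff algebra_simps)

lemma inner_rot:
  assumes "norm q = 1"
  shows "rot q \<theta> x \<bullet> y = x \<bullet> rot q (- \<theta>) y"
proof -
  have "rot q \<theta> x \<bullet> rot q \<theta> (rot q (- \<theta>) y) = x \<bullet> rot q (- \<theta>) y"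
    using orthogonal_transformation_rot[OF assms] by (simp add: orthogonal_transformation_def)
  then show ?thesis by (simp add: rot_add[OF assms])
qed

section \<open>Derivatives along rotation fields and integration by parts\<close>

lemma has_vector_derivative_rot:
  assumes q: "norm q = 1"
  shows "((\<lambda>\<theta>. rot q \<theta> x) has_vector_derivative cross3 q (rot q \<theta> x)) (at \<theta>)"
proof -
  have "((\<lambda>\<theta>. rot q \<theta> x) has_vector_derivative
      ((- sin \<theta>) *\<^sub>R x + cos \<theta> *\<^sub>R cross3 q x + (sin \<theta> * (q \<bullet> x)) *\<^sub>R q)) (at \<theta>)"
    unfolding rot_def by (auto intro!: derivative_eq_intros simp: has_real_derivative_iff_has_vector_derivative[symmetric])
  moreover have "cross3 q (rot q \<theta> x) = (- sin \<theta>) *\<^sub>R x + cos \<theta> *\<^sub>R cross3 q x + (sin \<theta> * (q \<bullet> x)) *\<^sub>R q"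
    by (simp only: rot_def cross_add_right cross_mult_right cross_cross_unit[OF q] cross_refl)
       (simp add: vec_eq_iff algebra_simps)
  ultimately show ?thesis by simp
qed

text \<open>\<open>F'\<close> is the derivative of \<open>F\<close> along the Killing field
  \<open>cross3 q x\<close>. Angle 0 is enough, because the group law of the rotations carries the
  derivative to every other angle. The fields of the three coordinate axes replace charts: the sum
  of their squares is the Laplacian of the sphere.\<close>

definition rot_deriv :: "real^3 \<Rightarrow> (real^3 \<Rightarrow> real) \<Rightarrow> (real^3 \<Rightarrow> real) \<Rightarrow> bool" where
  "rot_deriv q F F' \<longleftrightarrow> (\<forall>x\<in>S2. ((\<lambda>\<theta>. F (rot q \<theta> x)) has_real_derivative F' x) (at 0))"

lemma rot_deriv_at:
  assumes q: "norm q = 1" and F: "rot_deriv q F F'" and x: "x \<in> S2"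
  shows "((\<lambda>\<theta>. F (rot q \<theta> x)) has_real_derivative F' (rot q t x)) (at t)"
proof -
  have "((\<lambda>\<theta>. F (rot q \<theta> (rot q t x))) has_real_derivative F' (rot q t x)) (at (t + - t))"
    using F x q by (auto simp: rot_deriv_def)
  then have "((\<lambda>\<theta>. F (rot q (\<theta> + - t) (rot q t x))) has_real_derivative F' (rot q t x)) (at t)"
    by (subst DERIV_shift[symmetric]) (simp add: algebra_simps)
  then show ?thesis by (simp add: rot_add[OF q])
qed

lemma rot_deriv_mult:
  assumes "rot_deriv q F F'" "rot_deriv q G G'"
  shows "rot_deriv q (\<lambda>x. F x * G x) (\<lambda>x. F' x * G x + F x * G' x)"
  using assms unfolding rot_deriv_def by (auto intro!: derivative_eq_intros)

lemma rot_deriv_poly: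
  assumes "rot_deriv q F F'"
  shows "rot_deriv q (\<lambda>x. poly k (F x)) (\<lambda>x. poly (pderiv k) (F x) * F' x)"
  unfolding rot_deriv_def
proof
  fix x assume "x \<in> S2"
  then have "((\<lambda>\<theta>. F (rot q \<theta> x)) has_real_derivative F' x) (at 0)"
    using assms by (auto simp: rot_deriv_def)
  from DERIV_chain2[OF poly_DERIV this] 
  show "((\<lambda>\<theta>. poly k (F (rot q \<theta> x))) has_real_derivative poly (pderiv k) (F x) * F' x) (at 0)"
    by simp
qed

lemma rot_deriv_has_derivative:
  assumes q: "norm q = 1" and F: "\<And>x. x \<in> S2 \<Longrightarrow> (F has_derivative F' x) (at x)"
  shows "rot_deriv q F (\<lambda>x. F' x (cross3 q x))"
  unfolding rot_deriv_def
proof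
  fix x assume x: "x \<in> S2"
  have F0: "(F has_derivative F' x) (at (rot q 0 x))" using F[OF x] by simp
  have "((\<lambda>\<theta>. rot q \<theta> x) has_derivative (\<lambda>t. t *\<^sub>R cross3 q x)) (at 0)"
    using has_vector_derivative_rot[OF q, of x 0] by (simp add: has_vector_derivative_def)
  from has_derivative_compose[OF this F0]
  have "((\<lambda>\<theta>. F (rot q \<theta> x)) has_derivative (\<lambda>t. F' x (t *\<^sub>R cross3 q x))) (at 0)" .
  moreover have "F' x (t *\<^sub>R v) = t * F' x v" for t v
    using has_derivative_linear[OF F[OF x]] by (simp add: linear_scale)
  ultimately show "((\<lambda>\<theta>. F (rot q \<theta> x)) has_real_derivative F' x (cross3 q x)) (at 0)"
    by (simp add: has_field_derivative_def mult.commute[of _ "F' x (cross3 q x)"])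
qed

text \<open>Dominated convergence: \<open>F'\<close> is bounded on the compact sphere, and the mean
  value inequality along the orbit of a point transfers this bound to all difference quotients.
  Hence a merely integrable \<open>\<zeta>\<close> is admissible as a weight.\<close>

lemma tendsto_integral_rot_quotient:
  assumes q: "norm q = 1" and F: "rot_deriv q F F'"
    and cF: "continuous_on S2 F" and cF': "continuous_on S2 F'"
    and \<zeta>: "integrable sphere_area \<zeta>"
    and t: "t \<longlonglongrightarrow> 0" "\<And>n. t n \<noteq> 0"
  shows "(\<lambda>n::nat. LINT x|sphere_area. \<zeta> x * ((F (rot q (t n) x) - F x) / t n))
    \<longlonglongrightarrow> (LINT x|sphere_area. \<zeta> x * F' x)"
proof -
  obtain C where C: "0 \<le> C" "\<And>x. x \<in> S2 \<Longrightarrow> norm (F' x) \<le> C"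
    using continuous_on_sphere_bounded[OF cF'] by metis
  have bnd: "\<bar>(F (rot q s x) - F x) / s\<bar> \<le> C" if "x \<in> S2" for s x
  proof -
    have "norm (F (rot q s x) - F (rot q 0 x)) \<le> C * norm (s - 0)"
    proof (rule field_differentiable_bound)
      show "((\<lambda>\<theta>. F (rot q \<theta> x)) has_field_derivative F' (rot q z x)) (at z within UNIV)" for z
        using rot_deriv_at[OF q F that] by simp
      show "norm (F' (rot q z x)) \<le> C" for z
        using that q by (intro C) simp
    qed auto
    then show ?thesis using C(1) by (cases "s = 0") (auto simp: divide_le_eq)
  qed
  show ?thesis
  proof (rule integral_dominated_convergence)
    show "(\<lambda>x. \<zeta> x * F' x) \<in> borel_measurable sphere_area"
      using \<zeta> borel_measurable_sphere_continuous[OF cF'] by auto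
    show "(\<lambda>x. \<zeta> x * ((F (rot q (t n) x) - F x) / t n)) \<in> borel_measurable sphere_area" for n
      using \<zeta> borel_measurable_sphere_continuous[OF cF]
        borel_measurable_sphere_continuous[OF continuous_on_sphere_compose_rot[OF q cF]] by auto
    show "integrable sphere_area (\<lambda>x. C * norm (\<zeta> x))" using \<zeta> by simp
    show "AE x in sphere_area. (\<lambda>n. \<zeta> x * ((F (rot q (t n) x) - F x) / t n)) \<longlonglongrightarrow> \<zeta> x * F' x"
    proof (rule AE_I2)
      fix x assume "x \<in> space sphere_area"
      then have "((\<lambda>\<theta>. F (rot q \<theta> x)) has_real_derivative F' x) (at 0)"
        using F by (auto simp: rot_deriv_def)
      then have "((\<lambda>h. (F (rot q h x) - F x) / h) \<longlongrightarrow> F' x) (at 0)"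
        by (simp add: has_field_derivative_iff)
      moreover have "filterlim t (at 0) sequentially"
        using t by (auto simp: filterlim_at)
      ultimately have "(\<lambda>n. (F (rot q (t n) x) - F x) / t n) \<longlonglongrightarrow> F' x"
        by (rule filterlim_compose)
      then show "(\<lambda>n. \<zeta> x * ((F (rot q (t n) x) - F x) / t n)) \<longlonglongrightarrow> \<zeta> x * F' x"
        by (intro tendsto_intros)
    qed
    show "AE x in sphere_area. norm (\<zeta> x * ((F (rot q (t n) x) - F x) / t n)) \<le> C * norm (\<zeta> x)" for n
    proof (rule AE_I2)
      fix x assume "x \<in> space sphere_area"
      then have "\<bar>\<zeta> x\<bar> * \<bar>(F (rot q (t n) x) - F x) / t n\<bar> \<le> \<bar>\<zeta> x\<bar> * C"
        using bnd by (intro mult_left_mono) auto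
      then show "norm (\<zeta> x * ((F (rot q (t n) x) - F x) / t n)) \<le> C * norm (\<zeta> x)"
        by (simp only: real_norm_def abs_mult mult.commute[of C])
    qed
  qed
qed

lemma integral_rot:
  fixes F :: "real^3 \<Rightarrow> real"
  assumes "norm q = 1" "F \<in> borel_measurable sphere_area"
  shows "(LINT x|sphere_area. F (rot q t x)) = (LINT x|sphere_area. F x)"
  using integral_sphere_orthogonal[OF orthogonal_transformation_rot] assms by blast

text \<open>Rotations preserve the measure, so the integral of \<open>F\<close> composed with a
  rotation is constant in the angle and its derivative is zero. In other words, rotation fields are
  divergence free.\<close>

lemma integral_rot_deriv:
  assumes q: "norm q = 1" and F: "rot_deriv q F F'"
    and cF: "continuous_on S2 F" and cF': "continuous_on S2 F'"
  shows "(LINT x|sphere_area. F' x) = 0"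
proof -
  have "(\<lambda>n::nat. LINT x|sphere_area. 1 * ((F (rot q (inverse (real (Suc n))) x) - F x) / inverse (real (Suc n))))
      \<longlonglongrightarrow> (LINT x|sphere_area. 1 * F' x)"
    by (rule tendsto_integral_rot_quotient[OF q F cF cF'])
       (use LIMSEQ_inverse_real_of_nat in auto)
  moreover have "(LINT x|sphere_area. 1 * ((F (rot q s x) - F x) / s)) = 0" for s
    using integral_rot[OF q borel_measurable_sphere_continuous[OF cF]]
      integrable_sphere_continuous[OF cF]
      integrable_sphere_continuous[OF continuous_on_sphere_compose_rot[OF q cF]]
    by simp
  ultimately have "(\<lambda>n::nat. 0::real) \<longlonglongrightarrow> (LINT x|sphere_area. 1 * F' x)"
    by (simp only:)
  then show ?thesis by (simp add: LIMSEQ_const_iff)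
qed

lemma integral_rot_deriv_parts:
  assumes q: "norm q = 1" and F: "rot_deriv q F F'" and G: "rot_deriv q G G'"
    and cont: "continuous_on S2 F" "continuous_on S2 F'" "continuous_on S2 G" "continuous_on S2 G'"
  shows "(LINT x|sphere_area. F' x * G x) = - (LINT x|sphere_area. F x * G' x)"
proof -
  have "(LINT x|sphere_area. F' x * G x + F x * G' x) = 0"
    using cont by (intro integral_rot_deriv[OF q rot_deriv_mult[OF F G]] continuous_intros)
  moreover have "integrable sphere_area (\<lambda>x. F' x * G x)" "integrable sphere_area (\<lambda>x. F x * G' x)"
    using cont by (auto intro!: integrable_sphere_continuous continuous_intros)
  ultimately show ?thesis by simp
qed

text \<open>With the Laplacian written as the sum of squares of the three coordinate rotation
  fields, Green's identity is one integration by parts for each field, without boundary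
  terms.\<close>

lemma green_identity:
  assumes f: "\<And>i. rot_deriv (axis i 1) f (f1 i)" "\<And>i. rot_deriv (axis i 1) (f1 i) (f2 i)"
    and g: "\<And>i. rot_deriv (axis i 1) g (g1 i)"
    and cont: "continuous_on S2 f" "\<And>i. continuous_on S2 (f1 i)" "\<And>i. continuous_on S2 (f2 i)"
      "continuous_on S2 g" "\<And>i. continuous_on S2 (g1 i)"
  shows "(LINT x|sphere_area. (\<Sum>i\<in>UNIV. f2 i x) * g x) =
    - (LINT x|sphere_area. (\<Sum>i\<in>UNIV. f1 i x * g1 i x))"
proof -
  have "(LINT x|sphere_area. (\<Sum>i\<in>UNIV. f2 i x) * g x) = (\<Sum>i\<in>UNIV. LINT x|sphere_area. f2 i x * g x)"
    using cont by (simp add: sum_distrib_right, subst Bochner_Integration.integral_sum)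
      (auto intro!: integrable_sphere_continuous continuous_intros)
  also have "\<dots> = (\<Sum>i\<in>UNIV. - (LINT x|sphere_area. f1 i x * g1 i x))"
    using f g cont by (intro sum.cong integral_rot_deriv_parts[of "axis _ 1"]) auto
  also have "\<dots> = - (LINT x|sphere_area. (\<Sum>i\<in>UNIV. f1 i x * g1 i x))"
    using cont by (subst Bochner_Integration.integral_sum)
      (auto simp: sum_negf intro!: integrable_sphere_continuous continuous_intros)
  finally show ?thesis .
qed

section \<open>The Legendre operator\<close>

text \<open>For a function \<open>x \<mapsto> k (x \<bullet> y)\<close> with \<open>y\<close> on the sphere, \<open>- \<Delta>\<close> acts on the profile \<open>k\<close>
  as the Legendre operator \<open>- (1 - t\<^sup>2) k'' + 2 t k'\<close>.\<close>

definition legendre_op :: "real poly \<Rightarrow> real poly" where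
  "legendre_op k = [:-1, 0, 1:] * pderiv (pderiv k) + [:0, 2:] * pderiv k"

lemma poly_legendre_op:
  "poly (legendre_op k) t = - (1 - t\<^sup>2) * poly (pderiv (pderiv k)) t + 2 * t * poly (pderiv k) t"
  by (simp add: legendre_op_def power2_eq_square algebra_simps)

text \<open>Since (e_i \<times> x) \<bullet> y is the i-th component of x \<times> y, the sum equals
  (x \<times> y) \<bullet> (x \<times> z), and this is Lagrange's identity. For unit
  \<open>x\<close> it is the inner product of the tangential parts of \<open>y\<close> and
  \<open>z\<close>.\<close>

lemma sum_cross_axis:
  "(\<Sum>i\<in>UNIV. (cross3 (axis i 1) x \<bullet> y) * (cross3 (axis i 1) x \<bullet> z)) = (x \<bullet> x) * (y \<bullet> z) - (x \<bullet> y) * (x \<bullet> z)"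
  by (simp add: sum_3 cross3_def inner_vec_def axis_def vector_def algebra_simps)

lemma sum_cross_cross_axis:
  "(\<Sum>i\<in>UNIV. cross3 (axis i 1) (cross3 (axis i 1) x) \<bullet> y) = - 2 * (x \<bullet> y)"
  by (simp add: sum_3 cross3_def inner_vec_def axis_def vector_def algebra_simps)

lemma rot_deriv_inner:
  assumes "norm q = 1" shows "rot_deriv q (\<lambda>x. x \<bullet> y) (\<lambda>x. cross3 q x \<bullet> y)"
  by (rule rot_deriv_has_derivative[OF assms]) (auto intro!: derivative_eq_intros)

lemma bounded_linear_cross3: "bounded_linear (cross3 q)"
  unfolding linear_conv_bounded_linear[symmetric]
  by (intro linearI) (simp_all add: cross_add_right cross_mult_right)

lemma rot_deriv_cross_inner:
  assumes "norm q = 1" shows "rot_deriv q (\<lambda>x. cross3 q x \<bullet> y) (\<lambda>x. cross3 q (cross3 q x) \<bullet> y)"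
  by (intro rot_deriv_has_derivative[OF assms] has_derivative_inner_left
      bounded_linear_imp_has_derivative bounded_linear_cross3)

lemma continuous_on_zonal:
  fixes k :: "real poly"
  shows "continuous_on A (\<lambda>x. poly k (x \<bullet> y))"
  by (intro continuous_intros)

text \<open>The last factor on the right is the inner product of the tangential parts of
  \<open>y\<close> and \<open>z\<close> at \<open>x\<close>, so the right side is the Dirichlet form
  of two zonal functions. It is unchanged under exchange of (\<open>k\<close>, \<open>y\<close>)
  with (\<open>l\<close>, \<open>z\<close>), which yields the symmetry of the Legendre
  operator.\<close>

lemma green_identity_zonal:
  assumes y: "y \<in> S2" and z: "z \<in> S2"
  shows "(LINT x|sphere_area. poly (legendre_op k) (x \<bullet> y) * poly l (x \<bullet> z)) =
    (LINT x|sphere_area. poly (pderiv k) (x \<bullet> y) * poly (pderiv l) (x \<bullet> z) * (y \<bullet> z - (x \<bullet> y) * (x \<bullet> z)))"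
proof -
  let ?c = "\<lambda>i x. cross3 (axis i 1) (x::real^3)"
  define f1 where "f1 = (\<lambda>k y i x. poly (pderiv k) (x \<bullet> y) * (?c i x \<bullet> y))"
  define f2 where "f2 = (\<lambda>k y i x. (poly (pderiv (pderiv k)) (x \<bullet> y) * (?c i x \<bullet> y)) * (?c i x \<bullet> y)
      + poly (pderiv k) (x \<bullet> y) * (?c i (?c i x) \<bullet> y))"
  have d1: "rot_deriv (axis i 1) (\<lambda>x. poly k (x \<bullet> y)) (f1 k y i)" for k y i
    unfolding f1_def by (intro rot_deriv_poly rot_deriv_inner) simp
  have d2: "rot_deriv (axis i 1) (f1 k y i) (f2 k y i)" for k y i
    unfolding f1_def f2_def
    by (intro rot_deriv_mult rot_deriv_poly rot_deriv_inner rot_deriv_cross_inner) simp_all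
  have "(LINT x|sphere_area. (\<Sum>i\<in>UNIV. f2 k y i x) * poly l (x \<bullet> z)) =
      - (LINT x|sphere_area. (\<Sum>i\<in>UNIV. f1 k y i x * f1 l z i x))"
  proof (rule green_identity[OF d1 d2 d1])
    show "continuous_on S2 (f1 k y i)" "continuous_on S2 (f1 l z i)" "continuous_on S2 (f2 k y i)" for i
      unfolding f1_def f2_def by (intro continuous_intros continuous_on_cross)+
  qed (intro continuous_intros)+
  moreover have F2: "(\<Sum>i\<in>UNIV. f2 k y i x) = - poly (legendre_op k) (x \<bullet> y)" if "x \<in> S2" for x
  proof -
    have "(\<Sum>i\<in>UNIV. f2 k y i x) = poly (pderiv (pderiv k)) (x \<bullet> y) *
        (\<Sum>i\<in>UNIV. (?c i x \<bullet> y) * (?c i x \<bullet> y)) + poly (pderiv k) (x \<bullet> y) * (\<Sum>i\<in>UNIV. ?c i (?c i x) \<bullet> y)"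
      by (simp add: f2_def sum.distrib sum_distrib_left mult.assoc)
    also have "\<dots> = - poly (legendre_op k) (x \<bullet> y)"
      unfolding sum_cross_axis sum_cross_cross_axis using that y
      by (simp add: poly_legendre_op dot_square_norm power2_eq_square algebra_simps)
    finally show ?thesis .
  qed
  moreover have F1: "(\<Sum>i\<in>UNIV. f1 k y i x * f1 l z i x) =
     poly (pderiv k) (x \<bullet> y) * poly (pderiv l) (x \<bullet> z) * (y \<bullet> z - (x \<bullet> y) * (x \<bullet> z))" if "x \<in> S2" for x
  proof -
    have "(\<Sum>i\<in>UNIV. f1 k y i x * f1 l z i x) =
     poly (pderiv k) (x \<bullet> y) * poly (pderiv l) (x \<bullet> z) * (\<Sum>i\<in>UNIV. (?c i x \<bullet> y) * (?c i x \<bullet> z))"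
      by (simp add: f1_def sum_distrib_left mult_ac)
    then show ?thesis unfolding sum_cross_axis using that by (simp add: dot_square_norm)
  qed
  moreover have "(LINT x|sphere_area. (\<Sum>i\<in>UNIV. f2 k y i x) * poly l (x \<bullet> z)) =
      (LINT x|sphere_area. - poly (legendre_op k) (x \<bullet> y) * poly l (x \<bullet> z))"
    by (intro Bochner_Integration.integral_cong refl) (simp add: F2)
  moreover have "(LINT x|sphere_area. (\<Sum>i\<in>UNIV. f1 k y i x * f1 l z i x)) =
    (LINT x|sphere_area. poly (pderiv k) (x \<bullet> y) * poly (pderiv l) (x \<bullet> z) * (y \<bullet> z - (x \<bullet> y) * (x \<bullet> z)))"
    by (intro Bochner_Integration.integral_cong refl) (simp add: F1)
  ultimately have "(LINT x|sphere_area. - poly (legendre_op k) (x \<bullet> y) * poly l (x \<bullet> z)) =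
    - (LINT x|sphere_area. poly (pderiv k) (x \<bullet> y) * poly (pderiv l) (x \<bullet> z) * (y \<bullet> z - (x \<bullet> y) * (x \<bullet> z)))"
    by simp
  then show ?thesis by simp
qed

lemma legendre_op_symmetric:
  assumes y: "y \<in> S2" and z: "z \<in> S2"
  shows "(LINT x|sphere_area. poly (legendre_op k) (x \<bullet> y) * poly l (x \<bullet> z)) =
    (LINT x|sphere_area. poly k (x \<bullet> y) * poly (legendre_op l) (x \<bullet> z))"
  using green_identity_zonal[OF y z, of k l] green_identity_zonal[OF z y, of l k]
  by (simp add: mult_ac inner_commute)

lemma smult_sum_right: "smult c (\<Sum>i\<in>A. f i) = (\<Sum>i\<in>A. smult c (f i))"
  by (induction A rule: infinite_finite_induct) (simp_all add: smult_add_right)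

lemma legendre_op_smult: "legendre_op (smult c k) = smult c (legendre_op k)"
  by (simp add: legendre_op_def pderiv_smult smult_add_right)

lemma legendre_op_add: "legendre_op (k + l) = legendre_op k + legendre_op l"
  by (simp only: legendre_op_def pderiv_add distrib_left add_ac)

lemma legendre_op_0 [simp]: "legendre_op 0 = 0"
  by (simp add: legendre_op_def)

lemma legendre_op_diff: "legendre_op (k - l) = legendre_op k - legendre_op l"
  using legendre_op_add[of k "smult (-1) l"] by (simp only: legendre_op_smult) simp

lemma legendre_op_sum: "legendre_op (\<Sum>i\<in>A. f i) = (\<Sum>i\<in>A. legendre_op (f i))"
  by (induction A rule: infinite_finite_induct) (simp_all add: legendre_op_add)

text \<open>In the monomial basis the operator is triangular with diagonal entries n (n + 1). It
  does not raise the degree, and its eigenvalues are pairwise distinct; the decomposition into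
  eigenvectors rests on these two facts.\<close>

lemma coeff_legendre_op:
  "coeff (legendre_op k) n = real (n * (n + 1)) * coeff k n - real ((n + 1) * (n + 2)) * coeff k (n + 2)"
proof -
  have "legendre_op k = pCons 0 (pCons 0 (pderiv (pderiv k))) - pderiv (pderiv k) + smult 2 (pCons 0 (pderiv k))"
    by (simp add: legendre_op_def)
  then have "coeff (legendre_op k) n = coeff (pCons 0 (pCons 0 (pderiv (pderiv k)))) n
      - coeff (pderiv (pderiv k)) n + 2 * coeff (pCons 0 (pderiv k)) n"
    by (simp only: coeff_add coeff_diff coeff_smult)
  moreover have d2: "coeff (pderiv (pderiv k)) i = real (i + 1) * real (i + 2) * coeff k (i + 2)" for i
    by (simp add: coeff_pderiv)
  moreover have "coeff (pCons 0 (pCons 0 (pderiv (pderiv k)))) n = real n * (real n - 1) * coeff k n"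
    by (auto simp: coeff_pCons d2 split: nat.split)
  moreover have "coeff (pCons 0 (pderiv k)) n = real n * coeff k n"
    by (auto simp: coeff_pCons coeff_pderiv split: nat.split)
  ultimately have "coeff (legendre_op k) n = real n * (real n - 1) * coeff k n
      - real (n + 1) * real (n + 2) * coeff k (n + 2) + 2 * (real n * coeff k n)"
    by presburger
  then show ?thesis
    by (simp only: of_nat_mult of_nat_add of_nat_1) (simp add: algebra_simps)
qed

text \<open>Subtracting the eigenvalue of the top degree kills the top coefficient, so the induction
  hypothesis applies to the remainder \<open>k'\<close>. Inverting this shifted operator on the
  lower eigenvectors recovers all components of \<open>k\<close> except the last, which is what is
  left over. Some components may be zero.\<close>

theorem legendre_decomposition:
  assumes "degree k \<le> N"
  shows "\<exists>P. (\<forall>n. degree (P n) \<le> n \<and> legendre_op (P n) = smult (real (n * (n + 1))) (P n))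
    \<and> k = (\<Sum>n\<le>N. P n)"
  using assms
proof (induction N arbitrary: k)
  case 0
  then have "legendre_op k = 0"
  proof (intro poly_eqI)
    fix n
    show "coeff (legendre_op k) n = coeff 0 n"
      using 0 by (cases n) (simp_all add: coeff_legendre_op coeff_eq_0)
  qed
  with 0 show ?case
    by (intro exI[of _ "\<lambda>n. if n = 0 then k else 0"]) auto
next
  case (Suc N)
  define c where "c = (\<lambda>n. real (n * (n + 1)))"
  have cN: "c n \<noteq> c (Suc N)" if "n \<le> N" for n
  proof -
    have "n * (n + 1) < Suc N * (Suc N + 1)"
      using that by (intro mult_less_le_imp_less) auto
    then show ?thesis unfolding c_def by linarith
  qed
  define k' where "k' = legendre_op k - smult (c (Suc N)) k"
  have "degree k' \<le> N"
  proof (rule degree_le, intro allI impI)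
    fix i assume "N < i"
    then consider "i = Suc N" | "Suc N < i" by linarith
    then show "coeff k' i = 0"
      using Suc.prems by cases (simp_all add: k'_def c_def coeff_legendre_op coeff_eq_0 algebra_simps)
  qed
  from Suc.IH[OF this] obtain Q where
    Q: "\<And>n. degree (Q n) \<le> n" "\<And>n. legendre_op (Q n) = smult (c n) (Q n)" "k' = (\<Sum>n\<le>N. Q n)"
    unfolding c_def by blast
  \<comment> \<open>On an eigenvector for \<open>c n\<close> the shifted operator is multiplication
    by \<open>c n - c (Suc N)\<close>, which is nonzero for n \<le> N; dividing by it inverts the
    operator there.\<close>
  define R where "R = (\<lambda>n. smult (1 / (c n - c (Suc N))) (Q n))"
  have R: "degree (R n) \<le> n" "legendre_op (R n) = smult (c n) (R n)" for n
    unfolding R_def by (rule order_trans[OF degree_smult_le Q(1)])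
      (simp add: legendre_op_smult Q(2) mult.commute)
  define P where "P = (\<lambda>n. if n = Suc N then k - (\<Sum>n\<le>N. R n) else R n)"
  have "degree (\<Sum>n\<le>N. R n) \<le> Suc N"
    by (intro degree_sum_le finite_atMost order_trans[OF R(1)]) simp
  then have deg: "degree (k - (\<Sum>n\<le>N. R n)) \<le> Suc N"
    using Suc.prems by (intro degree_diff_le)
  have "legendre_op (k - (\<Sum>n\<le>N. R n)) = k' + smult (c (Suc N)) k - (\<Sum>n\<le>N. smult (c n) (R n))"
    by (simp add: legendre_op_diff legendre_op_sum R(2) k'_def)
  also have "k' = (\<Sum>n\<le>N. smult (c n - c (Suc N)) (R n))"
    unfolding Q(3) by (intro sum.cong refl) (use cN in \<open>auto simp: R_def\<close>)
  finally have leg: "legendre_op (k - (\<Sum>n\<le>N. R n)) = smult (c (Suc N)) (k - (\<Sum>n\<le>N. R n))"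
    by (simp add: smult_diff_left smult_diff_right sum_subtractf smult_sum_right)
  have "(\<Sum>n\<le>N. P n) = (\<Sum>n\<le>N. R n)"
    by (intro sum.cong refl) (auto simp: P_def)
  then have "k = (\<Sum>n\<le>Suc N. P n)"
    by (simp add: P_def)
  moreover have "degree (P n) \<le> n \<and> legendre_op (P n) = smult (c n) (P n)" for n
    using R deg leg by (cases "n = Suc N") (auto simp: P_def)
  ultimately show ?case
    unfolding c_def by blast
qed

interpretation sphere_pair: pair_sigma_finite sphere_area sphere_area
  by (simp add: pair_sigma_finite_def sphere_area.sigma_finite_measure_axioms)

section \<open>Zonal convolution operators\<close>

text \<open>The variable \<open>y\<close> ranges over the whole space and not only over the sphere.
  The convolution is thus a polynomial in \<open>y\<close> and has ordinary Euclidean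
  derivatives.\<close>

definition zconv :: "real poly \<Rightarrow> (real^3 \<Rightarrow> real) \<Rightarrow> real^3 \<Rightarrow> real" where
  "zconv k w y = (LINT x|sphere_area. poly k (x \<bullet> y) * w x)"

lemma integrable_zonal_mult:
  fixes w :: "real^3 \<Rightarrow> real"
  shows "integrable sphere_area w \<Longrightarrow> integrable sphere_area (\<lambda>x. poly k (x \<bullet> y) * w x)"
  using integrable_sphere_mult[OF continuous_on_zonal, of w] by simp

lemma zconv_0 [simp]: "zconv 0 w y = 0"
  by (simp add: zconv_def)

lemma zconv_add:
  "integrable sphere_area w \<Longrightarrow> zconv (k + l) w y = zconv k w y + zconv l w y"
  by (simp add: zconv_def distrib_right integrable_zonal_mult)

lemma zconv_smult: "zconv (smult c k) w y = c * zconv k w y"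
  by (simp add: zconv_def mult.assoc)

lemma zconv_sum:
  "integrable sphere_area w \<Longrightarrow> zconv (\<Sum>i\<in>A. k i) w y = (\<Sum>i\<in>A. zconv (k i) w y)"
  by (induction A rule: infinite_finite_induct) (simp_all add: zconv_add)

lemma zconv_diff_right:
  "integrable sphere_area w \<Longrightarrow> integrable sphere_area v \<Longrightarrow>
    zconv k (\<lambda>x. w x - v x) y = zconv k w y - zconv k v y"
  by (simp add: zconv_def right_diff_distrib integrable_zonal_mult)

lemma zconv_mult_right: "zconv k (\<lambda>x. c * w x) y = c * zconv k w y"
  by (simp add: zconv_def mult.left_commute)

lemma zconv_cong:
  "(\<And>x. x \<in> S2 \<Longrightarrow> w x = v x) \<Longrightarrow> zconv k w y = zconv k v y"
  unfolding zconv_def by (intro Bochner_Integration.integral_cong) auto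

lemma zconv_cong_AE:
  assumes "integrable sphere_area w" "integrable sphere_area v" "AE x in sphere_area. w x = v x"
  shows "zconv k w y = zconv k v y"
  unfolding zconv_def
  using assms borel_measurable_sphere_continuous[OF continuous_on_zonal[of S2 k y]]
  by (intro integral_cong_AE) (auto elim!: eventually_mono)

text \<open>Horner's scheme for the kernel: one factor \<open>x \<bullet> y\<close> is split into
  components, where \<open>y $ i\<close> leaves the integral and \<open>x $ i\<close> joins
  \<open>w\<close>. Induction on the kernel with arbitrary \<open>w\<close> then gives derivatives
  and smoothness without differentiating under the integral.\<close>

lemma zconv_pCons:
  assumes w: "integrable sphere_area w"
  shows "zconv (pCons a k) w y =
    a * (LINT x|sphere_area. w x) + (\<Sum>i\<in>UNIV. y $ i * zconv k (\<lambda>x. x $ i * w x) y)"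
proof -
  have int: "integrable sphere_area (\<lambda>x. x $ i * w x)" for i
    using integrable_sphere_mult[of "\<lambda>x. x $ i" w] w by (simp add: continuous_on_component)
  have "zconv (pCons a k) w y = (LINT x|sphere_area. a * w x + (\<Sum>i\<in>UNIV. y $ i * (poly k (x \<bullet> y) * (x $ i * w x))))"
    unfolding zconv_def
    by (intro Bochner_Integration.integral_cong refl)
      (simp add: inner_vec_def sum_distrib_left sum_distrib_right algebra_simps)
  also have "\<dots> = a * (LINT x|sphere_area. w x) + (\<Sum>i\<in>UNIV. y $ i * zconv k (\<lambda>x. x $ i * w x) y)"
    unfolding zconv_def
    using integrable_zonal_mult[OF int] w
    by (subst Bochner_Integration.integral_add)
       (auto simp: Bochner_Integration.integral_sum intro!: Bochner_Integration.integrable_sum)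
  finally show ?thesis .
qed

lemma integrable_component_mult:
  fixes w :: "real^3 \<Rightarrow> real"
  shows "integrable sphere_area w \<Longrightarrow> integrable sphere_area (\<lambda>x. x $ i * w x)"
  using integrable_sphere_mult[of "\<lambda>x. x $ i" w] by (simp add: continuous_on_component)

lemma integrable_inner_mult:
  fixes w :: "real^3 \<Rightarrow> real"
  shows "integrable sphere_area w \<Longrightarrow> integrable sphere_area (\<lambda>x. (v \<bullet> x) * w x)"
  using integrable_sphere_mult[of "\<lambda>x. v \<bullet> x" w] by (simp add: continuous_intros)

lemma zconv_inner_sum:
  assumes w: "integrable sphere_area w"
  shows "zconv k (\<lambda>x. (v \<bullet> x) * w x) y = (\<Sum>i\<in>UNIV. v $ i * zconv k (\<lambda>x. x $ i * w x) y)"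
proof -
  have "zconv k (\<lambda>x. (v \<bullet> x) * w x) y = (LINT x|sphere_area. (\<Sum>i\<in>UNIV. v $ i * (poly k (x \<bullet> y) * (x $ i * w x))))"
    unfolding zconv_def
    by (intro Bochner_Integration.integral_cong refl)
      (simp add: inner_vec_def sum_distrib_left sum_distrib_right algebra_simps)
  then show ?thesis
    unfolding zconv_def
    using integrable_zonal_mult[OF integrable_component_mult[OF w]]
    by (simp add: Bochner_Integration.integral_sum)
qed

lemma has_derivative_zconv:
  assumes "integrable sphere_area w"
  shows "(zconv k w has_derivative (\<lambda>v. zconv (pderiv k) (\<lambda>x. (v \<bullet> x) * w x) y)) (at y)"
  using assms
proof (induction k arbitrary: w)
  case 0
  have "zconv 0 w = (\<lambda>y. 0)" by (simp add: fun_eq_iff)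
  then show ?case by simp
next
  case (pCons a k)
  note w = pCons.prems
  have wi: "integrable sphere_area (\<lambda>x. x $ i * w x)" for i
    using integrable_component_mult[OF w] .
  have "((\<lambda>y. a * (LINT x|sphere_area. w x) + (\<Sum>i\<in>UNIV. y $ i * zconv k (\<lambda>x. x $ i * w x) y)) has_derivative
     (\<lambda>v. 0 + (\<Sum>i\<in>UNIV. y $ i * zconv (pderiv k) (\<lambda>x. (v \<bullet> x) * (x $ i * w x)) y + v $ i * zconv k (\<lambda>x. x $ i * w x) y))) (at y)"
    by (intro has_derivative_add has_derivative_sum has_derivative_const has_derivative_mult
        pCons.IH[OF wi] bounded_linear_imp_has_derivative bounded_linear_vec_nth)
  moreover have "zconv (pCons a k) w = (\<lambda>y. a * (LINT x|sphere_area. w x) + (\<Sum>i\<in>UNIV. y $ i * zconv k (\<lambda>x. x $ i * w x) y))"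
    using zconv_pCons[OF w] by blast
  moreover have "0 + (\<Sum>i\<in>UNIV. y $ i * zconv (pderiv k) (\<lambda>x. (v \<bullet> x) * (x $ i * w x)) y + v $ i * zconv k (\<lambda>x. x $ i * w x) y)
     = zconv (pderiv (pCons a k)) (\<lambda>x. (v \<bullet> x) * w x) y" for v
  proof -
    have "zconv (pderiv (pCons a k)) (\<lambda>x. (v \<bullet> x) * w x) y =
       zconv k (\<lambda>x. (v \<bullet> x) * w x) y + zconv (pCons 0 (pderiv k)) (\<lambda>x. (v \<bullet> x) * w x) y"
      using w by (simp only: pderiv_pCons zconv_add[OF integrable_inner_mult])
    then show ?thesis
      using zconv_pCons[OF integrable_inner_mult[OF w], of 0 "pderiv k" v y] zconv_inner_sum[OF w, of k v y]
      by (simp add: sum.distrib mult.left_commute)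
  qed
  ultimately show ?case by (simp only:)
qed

lemma continuous_on_zconv [continuous_intros]:
  assumes "integrable sphere_area w"
  shows "continuous_on A (zconv k w)"
  by (intro continuous_at_imp_continuous_on ballI has_derivative_continuous[OF has_derivative_zconv[OF assms]])

lemma integrable_zconv [simp]: "integrable sphere_area w \<Longrightarrow> integrable sphere_area (zconv k w)"
  by (rule integrable_sphere_continuous[OF continuous_on_zconv])

lemma zconv_rot:
  assumes q: "norm q = 1" and w: "integrable sphere_area w"
  shows "zconv k (\<lambda>x. w (rot q \<theta> x)) y = zconv k w (rot q \<theta> y)"
proof -
  have "rot q \<theta> x \<bullet> rot q \<theta> y = x \<bullet> y" for x
    using orthogonal_transformation_rot[OF q] by (simp add: orthogonal_transformation_def)
  then have "zconv k (\<lambda>x. w (rot q \<theta> x)) y =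
      (LINT x|sphere_area. (\<lambda>x. poly k (x \<bullet> rot q \<theta> y) * w x) (rot q \<theta> x))"
    by (simp add: zconv_def)
  also have "\<dots> = zconv k w (rot q \<theta> y)"
    using integrable_zonal_mult[OF w] unfolding zconv_def
    by (intro integral_rot[OF q]) auto
  finally show ?thesis .
qed

lemma measurable_zonal_pair [measurable]:
  "(\<lambda>(x, y). poly k (x \<bullet> y)) \<in> borel_measurable (sphere_area \<Otimes>\<^sub>M sphere_area)"
proof -
  have id: "(\<lambda>x. x) \<in> sphere_area \<rightarrow>\<^sub>M borel"
    by (intro borel_measurable_sphere_continuous continuous_on_id)
  have "(\<lambda>z. fst z) \<in> sphere_area \<Otimes>\<^sub>M sphere_area \<rightarrow>\<^sub>M borel" "(\<lambda>z. snd z) \<in> sphere_area \<Otimes>\<^sub>M sphere_area \<rightarrow>\<^sub>M borel"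
    using measurable_compose[OF measurable_fst id] measurable_compose[OF measurable_snd id] by auto
  then have 1: "(\<lambda>z. fst z \<bullet> snd z) \<in> borel_measurable (sphere_area \<Otimes>\<^sub>M sphere_area)"
    by (rule borel_measurable_inner)
  have "poly k \<in> borel_measurable borel"
    by (intro borel_measurable_continuous_onI continuous_intros)
  from measurable_compose[OF 1 this] show ?thesis by (simp add: case_prod_beta')
qed

text \<open>The kernel is symmetric in its two points, so convolution is self-adjoint. Fubini
  applies because a polynomial is bounded on [-1, 1], where all inner products of unit vectors
  lie.\<close>

lemma zconv_fubini:
  assumes w: "integrable sphere_area w" and f: "continuous_on S2 f"
  shows "(LINT y|sphere_area. zconv k w y * f y) = (LINT x|sphere_area. w x * zconv k f x)"
proof -
  let ?g = "\<lambda>x y. poly k (x \<bullet> y) * w x * f y"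
  have fi: "integrable sphere_area f" using f by (rule integrable_sphere_continuous)
  have [measurable]: "w \<in> borel_measurable sphere_area" "f \<in> borel_measurable sphere_area"
    using w fi by auto
  have meas: "(\<lambda>(x, y). ?g x y) \<in> borel_measurable (sphere_area \<Otimes>\<^sub>M sphere_area)"
    using measurable_zonal_pair[of k] by (simp add: case_prod_beta') measurable
  obtain C where C: "\<And>t. \<bar>t\<bar> \<le> 1 \<Longrightarrow> \<bar>poly k t\<bar> \<le> C"
  proof -
    have "compact (poly k ` {-1..1})"
      by (intro compact_continuous_image continuous_intros) auto
    then have "bounded (poly k ` {-1..1})" by (rule compact_imp_bounded)
    then obtain C where C: "\<forall>z\<in>poly k ` {-1..1}. norm z \<le> C" by (auto simp: bounded_iff)
    show ?thesis
    proof (rule that[of C])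
      fix t :: real assume "\<bar>t\<bar> \<le> 1"
      then have "t \<in> {-1..1}" by auto
      then show "\<bar>poly k t\<bar> \<le> C" using C by force
    qed
  qed
  have xy: "\<bar>x \<bullet> y\<bar> \<le> 1" if "x \<in> S2" "y \<in> S2" for x y
    using Cauchy_Schwarz_ineq2[of x y] that by simp
  have "integrable (sphere_area \<Otimes>\<^sub>M sphere_area) (\<lambda>(x, y). w x * f y)"
    by (rule sphere_pair.Fubini_integrable) (use w fi in \<open>auto simp: abs_mult\<close>)
  then have int: "integrable (sphere_area \<Otimes>\<^sub>M sphere_area) (\<lambda>(x, y). ?g x y)"
  proof (rule Bochner_Integration.integrable_bound[OF integrable_mult_right[where c = C] meas])
    show "AE z in sphere_area \<Otimes>\<^sub>M sphere_area. norm (case z of (x, y) \<Rightarrow> ?g x y) \<le> norm (C * (case z of (x, y) \<Rightarrow> w x * f y))"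
    proof (rule AE_I2)
      fix z assume "z \<in> space (sphere_area \<Otimes>\<^sub>M sphere_area)"
      then obtain x y where z: "z = (x, y)" "x \<in> S2" "y \<in> S2" by (auto simp: space_pair_measure)
      then have "\<bar>poly k (x \<bullet> y)\<bar> * \<bar>w x * f y\<bar> \<le> \<bar>C\<bar> * \<bar>w x * f y\<bar>"
        using C[OF xy, of x y] by (intro mult_right_mono) auto
      then show "norm (case z of (x, y) \<Rightarrow> ?g x y) \<le> norm (C * (case z of (x, y) \<Rightarrow> w x * f y))"
        by (simp add: z abs_mult mult_ac)
    qed
  qed
  have "(LINT y|sphere_area. zconv k w y * f y) = (LINT y|sphere_area. LINT x|sphere_area. ?g x y)"
    by (simp add: zconv_def)
  also have "\<dots> = (LINT x|sphere_area. LINT y|sphere_area. ?g x y)"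
    by (rule sphere_pair.Fubini_integral[OF int])
  also have "\<dots> = (LINT x|sphere_area. w x * zconv k f x)"
    by (simp add: zconv_def inner_commute mult_ac flip: Bochner_Integration.integral_mult_right_zero)
  finally show ?thesis .
qed

text \<open>After Fubini both sides integrate \<open>v\<close> against the convolution of the two
  kernels, and there the symmetry of the Legendre operator moves it from one kernel to the
  other.\<close>

lemma zconv_legendre_swap:
  assumes v: "integrable sphere_area v" and x: "x \<in> S2"
  shows "zconv k (zconv (legendre_op l) v) x = zconv (legendre_op k) (zconv l v) x"
proof -
  have *: "zconv k (zconv l v) x = (LINT z|sphere_area. v z * (LINT y|sphere_area. poly l (y \<bullet> z) * poly k (y \<bullet> x)))" for k l
    using zconv_fubini[OF v continuous_on_zonal[of S2 k x], of l]
    by (simp add: zconv_def mult.commute)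
  show ?thesis
    unfolding * using legendre_op_symmetric x
    by (intro Bochner_Integration.integral_cong refl) simp
qed

text \<open>Moving the operator from one kernel to the other multiplies the same double convolution
  by \<open>a\<close> on one side and by \<open>b\<close> on the other.\<close>

lemma zconv_eigen_orthogonal:
  assumes P: "legendre_op P = smult a P" and Q: "legendre_op Q = smult b Q" and ab: "a \<noteq> b"
    and w: "integrable sphere_area w" and x: "x \<in> S2"
  shows "zconv P (zconv Q w) x = 0"
proof -
  have "zconv (legendre_op Q) w = (\<lambda>y. b * zconv Q w y)"
    by (simp add: Q zconv_smult fun_eq_iff)
  then have "a * zconv P (zconv Q w) x = b * zconv P (zconv Q w) x"
    using zconv_legendre_swap[OF w x, of P Q] by (auto simp: P zconv_smult zconv_mult_right)
  then show ?thesis using ab by auto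
qed

lemma integral_zconv_eigen_orthogonal:
  assumes P: "legendre_op P = smult a P" and Q: "legendre_op Q = smult b Q" and ab: "a \<noteq> b"
    and w: "integrable sphere_area w" and v: "integrable sphere_area v"
  shows "(LINT x|sphere_area. zconv P w x * zconv Q v x) = 0"
proof -
  have "(LINT x|sphere_area. zconv P w x * zconv Q v x) = (LINT x|sphere_area. w x * zconv P (zconv Q v) x)"
    by (intro zconv_fubini w continuous_on_zconv v)
  also have "\<dots> = (LINT x|sphere_area. 0)"
    by (intro Bochner_Integration.integral_cong refl) (simp add: zconv_eigen_orthogonal[OF P Q ab v])
  finally show ?thesis by simp
qed

section \<open>An approximate identity of zonal kernels\<close>

text \<open>The kernel ((1 + t) / 2)^n is nonnegative on [-1, 1] and concentrates at t = 1, that is,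
  where the two points coincide. Its mass is evaluated at one arbitrary pole; by rotation invariance
  the pole does not matter.\<close>

definition peak_mass :: "nat \<Rightarrow> real" where
  "peak_mass n = zconv ([:1/2, 1/2:] ^ n) (\<lambda>_. 1) (axis 1 1)"

definition peak :: "nat \<Rightarrow> real poly" where
  "peak n = smult (1 / peak_mass n) ([:1/2, 1/2:] ^ n)"

lemma zconv_one_const:
  assumes "y \<in> S2" "z \<in> S2"
  shows "zconv k (\<lambda>_. 1) y = zconv k (\<lambda>_. 1) z"
proof -
  obtain f where f: "orthogonal_transformation f" "f z = y"
    using orthogonal_transformation_exists[of z y] assms by auto
  have "f x \<bullet> y = x \<bullet> z" for x
    using f by (auto simp: orthogonal_transformation_def)
  then have "zconv k (\<lambda>_. 1) z = (LINT x|sphere_area. (\<lambda>x. poly k (x \<bullet> y)) (f x))"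
    by (simp add: zconv_def)
  also have "\<dots> = zconv k (\<lambda>_. 1) y"
    unfolding zconv_def
    using borel_measurable_sphere_continuous[OF continuous_on_zonal[of S2 k y]]
    by (subst integral_sphere_orthogonal[OF f(1)]) auto
  finally show ?thesis by simp
qed

lemma inner_sphere_bounds:
  assumes "x \<in> S2" "y \<in> S2"
  shows "-1 \<le> x \<bullet> y" "x \<bullet> y \<le> 1"
  using Cauchy_Schwarz_ineq2[of x y] assms by (auto simp: abs_le_iff)

text \<open>On the cap of points with inner product above 1 - \<delta> the kernel is at least (1 -
  \<delta>/2)^n, and the cap has positive area \<open>c\<close>. The base of this lower bound can be
  brought as close to 1 as desired, which beats the decay of the kernel outside a larger
  cap.\<close>

lemma peak_mass_lower:
  assumes "0 < \<delta>" "\<delta> < 1"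
  obtains c where "0 < c" "\<And>n. c * (1 - \<delta> / 2) ^ n \<le> peak_mass n"
proof -
  define e where "e = (axis 1 1 :: real^3)"
  define U where "U = {x. 1 - \<delta> < x \<bullet> e}"
  have U: "open U" unfolding U_def by (intro open_Collect_less continuous_intros)
  have e: "e \<in> S2" by (simp add: e_def)
  then have "e \<bullet> e = 1" by (simp add: dot_square_norm)
  then have eU: "e \<in> U" using assms by (simp add: U_def)
  define c where "c = measure sphere_area (U \<inter> S2)"
  have meas: "U \<inter> S2 \<in> sets sphere_area" using U by (auto simp: sets_restrict_space)
  have "0 < c"
    using emeasure_sphere_area_open_pos[OF U eU e]
    by (simp add: c_def sphere_area.emeasure_eq_measure)
  moreover have "c * (1 - \<delta> / 2) ^ n \<le> peak_mass n" for n
  proof -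
    have "c * (1 - \<delta> / 2) ^ n = (LINT x|sphere_area. indicator (U \<inter> S2) x * (1 - \<delta> / 2) ^ n)"
      using meas by (simp add: c_def)
    also have "\<dots> \<le> (LINT x|sphere_area. poly ([:1/2, 1/2:] ^ n) (x \<bullet> e) * 1)"
    proof (rule integral_mono)
      show "integrable sphere_area (\<lambda>x. indicator (U \<inter> S2) x * (1 - \<delta> / 2) ^ n)"
        using meas by (intro integrable_mult_left) (simp add: sphere_area.emeasure_eq_measure)
      show "integrable sphere_area (\<lambda>x. poly ([:1/2, 1/2:] ^ n) (x \<bullet> e) * 1)"
        by (intro integrable_zonal_mult) simp
      fix x assume "x \<in> space sphere_area"
      then have "-1 \<le> x \<bullet> e" using inner_sphere_bounds[of x e] e by simp
      then show "indicator (U \<inter> S2) x * (1 - \<delta> / 2) ^ n \<le> poly ([:1/2, 1/2:] ^ n) (x \<bullet> e) * 1"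
        using assms by (auto simp: indicator_def U_def intro!: power_mono)
    qed
    also have "\<dots> = peak_mass n" by (simp add: peak_mass_def zconv_def e_def)
    finally show ?thesis .
  qed
  ultimately show ?thesis using that by blast
qed

lemma peak_mass_pos: "0 < peak_mass n"
proof -
  obtain c where c: "0 < c" "\<And>n. c * (1 - (1/2) / 2) ^ n \<le> peak_mass n"
    using peak_mass_lower[of "1/2"] by auto
  have "0 < c * (1 - (1/2) / 2) ^ n" using c(1) by simp
  then show ?thesis using c(2)[of n] by linarith
qed

lemma poly_peak: "poly (peak n) t = ((1 + t) / 2) ^ n / peak_mass n"
  by (simp add: peak_def add_divide_distrib)

lemma peak_nonneg: "x \<in> S2 \<Longrightarrow> y \<in> S2 \<Longrightarrow> 0 \<le> poly (peak n) (x \<bullet> y)"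
  using inner_sphere_bounds[of x y] peak_mass_pos[of n] by (simp add: poly_peak)

lemma zconv_peak_one: "y \<in> S2 \<Longrightarrow> zconv (peak n) (\<lambda>_. 1) y = 1"
  using zconv_one_const[of y "axis 1 1" "[:1/2, 1/2:] ^ n"] peak_mass_pos[of n]
  by (simp add: peak_def zconv_smult peak_mass_def)

lemma zconv_peak_bound:
  assumes w: "integrable sphere_area w" and C: "\<And>x. x \<in> S2 \<Longrightarrow> \<bar>w x\<bar> \<le> C" and y: "y \<in> S2"
  shows "\<bar>zconv (peak n) w y\<bar> \<le> C"
proof -
  have "\<bar>zconv (peak n) w y\<bar> \<le> (LINT x|sphere_area. \<bar>poly (peak n) (x \<bullet> y) * w x\<bar>)"
    unfolding zconv_def by (rule integral_abs_bound)
  also have "\<dots> \<le> (LINT x|sphere_area. C * (poly (peak n) (x \<bullet> y) * 1))"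
    using integrable_abs[OF integrable_zonal_mult[OF w, of "peak n" y]] integrable_zonal_mult[of "\<lambda>_. 1" "peak n" y]
      C peak_nonneg[OF _ y]
    by (intro integral_mono) (auto simp: abs_mult mult.commute[of C] intro!: mult_left_mono)
  also have "\<dots> = C * zconv (peak n) (\<lambda>_. 1) y"
    by (simp add: zconv_def)
  finally show ?thesis using zconv_peak_one[OF y] by simp
qed

theorem uniform_limit_zconv_peak:
  assumes w: "continuous_on S2 w"
  shows "uniform_limit S2 (\<lambda>n. zconv (peak n) w) w sequentially"
proof (rule uniform_limitI)
  fix \<epsilon> :: real assume "0 < \<epsilon>"
  have wi: "integrable sphere_area w" using w by (rule integrable_sphere_continuous)
  obtain C where C: "0 \<le> C" "\<And>x. x \<in> S2 \<Longrightarrow> norm (w x) \<le> C"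
    using continuous_on_sphere_bounded[OF w] by metis
  have "uniformly_continuous_on S2 w"
    using w by (intro compact_uniformly_continuous) auto
  then obtain \<eta> where \<eta>: "0 < \<eta>" "\<And>x y. x \<in> S2 \<Longrightarrow> y \<in> S2 \<Longrightarrow> dist x y < \<eta> \<Longrightarrow> dist (w x) (w y) < \<epsilon> / 2"
    using \<open>0 < \<epsilon>\<close> unfolding uniformly_continuous_on_def by (metis half_gt_zero)
  \<comment> \<open>For unit vectors the squared distance is 2 - 2 (x \<bullet> y), so the cap of
    size \<open>\<delta>\<close> lies within distance \<open>\<eta>\<close>. The bound 1/2 only
    keeps \<open>\<delta>\<close> below 1.\<close>
  define \<delta> where "\<delta> = min (\<eta>\<^sup>2 / 2) (1 / 2)"
  have \<delta>: "0 < \<delta>" "\<delta> < 1" "2 * \<delta> \<le> \<eta>\<^sup>2" using \<eta>(1) by (auto simp: \<delta>_def min_def)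
  obtain c where c: "0 < c" "\<And>n. c * (1 - \<delta> / 2 / 2) ^ n \<le> peak_mass n"
    using peak_mass_lower[of "\<delta> / 2"] \<delta> by auto
  \<comment> \<open>The numerator bounds the base of the kernel outside the cap of size
    \<open>\<delta>\<close>; the denominator is the base of the mass bound from the cap of half that
    size. Halving the cap makes the quotient smaller than 1.\<close>
  define r where "r = (1 - \<delta> / 2) / (1 - \<delta> / 2 / 2)"
  have r: "0 \<le> r" "r < 1" using \<delta> by (auto simp: r_def field_simps)
  define M where "M = 2 * C * measure sphere_area S2 / c"
  have M: "0 \<le> M" using C(1) c(1) by (simp add: M_def)
  have *: "\<bar>zconv (peak n) w y - w y\<bar> \<le> \<epsilon> / 2 + M * r ^ n" if y: "y \<in> S2" for n y
  proof -
    define b where "b = (1 - \<delta> / 2) ^ n / peak_mass n"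
    have b: "b \<le> r ^ n / c"
    proof -
      have "b \<le> (1 - \<delta> / 2) ^ n / (c * (1 - \<delta> / 2 / 2) ^ n)"
        unfolding b_def using c \<delta> peak_mass_pos[of n] by (intro divide_left_mono) auto
      then show ?thesis by (simp add: r_def power_divide mult.commute)
    qed
    have pt: "poly (peak n) (x \<bullet> y) * \<bar>w x - w y\<bar> \<le> (\<epsilon> / 2) * poly (peak n) (x \<bullet> y) + 2 * C * b"
      if x: "x \<in> S2" for x
    proof (cases "1 - \<delta> < x \<bullet> y")
      case True
      have "(dist x y)\<^sup>2 = 2 - 2 * (x \<bullet> y)"
      proof -
        have "x \<bullet> x = 1" "y \<bullet> y = 1" using x y by (simp_all add: dot_square_norm)
        then show ?thesis
          by (simp add: dist_norm power2_norm_eq_inner inner_diff_left inner_diff_right inner_commute)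
      qed
      also have "\<dots> < \<eta>\<^sup>2" using True \<delta>(3) by linarith
      finally have "dist x y < \<eta>" using \<eta>(1) by (meson less_le power2_less_imp_less)
      then have "\<bar>w x - w y\<bar> \<le> \<epsilon> / 2" using \<eta>(2)[OF x y] by (simp add: dist_real_def)
      then have "poly (peak n) (x \<bullet> y) * \<bar>w x - w y\<bar> \<le> poly (peak n) (x \<bullet> y) * (\<epsilon> / 2)"
        using peak_nonneg[OF x y] by (intro mult_left_mono)
      moreover have "0 \<le> 2 * C * b" using C(1) \<delta> peak_mass_pos[of n] by (simp add: b_def)
      ultimately show ?thesis using mult.commute[of "poly (peak n) (x \<bullet> y)" "\<epsilon> / 2"] by linarith
    next
      case False
      have "poly (peak n) (x \<bullet> y) \<le> b"
        unfolding poly_peak b_def using False inner_sphere_bounds[OF x y] peak_mass_pos[of n]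
        by (intro divide_right_mono power_mono) auto
      moreover have "\<bar>w x - w y\<bar> \<le> 2 * C"
        using C(2)[OF x] C(2)[OF y] by simp
      ultimately have "poly (peak n) (x \<bullet> y) * \<bar>w x - w y\<bar> \<le> b * (2 * C)"
        using peak_nonneg[OF x y, of n] by (intro mult_mono) auto
      moreover have "0 \<le> (\<epsilon> / 2) * poly (peak n) (x \<bullet> y)"
        using peak_nonneg[OF x y, of n] \<open>0 < \<epsilon>\<close> by simp
      ultimately show ?thesis by (simp add: mult_ac)
    qed
    have k1: "integrable sphere_area (\<lambda>x. poly (peak n) (x \<bullet> y))"
      using integrable_zonal_mult[of "\<lambda>_. 1" "peak n" y] by simp
    have kd: "integrable sphere_area (\<lambda>x. poly (peak n) (x \<bullet> y) * (w x - w y))"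
      using wi by (intro integrable_zonal_mult) auto
    have "zconv (peak n) w y - w y = zconv (peak n) (\<lambda>x. w x - w y) y"
      using wi zconv_mult_right[of "peak n" "w y" "\<lambda>_. 1" y]
      by (simp add: zconv_diff_right zconv_peak_one[OF y])
    also have "\<bar>\<dots>\<bar> \<le> (LINT x|sphere_area. \<bar>poly (peak n) (x \<bullet> y) * (w x - w y)\<bar>)"
      unfolding zconv_def by (rule integral_abs_bound)
    also have "\<dots> \<le> (LINT x|sphere_area. (\<epsilon> / 2) * poly (peak n) (x \<bullet> y) + 2 * C * b)"
      using k1 integrable_abs[OF kd] pt peak_nonneg[OF _ y] by (intro integral_mono) (auto simp: abs_mult)
    also have "\<dots> = (\<epsilon> / 2) * zconv (peak n) (\<lambda>_. 1) y + 2 * C * b * measure sphere_area S2"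
      using k1 by (simp add: zconv_def)
    also have "\<dots> \<le> \<epsilon> / 2 + M * r ^ n"
    proof -
      have "2 * C * b * measure sphere_area S2 \<le> 2 * C * (r ^ n / c) * measure sphere_area S2"
        using b C(1) by (intro mult_right_mono mult_left_mono) auto
      then show ?thesis using zconv_peak_one[OF y] by (simp add: M_def mult_ac)
    qed
    finally show ?thesis .
  qed
  have "(\<lambda>n. M * r ^ n) \<longlonglongrightarrow> M * 0"
    using r by (intro tendsto_intros LIMSEQ_realpow_zero) auto
  then have "\<forall>\<^sub>F n in sequentially. M * r ^ n < \<epsilon> / 2"
    using \<open>0 < \<epsilon>\<close> by (auto dest!: order_tendstoD(2)[of _ _ _ "\<epsilon> / 2"])
  then show "\<forall>\<^sub>F n in sequentially. \<forall>x\<in>S2. dist (zconv (peak n) w x) (w x) < \<epsilon>"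
  proof eventually_elim
    case (elim n)
    show ?case
    proof
      fix y assume "y \<in> S2"
      from *[OF this, of n] elim show "dist (zconv (peak n) w y) (w y) < \<epsilon>"
        by (simp add: dist_real_def)
    qed
  qed
qed

text \<open>Convolution with a nonnegative kernel of mass one does not increase the maximum, so the
  second smoothing adds at most the error of the first. Double smoothing arises when both factors of
  a product are smoothed and self-adjointness moves both kernels to one factor.\<close>

lemma uniform_limit_zconv_peak_twice:
  assumes w: "continuous_on S2 w"
  shows "uniform_limit S2 (\<lambda>n. zconv (peak n) (zconv (peak n) w)) w sequentially"
proof (rule uniform_limitI)
  fix \<epsilon> :: real assume "0 < \<epsilon>"
  have wi: "integrable sphere_area w" using w by (rule integrable_sphere_continuous)
  have "\<forall>\<^sub>F n in sequentially. \<forall>x\<in>S2. dist (zconv (peak n) w x) (w x) < \<epsilon> / 2"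
    using \<open>0 < \<epsilon>\<close> by (intro uniform_limitD[OF uniform_limit_zconv_peak[OF w]]) simp
  then show "\<forall>\<^sub>F n in sequentially. \<forall>x\<in>S2. dist (zconv (peak n) (zconv (peak n) w) x) (w x) < \<epsilon>"
  proof eventually_elim
    case (elim n)
    show ?case
    proof
      fix y assume y: "y \<in> S2"
      have "zconv (peak n) (zconv (peak n) w) y - zconv (peak n) w y = zconv (peak n) (\<lambda>x. zconv (peak n) w x - w x) y"
        using wi by (simp add: zconv_diff_right)
      also have "\<bar>\<dots>\<bar> \<le> \<epsilon> / 2"
        using wi elim by (intro zconv_peak_bound[OF _ _ y]) (auto simp: dist_real_def intro: less_imp_le)
      finally have "\<bar>zconv (peak n) (zconv (peak n) w) y - zconv (peak n) w y\<bar> \<le> \<epsilon> / 2" .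
      moreover have "\<bar>zconv (peak n) w y - w y\<bar> < \<epsilon> / 2" using elim y by (simp add: dist_real_def)
      ultimately show "dist (zconv (peak n) (zconv (peak n) w) y) (w y) < \<epsilon>"
        unfolding dist_real_def by linarith
    qed
  qed
qed

lemma tendsto_integral_uniform_limit:
  fixes h g :: "real^3 \<Rightarrow> real"
  assumes h: "integrable sphere_area h" and f: "\<And>n. continuous_on S2 (f n)" "continuous_on S2 g"
    and lim: "uniform_limit S2 f g sequentially"
  shows "(\<lambda>n. LINT x|sphere_area. h x * f n x) \<longlonglongrightarrow> (LINT x|sphere_area. h x * g x)"
proof -
  obtain C where C: "0 \<le> C" "\<And>x. x \<in> S2 \<Longrightarrow> norm (g x) \<le> C"
    using continuous_on_sphere_bounded[OF f(2)] by metis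
  obtain N where N: "\<And>n x. N \<le> n \<Longrightarrow> x \<in> S2 \<Longrightarrow> dist (f n x) (g x) < 1"
    using uniform_limitD[OF lim, of 1] by (fastforce simp: eventually_sequentially)
  have m: "(\<lambda>x. h x * v x) \<in> borel_measurable sphere_area" if "continuous_on S2 v" for v
    by (rule borel_measurable_times[OF borel_measurable_integrable[OF h]
        borel_measurable_sphere_continuous[OF that]])
  have "(\<lambda>n. LINT x|sphere_area. h x * f (n + N) x) \<longlonglongrightarrow> (LINT x|sphere_area. h x * g x)"
  proof (rule integral_dominated_convergence[OF m[OF f(2)] m[OF f(1)]])
    show "integrable sphere_area (\<lambda>x. \<bar>h x\<bar> * (C + 1))" using h by simp
    show "AE x in sphere_area. (\<lambda>n. h x * f (n + N) x) \<longlonglongrightarrow> h x * g x"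
    proof (rule AE_I2)
      fix x assume "x \<in> space sphere_area"
      then have "(\<lambda>n. f n x) \<longlonglongrightarrow> g x" using tendsto_uniform_limitI[OF lim] by simp
      then have "(\<lambda>n. f (n + N) x) \<longlonglongrightarrow> g x" by (rule LIMSEQ_ignore_initial_segment)
      then show "(\<lambda>n. h x * f (n + N) x) \<longlonglongrightarrow> h x * g x" by (intro tendsto_intros)
    qed
    show "AE x in sphere_area. norm (h x * f (n + N) x) \<le> \<bar>h x\<bar> * (C + 1)" for n
    proof (rule AE_I2)
      fix x assume "x \<in> space sphere_area"
      then have "\<bar>f (n + N) x\<bar> \<le> C + 1"
        using N[of "n + N" x] C(2)[of x] by (simp add: dist_real_def)
      then show "norm (h x * f (n + N) x) \<le> \<bar>h x\<bar> * (C + 1)"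
        by (simp add: abs_mult mult_left_mono)
    qed
  qed
  then show ?thesis by (rule LIMSEQ_offset)
qed

section \<open>Smoothness of zonal functions\<close>

lemma Ck_on_cong:
  assumes "open S" "\<And>x. x \<in> S \<Longrightarrow> f x = g x" "Ck_on k S f"
  shows "Ck_on k S g"
  using assms(2,3)
proof (induction k arbitrary: f g)
  case 0
  then show ?case using continuous_on_cong[of S S f g] by simp
next
  case (Suc k)
  have df: "f differentiable (at x)" if "x \<in> S" for x using Suc.prems(2) that by simp
  have "g differentiable (at x)" if x: "x \<in> S" for x
    using df[OF x] has_derivative_transform_within_open[OF _ \<open>open S\<close> x] Suc.prems(1)
    unfolding differentiable_def by blast
  moreover have "Ck_on k S (\<lambda>x. frechet_derivative g (at x) (axis i 1))" for i
  proof (rule Suc.IH)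
    show "Ck_on k S (\<lambda>x. frechet_derivative f (at x) (axis i 1))" using Suc.prems(2) by simp
    show "frechet_derivative f (at x) (axis i 1) = frechet_derivative g (at x) (axis i 1)" if "x \<in> S" for x
      using frechet_derivative_transform_within_open[OF df[OF that] \<open>open S\<close> that] Suc.prems(1) by auto
  qed
  ultimately show ?case by simp
qed

lemma Ck_on_SucI:
  assumes "open S" and f: "\<And>x. x \<in> S \<Longrightarrow> (f has_derivative f' x) (at x)"
    and "\<And>i. Ck_on k S (\<lambda>x. f' x (axis i 1))"
  shows "Ck_on (Suc k) S f"
proof -
  have "Ck_on k S (\<lambda>x. frechet_derivative f (at x) (axis i 1))" for i
    using frechet_derivative_at[OF f] by (intro Ck_on_cong[OF assms(1) _ assms(3)[of i]]) simp
  then show ?thesis using f by (auto simp: differentiable_def)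
qed

lemma Ck_on_Suc_imp: "Ck_on (Suc k) S f \<Longrightarrow> Ck_on k S f"
proof (induction k arbitrary: f)
  case 0
  then show ?case
    by (auto intro!: continuous_at_imp_continuous_on differentiable_imp_continuous_within)
next
  case (Suc k)
  then show ?case by auto
qed

lemma Ck_on_has_derivative:
  "Ck_on (Suc k) S f \<Longrightarrow> x \<in> S \<Longrightarrow> (f has_derivative frechet_derivative f (at x)) (at x)"
  by (simp add: frechet_derivative_works)

lemma Ck_on_const:
  assumes "open S" shows "Ck_on k S (\<lambda>x. c)"
proof (induction k arbitrary: c)
  case (Suc k)
  show ?case by (rule Ck_on_SucI[OF assms has_derivative_const Suc.IH])
qed simp

lemma Ck_on_add:
  assumes "open S" shows "Ck_on k S f \<Longrightarrow> Ck_on k S g \<Longrightarrow> Ck_on k S (\<lambda>x. f x + g x)"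
proof (induction k arbitrary: f g)
  case (Suc k)
  show ?case
    by (rule Ck_on_SucI[OF assms has_derivative_add[OF Ck_on_has_derivative[OF Suc.prems(1)]
          Ck_on_has_derivative[OF Suc.prems(2)]]]) (use Suc in auto)
qed (simp add: continuous_on_add)

lemma Ck_on_mult:
  assumes "open S" shows "Ck_on k S f \<Longrightarrow> Ck_on k S g \<Longrightarrow> Ck_on k S (\<lambda>x. f x * g x)"
proof (induction k arbitrary: f g)
  case (Suc k)
  have "Ck_on k S f" "Ck_on k S g" using Suc.prems Ck_on_Suc_imp by blast+
  then show ?case
    by (intro Ck_on_SucI[OF assms has_derivative_mult[OF Ck_on_has_derivative[OF Suc.prems(1)]
          Ck_on_has_derivative[OF Suc.prems(2)]]] Ck_on_add[OF assms] Suc.IH) (use Suc.prems in auto)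
qed (simp add: continuous_on_mult)

lemma Ck_on_sum:
  assumes "open S" shows "(\<And>i. i \<in> A \<Longrightarrow> Ck_on k S (f i)) \<Longrightarrow> Ck_on k S (\<lambda>x. \<Sum>i\<in>A. f i x)"
  by (induction A rule: infinite_finite_induct) (simp_all add: Ck_on_const Ck_on_add assms)

lemma Ck_on_component:
  assumes "open S" shows "Ck_on k S (\<lambda>x. x $ i)"
proof (cases k)
  case 0
  then show ?thesis by (simp add: continuous_on_component)
next
  case (Suc l)
  show ?thesis unfolding Suc
    by (rule Ck_on_SucI[OF assms bounded_linear_imp_has_derivative[OF bounded_linear_vec_nth] Ck_on_const[OF assms]])
qed

text \<open>The partial derivatives are products of a coordinate and powers of the function itself,
  so the induction on the order of differentiability closes.\<close>

lemma Ck_on_inverse_norm: "Ck_on k (- {0}) (\<lambda>x. inverse (norm x))"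
proof (induction k)
  case 0
  show ?case by (auto intro!: continuous_intros)
next
  case (Suc k)
  let ?N = "\<lambda>x. inverse (norm (x::real^3))"
  show ?case
  proof (rule Ck_on_SucI)
    show "open (- {0::real^3})" by auto
    fix x :: "real^3" assume "x \<in> - {0}"
    then show "(?N has_derivative (\<lambda>v. - (?N x * (v \<bullet> sgn x) * ?N x))) (at x)"
      by (intro Deriv.has_derivative_inverse has_derivative_norm) auto
  next
    fix i :: 3
    have "Ck_on k (- {0}) (\<lambda>x. (-1) * (?N x * (x $ i * ?N x) * ?N x))"
      by (intro Ck_on_mult Ck_on_component Ck_on_const Suc.IH) auto
    then show "Ck_on k (- {0}) (\<lambda>x. - (?N x * (axis i 1 \<bullet> sgn x) * ?N x))"
      by (rule Ck_on_cong[rotated 2]) (auto simp: inner_axis' sgn_div_norm divide_inverse)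
  qed
qed

lemma Ck_on_sgn_component: "Ck_on k (- {0}) (\<lambda>x. sgn x $ i)"
proof -
  have "Ck_on k (- {0}) (\<lambda>x. x $ i * inverse (norm x))"
    by (intro Ck_on_mult Ck_on_component Ck_on_inverse_norm) auto
  then show ?thesis
    by (rule Ck_on_cong[rotated 2]) (auto simp: sgn_div_norm divide_inverse)
qed

lemma sphere_smooth_zonal: "sphere_smooth (\<lambda>x. poly k (x \<bullet> y))"
proof -
  have "Ck_on n (- {0}) (\<lambda>x. poly k (sgn x \<bullet> y))" for n
  proof (induction k)
    case 0
    show ?case by (simp, rule Ck_on_const) auto
  next
    case (pCons a k)
    have "Ck_on n (- {0}) (\<lambda>x. a + (\<Sum>i\<in>UNIV. sgn x $ i * y $ i) * poly k (sgn x \<bullet> y))"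
      by (intro Ck_on_add Ck_on_mult Ck_on_const Ck_on_sum Ck_on_sgn_component pCons.IH) auto
    then show ?case
      by (rule Ck_on_cong[rotated 2]) (auto simp: inner_vec_def)
  qed
  then show ?thesis by (simp add: sphere_smooth_def o_def)
qed

lemma sphere_smooth_zconv:
  assumes "integrable sphere_area w"
  shows "sphere_smooth (zconv k w)"
proof -
  have "Ck_on n (- {0}) (\<lambda>x. zconv k w (sgn x))" for n
    using assms
  proof (induction k arbitrary: w)
    case 0
    show ?case by (simp, rule Ck_on_const) auto
  next
    case (pCons a k)
    have "Ck_on n (- {0}) (\<lambda>x. a * (LINT x|sphere_area. w x) +
        (\<Sum>i\<in>UNIV. sgn x $ i * zconv k (\<lambda>x. x $ i * w x) (sgn x)))"
      using pCons.prems
      by (intro Ck_on_add Ck_on_mult Ck_on_const Ck_on_sum Ck_on_sgn_component pCons.IH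
          integrable_component_mult) auto
    then show ?case
      by (rule Ck_on_cong[rotated 2]) (auto simp: zconv_pCons[OF pCons.prems])
  qed
  then show ?thesis by (simp add: sphere_smooth_def o_def)
qed

section \<open>Differential operators on zonal functions\<close>

lemma has_derivative_sgn_unit:
  fixes x :: "real^3"
  assumes "x \<in> S2"
  shows "(sgn has_derivative (\<lambda>v. v - (x \<bullet> v) *\<^sub>R x)) (at x)"
proof -
  have n: "norm x = 1" "x \<noteq> 0" "sgn x = x" using assms by (auto simp: sgn_div_norm)
  have "((\<lambda>x. inverse (norm x) *\<^sub>R x) has_derivative
      (\<lambda>v. inverse (norm x) *\<^sub>R v + (- (inverse (norm x) * (v \<bullet> sgn x) * inverse (norm x))) *\<^sub>R x)) (at x)"
    by (rule has_derivative_scaleR[OF Deriv.has_derivative_inverse[OF _ has_derivative_norm[OF n(2)]] has_derivative_ident])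
      (simp add: n(2))
  moreover have "(\<lambda>x. inverse (norm x) *\<^sub>R x) = (sgn :: real^3 \<Rightarrow> _)"
    by (simp add: fun_eq_iff sgn_div_norm)
  ultimately show ?thesis using n by (simp add: inner_commute)
qed

lemma has_derivative_comp_sgn:
  assumes x: "x \<in> S2" and F: "(F has_derivative F') (at x)"
  shows "(F \<circ> sgn has_derivative (\<lambda>v. F' (v - (x \<bullet> v) *\<^sub>R x))) (at x)"
proof -
  have "sgn x = x" using x by (simp add: sgn_div_norm)
  then have "(F has_derivative F') (at (sgn x))" using F by simp
  from has_derivative_compose[OF has_derivative_sgn_unit[OF x] this] show ?thesis by (simp add: o_def)
qed

lemma surf_grad_eq:
  assumes x: "x \<in> S2" and f: "(f has_derivative (\<lambda>v. v \<bullet> M)) (at x)"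
  shows "surf_grad f x = M - (x \<bullet> M) *\<^sub>R x"
  unfolding surf_grad_def frechet_derivative_at[OF has_derivative_comp_sgn[OF x f], symmetric]
  by (simp add: vec_eq_iff inner_diff_left inner_axis' inner_axis)

lemma has_derivative_zonal:
  "((\<lambda>x. poly k (x \<bullet> y)) has_derivative (\<lambda>v. v \<bullet> (poly (pderiv k) (x \<bullet> y) *\<^sub>R y))) (at x)"
proof -
  have "((\<lambda>x. x \<bullet> y) has_derivative (\<lambda>v. v \<bullet> y)) (at x)"
    by (intro has_derivative_inner_left has_derivative_ident)
  moreover have "(poly k has_derivative (*) (poly (pderiv k) (x \<bullet> y))) (at (x \<bullet> y))"
    using poly_DERIV[of k "x \<bullet> y"] by (simp add: has_field_derivative_def)
  ultimately show ?thesis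
    using has_derivative_compose[of "\<lambda>x. x \<bullet> y" "\<lambda>v. v \<bullet> y" x UNIV "poly k"] by simp
qed

lemma surf_grad_zonal:
  assumes x: "x \<in> S2"
  shows "surf_grad (\<lambda>x. poly k (x \<bullet> y)) x = poly (pderiv k) (x \<bullet> y) *\<^sub>R (y - (x \<bullet> y) *\<^sub>R x)"
  by (simp add: surf_grad_eq[OF x has_derivative_zonal] scaleR_diff_right)

text \<open>The gradient field is k'(s) times the tangential part y - s x of y, with s = x \<bullet>
  y. Precomposition with \<open>sgn\<close> replaces a direction by its tangential part, and the
  trace of the resulting derivative is (1 - s^2) k'' - 2 s k'.\<close>

lemma surf_laplacian_zonal:
  assumes x: "x \<in> S2" and y: "y \<in> S2"
  shows "surf_laplacian (\<lambda>x. poly k (x \<bullet> y)) x = - poly (legendre_op k) (x \<bullet> y)"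
proof -
  define G where "G = (\<lambda>z. poly (pderiv k) (z \<bullet> y) *\<^sub>R (y - (z \<bullet> y) *\<^sub>R z))"
  define s where "s = x \<bullet> y"
  define k1 where "k1 = poly (pderiv k) s"
  define k2 where "k2 = poly (pderiv (pderiv k)) s"
  have G': "(G has_derivative (\<lambda>v. k1 *\<^sub>R (0 - (s *\<^sub>R v + (v \<bullet> y) *\<^sub>R x)) + (v \<bullet> (k2 *\<^sub>R y)) *\<^sub>R (y - s *\<^sub>R x))) (at x)"
    unfolding G_def s_def k1_def k2_def
    by (intro has_derivative_scaleR has_derivative_zonal has_derivative_diff has_derivative_const
        has_derivative_inner_left has_derivative_ident)
  let ?T = "\<lambda>v. v - (x \<bullet> v) *\<^sub>R x"
  let ?L = "\<lambda>v. k1 *\<^sub>R (0 - (s *\<^sub>R ?T v + (?T v \<bullet> y) *\<^sub>R x)) + (?T v \<bullet> (k2 *\<^sub>R y)) *\<^sub>R (y - s *\<^sub>R x)"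
  have "(G \<circ> sgn has_derivative ?L) (at x)"
    by (rule has_derivative_comp_sgn[OF x G'])
  then have "(surf_grad (\<lambda>x. poly k (x \<bullet> y)) \<circ> sgn has_derivative ?L) (at x)"
  proof (rule has_derivative_transform_within_open)
    show "open (- {0::real^3})" by auto
    show "x \<in> - {0}" using x by auto
    show "(G \<circ> sgn) z = (surf_grad (\<lambda>x. poly k (x \<bullet> y)) \<circ> sgn) z" if "z \<in> - {0}" for z
      using that by (simp add: surf_grad_zonal norm_sgn G_def)
  qed
  then have "surf_laplacian (\<lambda>x. poly k (x \<bullet> y)) x = trace (matrix ?L)"
    unfolding surf_laplacian_def surf_div_def by (simp only: frechet_derivative_at[symmetric])
  also have "\<dots> = (\<Sum>i\<in>UNIV. ?L (axis i 1) $ i)"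
    by (simp add: trace_def matrix_def)
  also have "\<dots> = (\<Sum>i\<in>UNIV. k1 * (s * (x $ i * x $ i) - s - (y $ i * x $ i - s * (x $ i * x $ i)))
      + k2 * (y $ i * y $ i - 2 * s * (x $ i * y $ i) + s\<^sup>2 * (x $ i * x $ i)))"
    by (intro sum.cong refl)
      (simp add: inner_diff_left inner_axis inner_axis' s_def[symmetric] power2_eq_square algebra_simps)
  also have "\<dots> = k1 * (s * (x \<bullet> x) - 3 * s - ((y \<bullet> x) - s * (x \<bullet> x))) +
      k2 * (y \<bullet> y - 2 * s * (x \<bullet> y) + s\<^sup>2 * (x \<bullet> x))"
    by (simp add: inner_vec_def sum_3 algebra_simps)
  also have "\<dots> = - poly (legendre_op k) s"
    using x y by (simp add: poly_legendre_op k1_def k2_def s_def inner_commute[of y x] dot_square_norm power2_eq_square algebra_simps)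
  finally show ?thesis by (simp add: s_def)
qed

text \<open>The equation \<open>- \<Delta> w = h\<close>, tested against all zonal polynomials.\<close>

definition zonal_poisson :: "(real^3 \<Rightarrow> real) \<Rightarrow> (real^3 \<Rightarrow> real) \<Rightarrow> bool" where
  "zonal_poisson w h \<longleftrightarrow> (\<forall>k. \<forall>y\<in>S2. zconv (legendre_op k) w y = zconv k h y)"

lemma weak_laplacian_zonal_poisson:
  assumes "has_weak_laplacian w (\<lambda>x. - h x)"
  shows "zonal_poisson w h"
  unfolding zonal_poisson_def
proof (intro allI ballI)
  fix k y assume y: "y \<in> S2"
  have "(LINT x|sphere_area. w x * surf_laplacian (\<lambda>x. poly k (x \<bullet> y)) x) =
      (LINT x|sphere_area. w x * - poly (legendre_op k) (x \<bullet> y))"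
    using surf_laplacian_zonal[OF _ y, of _ k]
    by (intro Bochner_Integration.integral_cong refl) simp
  moreover have "(LINT x|sphere_area. w x * surf_laplacian (\<lambda>x. poly k (x \<bullet> y)) x) =
      (LINT x|sphere_area. - h x * poly k (x \<bullet> y))"
    using assms sphere_smooth_zonal unfolding has_weak_laplacian_def by blast
  ultimately show "zconv (legendre_op k) w y = zconv k h y"
    by (simp add: zconv_def mult.commute)
qed

lemma zonal_poisson_rot_diff:
  assumes p: "zonal_poisson w h" and w: "integrable sphere_area w" and h: "integrable sphere_area h"
    and q: "norm q = 1"
  shows "zonal_poisson (\<lambda>x. w (rot q \<theta> x) - w x) (\<lambda>x. h (rot q \<theta> x) - h x)"
proof -
  have "integrable sphere_area (\<lambda>x. w (rot q \<theta> x))" "integrable sphere_area (\<lambda>x. h (rot q \<theta> x))"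
    using integrable_sphere_orthogonal[OF orthogonal_transformation_rot[OF q]] w h by blast+
  then show ?thesis
    using p q w h by (simp add: zonal_poisson_def zconv_diff_right zconv_rot[OF q])
qed

section \<open>The Dirichlet energy of zonal convolutions\<close>

text \<open>This is the Euclidean gradient of the polynomial extension of the convolution. It has a
  radial part in general, which disappears when paired with a rotation field or after tangential
  projection.\<close>

definition zconv_grad :: "real poly \<Rightarrow> (real^3 \<Rightarrow> real) \<Rightarrow> real^3 \<Rightarrow> real^3" where
  "zconv_grad k w x = (\<chi> i. zconv (pderiv k) (\<lambda>y. y $ i * w y) x)"

lemma has_derivative_zconv_grad:
  assumes "integrable sphere_area w"
  shows "(zconv k w has_derivative (\<lambda>v. v \<bullet> zconv_grad k w x)) (at x)"
  using has_derivative_zconv[OF assms, of k x]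
  unfolding zconv_inner_sum[OF assms] zconv_grad_def by (simp add: inner_vec_def)

lemma rot_deriv_zconv:
  assumes "norm q = 1" "integrable sphere_area w"
  shows "rot_deriv q (zconv k w) (\<lambda>x. cross3 q x \<bullet> zconv_grad k w x)"
  using has_derivative_zconv_grad[OF assms(2)] by (intro rot_deriv_has_derivative[OF assms(1)])

lemma continuous_on_zconv_grad [continuous_intros]:
  assumes "integrable sphere_area w" shows "continuous_on A (zconv_grad k w)"
  unfolding zconv_grad_def
  by (intro continuous_on_vec_lambda continuous_on_zconv integrable_component_mult assms)

lemma rot_deriv_sum:
  assumes "\<And>i. i \<in> A \<Longrightarrow> rot_deriv q (F i) (F' i)"
  shows "rot_deriv q (\<lambda>x. \<Sum>i\<in>A. F i x) (\<lambda>x. \<Sum>i\<in>A. F' i x)"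
  using assms unfolding rot_deriv_def by (auto intro!: DERIV_sum)

text \<open>Green's identity with both functions equal to the convolution. The squares of the three
  rotational derivatives add up to the squared surface gradient by Lagrange's identity, while the
  second derivatives add up, under the integral, to the negative Legendre operator on the
  kernel.\<close>

lemma integral_surf_grad_zconv:
  assumes w: "integrable sphere_area w"
  shows "(LINT x|sphere_area. (norm (surf_grad (zconv k w) x))\<^sup>2) =
    (LINT x|sphere_area. zconv k w x * zconv (legendre_op k) w x)"
proof -
  let ?c = "\<lambda>i x. cross3 (axis i 1) (x::real^3)"
  note wa = integrable_component_mult[OF w]
  define f1 where "f1 = (\<lambda>i x. \<Sum>a\<in>UNIV. ?c i x $ a * zconv (pderiv k) (\<lambda>y. y $ a * w y) x)"
  define f2 where "f2 = (\<lambda>i x. \<Sum>a\<in>UNIV. ?c i (?c i x) $ a * zconv (pderiv k) (\<lambda>y. y $ a * w y) x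
      + ?c i x $ a * (?c i x \<bullet> zconv_grad (pderiv k) (\<lambda>y. y $ a * w y) x))"
  have f1: "f1 i x = ?c i x \<bullet> zconv_grad k w x" for i x
    by (simp add: f1_def zconv_grad_def inner_vec_def)
  have d1: "rot_deriv (axis i 1) (zconv k w) (f1 i)" for i
    unfolding f1 by (intro rot_deriv_zconv w) simp
  have dc: "rot_deriv (axis i 1) (\<lambda>x. ?c i x $ a) (\<lambda>x. ?c i (?c i x) $ a)" for i a
    by (rule rot_deriv_has_derivative)
      (auto intro!: bounded_linear_imp_has_derivative bounded_linear_compose[OF bounded_linear_vec_nth bounded_linear_cross3])
  have d2: "rot_deriv (axis i 1) (f1 i) (f2 i)" for i
    unfolding f1_def f2_def by (intro rot_deriv_sum rot_deriv_mult dc rot_deriv_zconv wa) simp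
  have c1: "continuous_on S2 (f1 i)" for i
    unfolding f1 by (intro continuous_intros continuous_on_cross w)
  have c2: "continuous_on S2 (f2 i)" for i
    unfolding f2_def by (intro continuous_intros continuous_on_cross wa)
  have lap: "(\<Sum>i\<in>UNIV. f2 i x) = - zconv (legendre_op k) w x" if x: "x \<in> S2" for x
  proof -
    have f2: "f2 i x = zconv (pderiv k) (\<lambda>y. (?c i (?c i x) \<bullet> y) * w y) x
        + zconv (pderiv (pderiv k)) (\<lambda>y. (?c i x \<bullet> y) * ((?c i x \<bullet> y) * w y)) x" for i
    proof -
      have "?c i x \<bullet> zconv_grad (pderiv k) (\<lambda>y. y $ a * w y) x =
         zconv (pderiv (pderiv k)) (\<lambda>y. y $ a * ((?c i x \<bullet> y) * w y)) x" for a
        by (simp add: zconv_grad_def inner_vec_def[of _ "vec_lambda _"]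
            zconv_inner_sum[OF wa, symmetric] mult.left_commute)
      then show ?thesis
        using zconv_inner_sum[OF w, of "pderiv k" "?c i (?c i x)" x]
          zconv_inner_sum[OF integrable_inner_mult[OF w], of "pderiv (pderiv k)" "?c i x" "?c i x" x]
        by (simp add: f2_def sum.distrib)
    qed
    have "(\<Sum>i\<in>UNIV. f2 i x) = (LINT y|sphere_area. (\<Sum>i\<in>UNIV.
        poly (pderiv k) (y \<bullet> x) * ((?c i (?c i x) \<bullet> y) * w y)
        + poly (pderiv (pderiv k)) (y \<bullet> x) * ((?c i x \<bullet> y) * ((?c i x \<bullet> y) * w y))))"
      unfolding f2 zconv_def
      by (simp add: Bochner_Integration.integral_sum integrable_zonal_mult integrable_inner_mult w)
    also have "\<dots> = (LINT y|sphere_area. - (poly (legendre_op k) (y \<bullet> x) * w y))"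
    proof (intro Bochner_Integration.integral_cong refl)
      fix y assume y: "y \<in> space sphere_area"
      have "(\<Sum>i\<in>UNIV. poly (pderiv k) (y \<bullet> x) * ((?c i (?c i x) \<bullet> y) * w y)
          + poly (pderiv (pderiv k)) (y \<bullet> x) * ((?c i x \<bullet> y) * ((?c i x \<bullet> y) * w y)))
        = poly (pderiv k) (y \<bullet> x) * w y * (\<Sum>i\<in>UNIV. ?c i (?c i x) \<bullet> y)
          + poly (pderiv (pderiv k)) (y \<bullet> x) * w y * (\<Sum>i\<in>UNIV. (?c i x \<bullet> y) * (?c i x \<bullet> y))"
        by (simp add: sum.distrib sum_distrib_left mult_ac)
      also have "\<dots> = - (poly (legendre_op k) (y \<bullet> x) * w y)"
        unfolding sum_cross_axis sum_cross_cross_axis using x y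
        by (simp add: poly_legendre_op dot_square_norm inner_commute[of y x] power2_eq_square algebra_simps)
      finally show "(\<Sum>i\<in>UNIV. poly (pderiv k) (y \<bullet> x) * ((?c i (?c i x) \<bullet> y) * w y)
          + poly (pderiv (pderiv k)) (y \<bullet> x) * ((?c i x \<bullet> y) * ((?c i x \<bullet> y) * w y)))
        = - (poly (legendre_op k) (y \<bullet> x) * w y)" .
    qed
    finally show ?thesis by (simp add: zconv_def)
  qed
  have grad: "(\<Sum>i\<in>UNIV. f1 i x * f1 i x) = (norm (surf_grad (zconv k w) x))\<^sup>2" if x: "x \<in> S2" for x
  proof -
    have xx: "x \<bullet> x = 1" using x by (simp add: dot_square_norm)
    define M where "M = zconv_grad k w x"
    define s where "s = x \<bullet> M"
    have "(norm (M - s *\<^sub>R x))\<^sup>2 = M \<bullet> M - 2 * s * (x \<bullet> M) + s * s * (x \<bullet> x)"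
      by (simp add: power2_norm_eq_inner inner_diff_left inner_diff_right inner_commute[of M x] algebra_simps)
    then have "(norm (M - s *\<^sub>R x))\<^sup>2 = M \<bullet> M - s * s"
      by (simp add: xx s_def)
    then show ?thesis
      unfolding f1 sum_cross_axis surf_grad_eq[OF x has_derivative_zconv_grad[OF w]]
      by (simp only: M_def[symmetric] s_def[symmetric] xx mult_1)
  qed
  have "(LINT x|sphere_area. (\<Sum>i\<in>UNIV. f2 i x) * zconv k w x) =
      - (LINT x|sphere_area. (\<Sum>i\<in>UNIV. f1 i x * f1 i x))"
    by (rule green_identity[OF d1 d2 d1]) (intro continuous_on_zconv w c1 c2)+
  moreover have "(LINT x|sphere_area. (\<Sum>i\<in>UNIV. f2 i x) * zconv k w x) =
      (LINT x|sphere_area. - (zconv k w x * zconv (legendre_op k) w x))"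
    by (intro Bochner_Integration.integral_cong refl) (simp add: lap)
  moreover have "(LINT x|sphere_area. (\<Sum>i\<in>UNIV. f1 i x * f1 i x)) =
      (LINT x|sphere_area. (norm (surf_grad (zconv k w) x))\<^sup>2)"
    by (intro Bochner_Integration.integral_cong refl) (simp add: grad)
  ultimately show ?thesis by simp
qed

lemma continuous_on_norm_surf_grad_zconv:
  assumes w: "integrable sphere_area w"
  shows "continuous_on S2 (\<lambda>x. norm (surf_grad (zconv k w) x))"
proof -
  have "continuous_on S2 (\<lambda>x. norm (zconv_grad k w x - (x \<bullet> zconv_grad k w x) *\<^sub>R x))"
    by (intro continuous_intros w)
  then show ?thesis
    by (rule continuous_on_eq) (simp add: surf_grad_eq[OF _ has_derivative_zconv_grad[OF w]])
qed

lemma norm_cross3_le_1: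
  assumes q: "norm q = 1" and x: "x \<in> S2"
  shows "norm (cross3 q x) \<le> 1"
proof (rule power2_le_imp_le)
  show "(norm (cross3 q x))\<^sup>2 \<le> 1\<^sup>2"
    using norm_cross_dot[of q x] q x by simp (metis le_add_same_cancel1 zero_le_power2)
qed simp

text \<open>The rotation field is tangential and has length at most 1 on the sphere, so only the
  tangential part of the gradient contributes to the derivative.\<close>

lemma rot_deriv_zconv_bound:
  assumes q: "norm q = 1" and w: "integrable sphere_area w" and x: "x \<in> S2"
  shows "\<bar>cross3 q x \<bullet> zconv_grad k w x\<bar> \<le> norm (surf_grad (zconv k w) x)"
proof -
  let ?M = "zconv_grad k w x"
  have "norm (cross3 q x) \<le> 1" by (rule norm_cross3_le_1[OF q x])
  moreover have "cross3 q x \<bullet> ?M = cross3 q x \<bullet> (?M - (x \<bullet> ?M) *\<^sub>R x)"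
    by (simp add: inner_diff_right dot_cross_self)
  moreover have "\<bar>cross3 q x \<bullet> (?M - (x \<bullet> ?M) *\<^sub>R x)\<bar> \<le> norm (cross3 q x) * norm (?M - (x \<bullet> ?M) *\<^sub>R x)"
    by (rule Cauchy_Schwarz_ineq2)
  moreover have "norm (cross3 q x) * norm (?M - (x \<bullet> ?M) *\<^sub>R x) \<le> 1 * norm (?M - (x \<bullet> ?M) *\<^sub>R x)"
    using calculation(1) by (intro mult_right_mono) auto
  ultimately show ?thesis
    unfolding surf_grad_eq[OF x has_derivative_zconv_grad[OF w]] by linarith
qed

section \<open>Spectral inequalities\<close>

lemma integrable_moment:
  fixes w :: "real^3 \<Rightarrow> real"
  assumes w: "integrable sphere_area w"
  shows "integrable sphere_area (\<lambda>x. w x *\<^sub>R x)"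
proof (rule Bochner_Integration.integrable_bound[OF w])
  show "(\<lambda>x. w x *\<^sub>R x) \<in> borel_measurable sphere_area"
    by (rule borel_measurable_scaleR[OF borel_measurable_integrable[OF w]
          borel_measurable_sphere_continuous[OF continuous_on_id]])
qed (auto intro!: AE_I2)

lemma inner_moment:
  assumes w: "integrable sphere_area w"
  shows "moment w \<bullet> y = (LINT x|sphere_area. w x * (x \<bullet> y))"
  using integral_inner_left[OF integrable_moment[OF w], of y]
  by (simp add: moment_def)

lemma zconv_linear:
  assumes "integrable sphere_area w"
  shows "zconv [:0, c:] w y = c * (moment w \<bullet> y)"
  by (simp add: zconv_def inner_moment[OF assms] mult_ac)

section \<open>The three lowest eigenspaces among the kernels\<close>

lemma legendre_eigen_0:
  assumes "degree P \<le> 0"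
  shows "zconv P w y = coeff P 0 * (LINT x|sphere_area. w x)"
proof -
  have "P = [:coeff P 0:]" using assms by (metis degree_eq_zeroE coeff_pCons_0 le_zero_eq)
  then have "zconv P w y = zconv [:coeff P 0:] w y" by simp
  then show ?thesis by (simp add: zconv_def)
qed

lemma legendre_eigen_1:
  assumes "degree P \<le> 1" "legendre_op P = smult 2 P"
  shows "P = [:0, coeff P 1:]"
proof (rule poly_eqI)
  fix n
  have "coeff (legendre_op P) 0 = 2 * coeff P 0" by (simp add: assms(2))
  then have "coeff P 0 = 0" using assms(1) by (simp add: coeff_legendre_op coeff_eq_0)
  then show "coeff P n = coeff [:0, coeff P 1:] n"
    using assms(1) by (auto simp: coeff_pCons coeff_eq_0 split: nat.split)
qed

text \<open>Twice the Legendre polynomial of degree two, the zonal profile belonging to the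
  eigenvalue 6.\<close>

abbreviation quad :: "real poly" where
  "quad \<equiv> [:-1, 0, 3:]"

lemma legendre_op_quad: "legendre_op quad = smult 6 quad"
  by (simp add: legendre_op_def pderiv_pCons)

lemma legendre_eigen_2:
  assumes "degree P \<le> 2" "legendre_op P = smult 6 P"
  shows "P = smult (coeff P 2 / 3) quad"
proof (rule poly_eqI)
  fix n
  have *: "coeff (legendre_op P) n = 6 * coeff P n" for n by (simp add: assms(2))
  have "coeff P 1 = 0" using *[of 1] assms(1) by (simp add: coeff_legendre_op coeff_eq_0)
  moreover have "coeff P 0 = - coeff P 2 / 3" using *[of 0] assms(1) by (simp add: coeff_legendre_op numeral_2_eq_2)
  ultimately show "coeff P n = coeff (smult (coeff P 2 / 3) quad) n"
    using assms(1) by (auto simp: coeff_pCons coeff_eq_0 numeral_2_eq_2 split: nat.split)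
qed

section \<open>Splitting the smoothing kernels into eigenvectors\<close>

definition peak_order :: "nat \<Rightarrow> nat" where
  "peak_order n = degree (peak n) + 2"

text \<open>The extra 2 in the order guarantees that the component of degree two occurs in the sum
  even for the first few kernels, so that it can be singled out for every \<open>n\<close>.\<close>

lemma degree_peak_le: "degree (peak n) \<le> peak_order n" and two_le_peak_order: "2 \<le> peak_order n"
  by (simp_all add: peak_order_def)

text \<open>Convolution with \<open>peak_part n l\<close> maps into the spherical harmonics of
  degree \<open>l\<close>. One decomposition is fixed by choice; all later arguments use only
  degree, eigenvalue and sum of the components.\<close>

definition peak_part :: "nat \<Rightarrow> nat \<Rightarrow> real poly" where
  "peak_part n = (SOME P. (\<forall>l. degree (P l) \<le> l \<and> legendre_op (P l) = smult (real (l * (l + 1))) (P l))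
    \<and> peak n = (\<Sum>l\<le>peak_order n. P l))"

lemma peak_part:
  shows degree_peak_part: "degree (peak_part n l) \<le> l"
    and legendre_op_peak_part: "legendre_op (peak_part n l) = smult (real (l * (l + 1))) (peak_part n l)"
    and peak_eq_sum: "peak n = (\<Sum>l\<le>peak_order n. peak_part n l)"
proof -
  have "\<exists>P. (\<forall>l. degree (P l) \<le> l \<and> legendre_op (P l) = smult (real (l * (l + 1))) (P l))
      \<and> peak n = (\<Sum>l\<le>peak_order n. P l)"
    by (rule legendre_decomposition) (rule degree_peak_le)
  from someI_ex[OF this, folded peak_part_def]
  show "degree (peak_part n l) \<le> l"
    and "legendre_op (peak_part n l) = smult (real (l * (l + 1))) (peak_part n l)"
    and "peak n = (\<Sum>l\<le>peak_order n. peak_part n l)" by blast+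
qed

lemma eigenvalue_inj: "l \<noteq> m \<Longrightarrow> real (l * (l + 1)) \<noteq> real (m * (m + 1))"
proof -
  have "a * (a + 1) < b * (b + 1)" if "a < b" for a b :: nat
    using that by (intro mult_less_le_imp_less) auto
  then show "l \<noteq> m \<Longrightarrow> real (l * (l + 1)) \<noteq> real (m * (m + 1))"
    by (metis less_irrefl linorder_neqE_nat of_nat_eq_iff)
qed

lemma zconv_peak:
  assumes "integrable sphere_area w"
  shows "zconv (peak n) w x = (\<Sum>l\<le>peak_order n. zconv (peak_part n l) w x)"
  using zconv_sum[OF assms, of "peak_part n" "{..peak_order n}"]
  by (simp only: peak_eq_sum[of n, symmetric])

text \<open>A weighted Parseval identity: components for different eigenvalues are orthogonal. The
  weights 1, the indicator of degree two, and l (l + 1) give the norm, the projection to degree two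
  and the energy.\<close>

lemma integral_peak_parts:
  assumes w: "integrable sphere_area w"
  shows "(LINT x|sphere_area. zconv (peak n) w x * (\<Sum>l\<le>peak_order n. a l * zconv (peak_part n l) w x))
    = (\<Sum>l\<le>peak_order n. a l * (LINT x|sphere_area. (zconv (peak_part n l) w x)\<^sup>2))"
proof -
  let ?N = "peak_order n"
  let ?f = "\<lambda>l. zconv (peak_part n l) w"
  have int: "integrable sphere_area (\<lambda>x. ?f i x * ?f j x)" for i j
    by (intro integrable_sphere_continuous continuous_intros w)
  have orth: "(LINT x|sphere_area. ?f i x * ?f j x) = (if i = j then LINT x|sphere_area. (?f i x)\<^sup>2 else 0)" for i j
    using integral_zconv_eigen_orthogonal[OF legendre_op_peak_part legendre_op_peak_part eigenvalue_inj w w, of i j n n]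
    by (simp add: power2_eq_square)
  have "(LINT x|sphere_area. zconv (peak n) w x * (\<Sum>l\<le>?N. a l * ?f l x))
      = (LINT x|sphere_area. (\<Sum>i\<le>?N. \<Sum>j\<le>?N. a j * (?f i x * ?f j x)))"
    unfolding zconv_peak[OF w] sum_product
    by (simp add: mult.left_commute)
  also have "\<dots> = (\<Sum>i\<le>?N. \<Sum>j\<le>?N. a j * (LINT x|sphere_area. ?f i x * ?f j x))"
    using int by (simp add: Bochner_Integration.integral_sum)
  also have "\<dots> = (\<Sum>i\<le>?N. a i * (LINT x|sphere_area. (?f i x)\<^sup>2))"
    unfolding orth by (intro sum.cong refl) (simp add: if_distrib[of "(*) _"] cong: if_cong)
  finally show ?thesis .
qed

lemma integral_peak_square:
  assumes w: "integrable sphere_area w"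
  shows "(LINT x|sphere_area. (zconv (peak n) w x)\<^sup>2)
    = (\<Sum>l\<le>peak_order n. (LINT x|sphere_area. (zconv (peak_part n l) w x)\<^sup>2))"
  using integral_peak_parts[OF w, of n "\<lambda>_. 1"]
  by (simp add: zconv_peak[OF w, symmetric] power2_eq_square)

lemma integral_peak_part:
  assumes w: "integrable sphere_area w"
  shows "(LINT x|sphere_area. zconv (peak n) w x * zconv (peak_part n 2) w x)
    = (LINT x|sphere_area. (zconv (peak_part n 2) w x)\<^sup>2)"
  using integral_peak_parts[OF w, of n "\<lambda>l. if l = 2 then 1 else 0"]
    two_le_peak_order[of n]
  by (simp add: if_distrib[of "\<lambda>z. z * _"] cong: if_cong)

lemma integral_peak_energy:
  assumes w: "integrable sphere_area w"
  shows "(LINT x|sphere_area. zconv (peak n) w x * zconv (legendre_op (peak n)) w x)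
    = (\<Sum>l\<le>peak_order n. real (l * (l + 1)) * (LINT x|sphere_area. (zconv (peak_part n l) w x)\<^sup>2))"
proof -
  have "legendre_op (peak n) = (\<Sum>l\<le>peak_order n. smult (real (l * (l + 1))) (peak_part n l))"
    using peak_eq_sum[of n] legendre_op_sum[of "peak_part n" "{..peak_order n}"]
    by (simp only: legendre_op_peak_part)
  then have "zconv (legendre_op (peak n)) w x = (\<Sum>l\<le>peak_order n. real (l * (l + 1)) * zconv (peak_part n l) w x)" for x
    by (simp only: zconv_sum[OF w] zconv_smult)
  then show ?thesis using integral_peak_parts[OF w] by simp
qed

text \<open>Self-adjointness puts both kernels on the continuous factor, where convergence is
  uniform; integrability of \<open>h\<close> is then enough.\<close>

lemma tendsto_integral_peak:
  assumes h: "integrable sphere_area h" and w: "continuous_on S2 w"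
  shows "(\<lambda>n. LINT x|sphere_area. zconv (peak n) h x * zconv (peak n) w x) \<longlonglongrightarrow> (LINT x|sphere_area. h x * w x)"
proof -
  have wi: "integrable sphere_area w" using w by (rule integrable_sphere_continuous)
  have "(LINT x|sphere_area. zconv (peak n) h x * zconv (peak n) w x) =
      (LINT x|sphere_area. h x * zconv (peak n) (zconv (peak n) w) x)" for n
    by (intro zconv_fubini h continuous_on_zconv wi)
  then show ?thesis
    using tendsto_integral_uniform_limit[OF h continuous_on_zconv[OF integrable_zconv[OF wi]] w
        uniform_limit_zconv_peak_twice[OF w]] by simp
qed

lemma tendsto_integral_peak_square:
  assumes w: "continuous_on S2 w"
  shows "(\<lambda>n. LINT x|sphere_area. (zconv (peak n) w x)\<^sup>2) \<longlonglongrightarrow> (LINT x|sphere_area. (w x)\<^sup>2)"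
  using tendsto_integral_peak[OF integrable_sphere_continuous[OF w] w]
  by (simp add: power2_eq_square)

lemma zonal_poisson_energy:
  assumes "zonal_poisson w h"
  shows "(LINT x|sphere_area. zconv k h x * zconv k w x) =
    (LINT x|sphere_area. zconv k w x * zconv (legendre_op k) w x)"
  using assms unfolding zonal_poisson_def
  by (intro Bochner_Integration.integral_cong refl) (simp add: mult.commute)

text \<open>The mean removes degree 0, and all other eigenvalues are at least 2. The comparison is
  made term by term in the finite sum for the smoothed function and then passed to the
  limit.\<close>

lemma poincare_inequality:
  assumes w: "continuous_on S2 w" and h: "integrable sphere_area h" and p: "zonal_poisson w h"
    and mean: "(LINT x|sphere_area. w x) = 0"
  shows "2 * (LINT x|sphere_area. (w x)\<^sup>2) \<le> (LINT x|sphere_area. h x * w x)"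
proof (rule LIMSEQ_le)
  have wi: "integrable sphere_area w" using w by (rule integrable_sphere_continuous)
  show "(\<lambda>n. 2 * (LINT x|sphere_area. (zconv (peak n) w x)\<^sup>2)) \<longlonglongrightarrow> 2 * (LINT x|sphere_area. (w x)\<^sup>2)"
    by (intro tendsto_intros tendsto_integral_peak_square w)
  show "(\<lambda>n. LINT x|sphere_area. zconv (peak n) h x * zconv (peak n) w x) \<longlonglongrightarrow> (LINT x|sphere_area. h x * w x)"
    by (rule tendsto_integral_peak[OF h w])
  have "2 * (LINT x|sphere_area. (zconv (peak n) w x)\<^sup>2) \<le>
      (LINT x|sphere_area. zconv (peak n) h x * zconv (peak n) w x)" for n
    unfolding zonal_poisson_energy[OF p] integral_peak_energy[OF wi] integral_peak_square[OF wi] sum_distrib_left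
  proof (rule sum_mono)
    fix l
    show "2 * (LINT x|sphere_area. (zconv (peak_part n l) w x)\<^sup>2) \<le>
        real (l * (l + 1)) * (LINT x|sphere_area. (zconv (peak_part n l) w x)\<^sup>2)"
    proof (cases "l = 0")
      case True
      have "zconv (peak_part n l) w x = 0" for x
        using legendre_eigen_0[of "peak_part n l" w x] degree_peak_part[of n l] True mean by simp
      then show ?thesis by simp
    next
      case False
      then have "1 * 2 \<le> l * (l + 1)" by (intro mult_le_mono) auto
      then have "2 \<le> real (l * (l + 1))" by linarith
      then show ?thesis by (intro mult_right_mono) auto
    qed
  qed
  then show "\<exists>N. \<forall>n\<ge>N. 2 * (LINT x|sphere_area. (zconv (peak n) w x)\<^sup>2) \<le>
      (LINT x|sphere_area. zconv (peak n) h x * zconv (peak n) w x)" by blast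
qed

text \<open>Eigenvectors of degree 0 and 1 are constants and multiples of t, and convolution with
  these only sees the mean and the moment.\<close>

lemma peak_part_low_zero:
  assumes w: "integrable sphere_area w"
    and mean: "(LINT x|sphere_area. w x) = 0" and mom: "moment w = 0" and l: "l < 2"
  shows "zconv (peak_part n l) w x = 0"
proof -
  consider "l = 0" | "l = 1" using l by linarith
  then show ?thesis
  proof cases
    case 1
    then show ?thesis
      using legendre_eigen_0[of "peak_part n l" w x] degree_peak_part[of n l] mean by simp
  next
    case 2
    then have "peak_part n l = [:0, coeff (peak_part n l) 1:]"
      using degree_peak_part[of n l] legendre_op_peak_part[of n l] by (intro legendre_eigen_1) auto
    then show ?thesis using zconv_linear[OF w, of "coeff (peak_part n l) 1" x] mom by simp
  qed
qed

definition quad_coeff :: "nat \<Rightarrow> real" where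
  "quad_coeff n = coeff (peak_part n 2) 2 / 3"

lemma zconv_peak_part_2: "zconv (peak_part n 2) w x = quad_coeff n * zconv quad w x"
proof -
  have "legendre_op (peak_part n 2) = smult 6 (peak_part n 2)"
    using legendre_op_peak_part[of n 2] by simp
  then have "peak_part n 2 = smult (quad_coeff n) quad"
    unfolding quad_coeff_def by (intro legendre_eigen_2 degree_peak_part)
  then show ?thesis by (metis zconv_smult)
qed

text \<open>Degrees 0 and 1 are absent, degree two has eigenvalue 6, and all higher eigenvalues are
  at least 12. The energy in excess of 6 times the norm is thus at least 12 - 6 = 6 times the part
  outside degree two.\<close>

lemma quadratic_part_inequality:
  assumes w: "integrable sphere_area w"
    and mean: "(LINT x|sphere_area. w x) = 0" and mom: "moment w = 0"
  shows "6 * (LINT x|sphere_area. (zconv (peak n) w x)\<^sup>2)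
     + 6 * (LINT x|sphere_area. (zconv (peak n) w x - quad_coeff n * zconv quad w x)\<^sup>2)
     \<le> (LINT x|sphere_area. zconv (peak n) w x * zconv (legendre_op (peak n)) w x)"
proof -
  let ?f = "\<lambda>l. LINT x|sphere_area. (zconv (peak_part n l) w x)\<^sup>2"
  let ?A = "LINT x|sphere_area. (zconv (peak n) w x)\<^sup>2"
  have int: "integrable sphere_area (\<lambda>x. zconv k w x * zconv l w x)" for k l
    by (intro integrable_sphere_continuous continuous_intros w)
  have "(LINT x|sphere_area. (zconv (peak n) w x - zconv (peak_part n 2) w x)\<^sup>2)
     = (LINT x|sphere_area. zconv (peak n) w x * zconv (peak n) w x
        - 2 * (zconv (peak n) w x * zconv (peak_part n 2) w x)
        + zconv (peak_part n 2) w x * zconv (peak_part n 2) w x)"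
    by (intro Bochner_Integration.integral_cong refl) (simp add: power2_eq_square algebra_simps)
  also have "\<dots> = ?A - 2 * ?f 2 + ?f 2"
    using int[of "peak n" "peak n"] int[of "peak n" "peak_part n 2"] int[of "peak_part n 2" "peak_part n 2"]
    by (simp only: Bochner_Integration.integral_add Bochner_Integration.integral_diff integrable_mult_right
        Bochner_Integration.integrable_diff integral_mult_right_zero
        integral_peak_part[OF w] power2_eq_square[symmetric])
  finally have 1: "(LINT x|sphere_area. (zconv (peak n) w x - quad_coeff n * zconv quad w x)\<^sup>2) = ?A - ?f 2"
    by (simp add: zconv_peak_part_2)
  \<comment> \<open>Weight 12 on every degree, lowered to 6 on degree two, equals 6 on the whole
    plus 6 on the part orthogonal to degree two.\<close>
  have "12 * ?A - 6 * ?f 2 = (\<Sum>l\<le>peak_order n. (12 - (if l = 2 then 6 else 0)) * ?f l)"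
    unfolding integral_peak_square[OF w]
    using two_le_peak_order[of n] by (simp add: left_diff_distrib sum_subtractf sum_distrib_left if_distrib[of "\<lambda>z. z * _"] cong: if_cong)
  also have "\<dots> \<le> (\<Sum>l\<le>peak_order n. real (l * (l + 1)) * ?f l)"
  proof (rule sum_mono)
    fix l
    show "(12 - (if l = 2 then 6 else 0)) * ?f l \<le> real (l * (l + 1)) * ?f l"
    proof (cases "l < 2")
      case True
      then show ?thesis by (simp add: peak_part_low_zero[OF w mean mom])
    next
      case False
      have "12 - (if l = 2 then 6 else 0) \<le> real (l * (l + 1))"
      proof (cases "l = 2")
        case neq: False
        then have "3 * 4 \<le> l * (l + 1)" using False by (intro mult_le_mono) auto
        then have "12 \<le> real (l * (l + 1))" by linarith
        then show ?thesis using neq by simp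
      qed simp
      then show ?thesis by (intro mult_right_mono) auto
    qed
  qed
  also have "12 * ?A - 6 * ?f 2 = 6 * ?A + 6 * (?A - ?f 2)" by simp
  finally show ?thesis unfolding 1 integral_peak_energy[OF w] .
qed

lemma continuous_sphere_square_zero:
  fixes f :: "real^3 \<Rightarrow> real"
  assumes f: "continuous_on S2 f" and le: "(LINT x|sphere_area. (f x)\<^sup>2) \<le> 0" and x: "x \<in> S2"
  shows "f x = 0"
proof -
  have i: "integrable sphere_area (\<lambda>x. (f x)\<^sup>2)"
    by (intro integrable_sphere_continuous continuous_intros f)
  have "(LINT x|sphere_area. (f x)\<^sup>2) = 0"
    using le by (intro antisym integral_nonneg) auto
  then have "AE x in sphere_area. (f x)\<^sup>2 = 0"
    using integral_nonneg_eq_0_iff_AE[OF i] by simp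
  then have "AE x in sphere_area. f x = (\<lambda>_. 0) x" by simp
  then show ?thesis using AE_sphere_continuous_eq[OF f continuous_on_const _ x] by simp
qed

text \<open>The limit \<open>\<kappa>\<close> makes \<open>\<kappa> *\<close> convolution with \<open>quad\<close> the projection onto the
  second eigenspace.\<close>

lemma quadratic_rigidity:
  obtains \<kappa> where "\<And>w h x. \<lbrakk>continuous_on S2 w; integrable sphere_area h; zonal_poisson w h;
      (LINT x|sphere_area. w x) = 0; moment w = 0;
      (LINT x|sphere_area. h x * w x) \<le> 6 * (LINT x|sphere_area. (w x)\<^sup>2); x \<in> S2\<rbrakk>
    \<Longrightarrow> w x = \<kappa> * zconv quad w x"
proof -
  \<comment> \<open>On a convolution with \<open>quad\<close> the kernel \<open>peak n\<close> acts
    through its degree two component, that is, through the factor \<open>quad_coeff n\<close>. As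
    these kernels approximate the identity, one nonvanishing value of such a convolution forces
    \<open>quad_coeff\<close> to converge. If there is no such value, the degree two terms vanish
    and any \<open>\<kappa>\<close> serves. Either way \<open>\<kappa>\<close> does not depend on
    \<open>w\<close>.\<close>
  have "\<exists>\<kappa>. quad_coeff \<longlonglongrightarrow> \<kappa> \<or> (\<forall>v x. integrable sphere_area v \<longrightarrow> x \<in> S2 \<longrightarrow> zconv quad v x = 0)"
  proof (cases "\<exists>v x. integrable sphere_area v \<and> x \<in> S2 \<and> zconv quad v x \<noteq> 0")
    case True
    then obtain v x where v: "integrable sphere_area v" and x: "x \<in> S2" and ne: "zconv quad v x \<noteq> 0" by blast
    have "zconv (peak n) (zconv quad v) x = quad_coeff n * zconv quad (zconv quad v) x" for n
    proof -
      have "zconv (peak n) (zconv quad v) x = (\<Sum>l\<le>peak_order n. if l = 2 then zconv (peak_part n 2) (zconv quad v) x else 0)"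
        unfolding zconv_peak[OF integrable_zconv[OF v]]
      proof (intro sum.cong refl)
        fix l
        have "zconv (peak_part n l) (zconv quad v) x = 0" if "l \<noteq> 2"
          using legendre_op_quad eigenvalue_inj[OF that] v x
          by (intro zconv_eigen_orthogonal[OF legendre_op_peak_part]) auto
        then show "zconv (peak_part n l) (zconv quad v) x = (if l = 2 then zconv (peak_part n 2) (zconv quad v) x else 0)"
          by simp
      qed
      then show ?thesis using two_le_peak_order[of n] by (simp add: zconv_peak_part_2)
    qed
    then have lim: "(\<lambda>n. quad_coeff n * zconv quad (zconv quad v) x) \<longlonglongrightarrow> zconv quad v x"
      using tendsto_uniform_limitI[OF uniform_limit_zconv_peak[OF continuous_on_zconv[OF v]] x, of quad] by simp
    have "zconv quad (zconv quad v) x \<noteq> 0"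
    proof
      assume "zconv quad (zconv quad v) x = 0"
      then show False using lim ne by (simp add: LIMSEQ_const_iff)
    qed
    then have "quad_coeff \<longlonglongrightarrow> zconv quad v x / zconv quad (zconv quad v) x"
      using tendsto_divide[OF lim tendsto_const[of "zconv quad (zconv quad v) x"]] by simp
    then show ?thesis by blast
  qed blast
  then obtain \<kappa> where \<kappa>: "quad_coeff \<longlonglongrightarrow> \<kappa> \<or> (\<forall>v x. integrable sphere_area v \<longrightarrow> x \<in> S2 \<longrightarrow> zconv quad v x = 0)" ..
  show ?thesis
  proof (rule that)
    fix w h x
    assume w: "continuous_on S2 w" and h: "integrable sphere_area h" and p: "zonal_poisson w h"
      and mean: "(LINT x|sphere_area. w x) = 0" and mom: "moment w = 0"
      and le: "(LINT x|sphere_area. h x * w x) \<le> 6 * (LINT x|sphere_area. (w x)\<^sup>2)" and x: "x \<in> S2"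
    have wi: "integrable sphere_area w" using w by (rule integrable_sphere_continuous)
    let ?S = "zconv quad w"
    let ?ww = "LINT x|sphere_area. (w x)\<^sup>2"
    have cS: "continuous_on S2 ?S" by (intro continuous_on_zconv wi)
    define D where "D = (\<lambda>n. LINT x|sphere_area. (zconv (peak n) w x - quad_coeff n * ?S x)\<^sup>2)"
    have exp: "(LINT x|sphere_area. (f x - c * ?S x)\<^sup>2) = (LINT x|sphere_area. (f x)\<^sup>2)
        - 2 * c * (LINT x|sphere_area. ?S x * f x) + c\<^sup>2 * (LINT x|sphere_area. (?S x)\<^sup>2)"
      if f: "continuous_on S2 f" for f c
    proof -
      have "(LINT x|sphere_area. (f x - c * ?S x)\<^sup>2) = (LINT x|sphere_area. (f x)\<^sup>2
          - 2 * c * (?S x * f x) + c\<^sup>2 * (?S x)\<^sup>2)"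
        by (intro Bochner_Integration.integral_cong refl) (simp add: power2_eq_square algebra_simps)
      also have "\<dots> = (LINT x|sphere_area. (f x)\<^sup>2 - 2 * c * (?S x * f x)) + (LINT x|sphere_area. c\<^sup>2 * (?S x)\<^sup>2)"
        by (intro Bochner_Integration.integral_add integrable_sphere_continuous continuous_intros f cS)
      also have "(LINT x|sphere_area. (f x)\<^sup>2 - 2 * c * (?S x * f x)) =
          (LINT x|sphere_area. (f x)\<^sup>2) - (LINT x|sphere_area. 2 * c * (?S x * f x))"
        by (intro Bochner_Integration.integral_diff integrable_sphere_continuous continuous_intros f cS)
      finally show ?thesis by simp
    qed
    have "(\<lambda>n. LINT x|sphere_area. ?S x * zconv (peak n) w x) \<longlonglongrightarrow> (LINT x|sphere_area. ?S x * w x)"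
      by (intro tendsto_integral_uniform_limit integrable_zconv continuous_on_zconv wi w uniform_limit_zconv_peak)
    note lims = this tendsto_integral_peak_square[OF w]
    have limD: "D \<longlonglongrightarrow> (LINT x|sphere_area. (w x - \<kappa> * ?S x)\<^sup>2)"
      using \<kappa>
    proof
      assume "quad_coeff \<longlonglongrightarrow> \<kappa>"
      then show ?thesis
        unfolding D_def exp[OF continuous_on_zconv[OF wi]] exp[OF w] by (intro tendsto_intros lims)
    next
      assume "\<forall>v x. integrable sphere_area v \<longrightarrow> x \<in> S2 \<longrightarrow> zconv quad v x = 0"
      then have "(LINT x|sphere_area. (f x - c * ?S x)\<^sup>2) = (LINT x|sphere_area. (f x)\<^sup>2)" for f c
        using wi by (intro Bochner_Integration.integral_cong refl) simp
      then show ?thesis unfolding D_def using lims(2) by simp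
    qed
    have "(\<lambda>n. (LINT x|sphere_area. zconv (peak n) h x * zconv (peak n) w x)
        - 6 * (LINT x|sphere_area. (zconv (peak n) w x)\<^sup>2)) \<longlonglongrightarrow> (LINT x|sphere_area. h x * w x) - 6 * ?ww"
      by (intro tendsto_intros lims tendsto_integral_peak h w)
    moreover have "(\<lambda>n. 6 * D n) \<longlonglongrightarrow> 6 * (LINT x|sphere_area. (w x - \<kappa> * ?S x)\<^sup>2)"
      by (intro tendsto_intros limD)
    moreover have "6 * D n \<le> (LINT x|sphere_area. zconv (peak n) h x * zconv (peak n) w x)
        - 6 * (LINT x|sphere_area. (zconv (peak n) w x)\<^sup>2)" for n
      using quadratic_part_inequality[OF wi mean mom, of n] unfolding zonal_poisson_energy[OF p] D_def by linarith
    ultimately have "6 * (LINT x|sphere_area. (w x - \<kappa> * ?S x)\<^sup>2) \<le> (LINT x|sphere_area. h x * w x) - 6 * ?ww"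
      by (intro LIMSEQ_le[of "\<lambda>n. 6 * D n"]) auto
    then have "(LINT x|sphere_area. (w x - \<kappa> * ?S x)\<^sup>2) \<le> 0" using le by linarith
    then have "w x - \<kappa> * ?S x = 0"
      by (intro continuous_sphere_square_zero[OF _ _ x] continuous_intros w wi)
    then show "w x = \<kappa> * zconv quad w x" by simp
  qed
qed

text \<open>Every zonal convolution of \<open>h - 6 w\<close> vanishes, because the Legendre
  operator can be moved onto \<open>quad\<close>, where it is multiplication by 6. The approximate
  identity then gives the pointwise claim. This passes from information on the solution to
  information on its source.\<close>

lemma quadratic_part_source:
  assumes w: "continuous_on S2 w" and h: "continuous_on S2 h" and p: "zonal_poisson w h"
    and eq: "\<And>x. x \<in> S2 \<Longrightarrow> w x = \<kappa> * zconv quad w x" and x: "x \<in> S2"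
  shows "h x = 6 * w x"
proof -
  have wi: "integrable sphere_area w" and hi: "integrable sphere_area h"
    using w h by (auto intro: integrable_sphere_continuous)
  have z: "zconv k (\<lambda>x. h x - 6 * w x) y = 0" if y: "y \<in> S2" for k y
  proof -
    have "zconv k h y = zconv (legendre_op k) w y" using p y by (simp add: zonal_poisson_def)
    also have "\<dots> = zconv (legendre_op k) (\<lambda>x. \<kappa> * zconv quad w x) y" using eq by (intro zconv_cong)
    also have "\<dots> = \<kappa> * zconv k (zconv (legendre_op quad) w) y"
      by (simp add: zconv_mult_right zconv_legendre_swap[OF wi y])
    also have "\<dots> = 6 * zconv k (\<lambda>x. \<kappa> * zconv quad w x) y"
    proof -
      have "zconv (legendre_op quad) w = (\<lambda>x. 6 * zconv quad w x)"
        unfolding legendre_op_quad fun_eq_iff zconv_smult by simp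
      then show ?thesis by (simp add: zconv_mult_right)
    qed
    also have "\<dots> = 6 * zconv k w y"
    proof -
      have "zconv k (\<lambda>x. \<kappa> * zconv quad w x) y = zconv k w y" using eq by (intro zconv_cong) simp
      then show ?thesis by simp
    qed
    finally show ?thesis using wi hi by (simp add: zconv_diff_right zconv_mult_right)
  qed
  have "(\<lambda>n. zconv (peak n) (\<lambda>x. h x - 6 * w x) x) \<longlonglongrightarrow> h x - 6 * w x"
    by (rule tendsto_uniform_limitI[OF uniform_limit_zconv_peak _ ]) (intro continuous_intros h w x)+
  then show ?thesis using z[OF x] by (simp add: LIMSEQ_const_iff)
qed

text \<open>The smoothed \<open>w\<close> is an admissible test function: it is smooth and inherits
  vanishing mean and moment. Its Dirichlet energy is the pairing of the smoothed \<open>h\<close>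
  and \<open>w\<close>, so the limit needs no convergence of gradients.\<close>

lemma stability_inequality:
  assumes w: "continuous_on S2 w" and h: "integrable sphere_area h" and p: "zonal_poisson w h"
    and mean: "(LINT x|sphere_area. w x) = 0" and mom: "moment w = 0"
    and a: "continuous_on S2 a"
    and stab: "\<And>\<phi>. sphere_smooth \<phi> \<Longrightarrow> (LINT x|sphere_area. \<phi> x) = 0 \<Longrightarrow> moment \<phi> = 0 \<Longrightarrow>
       c * (LINT x|sphere_area. (\<phi> x)\<^sup>2) \<le> (LINT x|sphere_area. (norm (surf_grad \<phi> x))\<^sup>2 - a x * (\<phi> x)\<^sup>2)"
  shows "c * (LINT x|sphere_area. (w x)\<^sup>2) \<le> (LINT x|sphere_area. h x * w x) - (LINT x|sphere_area. a x * (w x)\<^sup>2)"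
proof -
  have wi: "integrable sphere_area w" using w by (rule integrable_sphere_continuous)
  have step: "c * (LINT x|sphere_area. (zconv (peak n) w x)\<^sup>2) \<le>
      (LINT x|sphere_area. zconv (peak n) h x * zconv (peak n) w x) - (LINT x|sphere_area. a x * (zconv (peak n) w x)\<^sup>2)" for n
  proof -
    let ?\<phi> = "zconv (peak n) w"
    have "(LINT x|sphere_area. ?\<phi> x * 1) = (LINT x|sphere_area. w x * zconv (peak n) (\<lambda>_. 1) x)"
      by (intro zconv_fubini wi) auto
    also have "\<dots> = (LINT x|sphere_area. w x)"
      by (intro Bochner_Integration.integral_cong refl) (simp add: zconv_peak_one)
    finally have mean_\<phi>: "(LINT x|sphere_area. ?\<phi> x) = 0" using mean by simp
    have "moment ?\<phi> \<bullet> y = 0" if y: "y \<in> S2" for y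
    proof -
      \<comment> \<open>Degrees below two vanish by assumption on \<open>w\<close>. A component of
        degree at least two is orthogonal to linear functions, whose profile t is an eigenvector for
        the eigenvalue 2.\<close>
      have part: "(LINT x|sphere_area. zconv (peak_part n l) w x * (x \<bullet> y)) = 0" for l
      proof (cases "l < 2")
        case True
        then show ?thesis by (simp add: peak_part_low_zero[OF wi mean mom])
      next
        case False
        have "(LINT x|sphere_area. zconv (peak_part n l) w x * (x \<bullet> y)) =
            (LINT x|sphere_area. w x * zconv (peak_part n l) (\<lambda>x. x \<bullet> y) x)"
          by (intro zconv_fubini wi continuous_intros)
        also have "\<dots> = (LINT x|sphere_area. 0)"
        proof (intro Bochner_Integration.integral_cong refl)
          fix x assume "x \<in> space sphere_area"
          then have x: "x \<in> S2" by simp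
          define I where "I = zconv (peak_part n l) (\<lambda>x. x \<bullet> y) x"
          have "(LINT z|sphere_area. poly (legendre_op (peak_part n l)) (z \<bullet> x) * poly [:0, 1:] (z \<bullet> y)) =
              (LINT z|sphere_area. poly (peak_part n l) (z \<bullet> x) * poly (legendre_op [:0, 1:]) (z \<bullet> y))"
            by (rule legendre_op_symmetric[OF x y])
          moreover have "legendre_op [:0, 1:] = [:0, 2:]" by (simp add: legendre_op_def pderiv_pCons)
          ultimately have "real (l * (l + 1)) * I = 2 * I"
            by (simp add: I_def zconv_def legendre_op_peak_part mult.assoc mult.left_commute[of _ 2]
                mult.commute[of _ "2::real"])
          moreover have "real (l * (l + 1)) \<noteq> 2" using eigenvalue_inj[of l 1] False by simp
          ultimately have "I = 0" by auto
          then show "w x * zconv (peak_part n l) (\<lambda>x. x \<bullet> y) x = 0" by (simp add: I_def)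
        qed
        finally show ?thesis by simp
      qed
      have "moment ?\<phi> \<bullet> y = (LINT x|sphere_area. (\<Sum>l\<le>peak_order n. zconv (peak_part n l) w x * (x \<bullet> y)))"
        unfolding inner_moment[OF integrable_zconv[OF wi]] by (simp add: zconv_peak[OF wi] sum_distrib_right)
      also have "\<dots> = (\<Sum>l\<le>peak_order n. (LINT x|sphere_area. zconv (peak_part n l) w x * (x \<bullet> y)))"
        by (intro Bochner_Integration.integral_sum integrable_sphere_continuous continuous_intros wi)
      finally show ?thesis by (simp add: part)
    qed
    from this[of "sgn (moment ?\<phi>)"] have mom_\<phi>: "moment ?\<phi> = 0"
      by (cases "moment ?\<phi> = 0") (simp_all add: norm_sgn sgn_div_norm)
    have "c * (LINT x|sphere_area. (?\<phi> x)\<^sup>2) \<le> (LINT x|sphere_area. (norm (surf_grad ?\<phi> x))\<^sup>2 - a x * (?\<phi> x)\<^sup>2)"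
      by (rule stab[OF sphere_smooth_zconv[OF wi] mean_\<phi> mom_\<phi>])
    also have "\<dots> = (LINT x|sphere_area. (norm (surf_grad ?\<phi> x))\<^sup>2) - (LINT x|sphere_area. a x * (?\<phi> x)\<^sup>2)"
      by (intro Bochner_Integration.integral_diff integrable_sphere_continuous continuous_intros
          continuous_on_norm_surf_grad_zconv wi a)
    finally show ?thesis
      by (simp only: integral_surf_grad_zconv[OF wi] zonal_poisson_energy[OF p])
  qed
  have bw: "bounded (w ` S2)"
    using w by (intro compact_imp_bounded compact_continuous_image) auto
  have sq: "(\<lambda>n. LINT x|sphere_area. a x * (zconv (peak n) w x * zconv (peak n) w x))
      \<longlonglongrightarrow> (LINT x|sphere_area. a x * (w x * w x))"
    by (intro tendsto_integral_uniform_limit integrable_sphere_continuous a continuous_on_mult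
        continuous_on_zconv wi w uniform_lim_mult uniform_limit_zconv_peak bw)
  show ?thesis
  proof (rule LIMSEQ_le)
    show "(\<lambda>n. c * (LINT x|sphere_area. (zconv (peak n) w x)\<^sup>2)) \<longlonglongrightarrow> c * (LINT x|sphere_area. (w x)\<^sup>2)"
      by (intro tendsto_intros tendsto_integral_peak_square w)
    show "(\<lambda>n. (LINT x|sphere_area. zconv (peak n) h x * zconv (peak n) w x) - (LINT x|sphere_area. a x * (zconv (peak n) w x)\<^sup>2))
       \<longlonglongrightarrow> (LINT x|sphere_area. h x * w x) - (LINT x|sphere_area. a x * (w x)\<^sup>2)"
      using sq by (intro tendsto_diff tendsto_integral_peak h w) (simp add: power2_eq_square)
  qed (use step in blast)
qed

section \<open>Orthogonality of the moment and the rotation field\<close>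

lemma legendre_op_dirichlet_symmetric:
  assumes w: "integrable sphere_area w" and v: "integrable sphere_area v"
  shows "(LINT x|sphere_area. zconv (legendre_op k) w x * zconv k v x) =
    (LINT x|sphere_area. zconv k w x * zconv (legendre_op k) v x)"
proof -
  have "(LINT x|sphere_area. zconv (legendre_op k) w x * zconv k v x) =
      (LINT x|sphere_area. w x * zconv (legendre_op k) (zconv k v) x)"
    by (intro zconv_fubini w continuous_on_zconv v)
  also have "\<dots> = (LINT x|sphere_area. w x * zconv k (zconv (legendre_op k) v) x)"
    using zconv_legendre_swap[OF v] by (intro Bochner_Integration.integral_cong refl) simp
  also have "\<dots> = (LINT x|sphere_area. zconv k w x * zconv (legendre_op k) v x)"
    by (intro zconv_fubini[symmetric] w continuous_on_zconv v)
  finally show ?thesis .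
qed

text \<open>The integral of \<open>(- \<Delta> \<phi>) (\<phi> \<circ> R)\<close> is an even function of the angle of the
  rotation \<open>R\<close>, so its derivative at angle \<open>0\<close> vanishes.\<close>

lemma integral_laplacian_rot_deriv:
  assumes q: "norm q = 1" and w: "integrable sphere_area w"
  shows "(LINT x|sphere_area. zconv (legendre_op k) w x * (cross3 q x \<bullet> zconv_grad k w x)) = 0"
proof -
  let ?\<phi> = "zconv k w" and ?\<zeta> = "zconv (legendre_op k) w"
  let ?L = "LINT x|sphere_area. ?\<zeta> x * (cross3 q x \<bullet> zconv_grad k w x)"
  define I where "I = (\<lambda>\<theta>. LINT x|sphere_area. ?\<zeta> x * ?\<phi> (rot q \<theta> x))"
  have cont: "continuous_on S2 ?\<phi>" "continuous_on S2 ?\<zeta>" by (intro continuous_on_zconv w)+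
  \<comment> \<open>Substituting a rotation in the integral shifts it from one factor to the other;
    the symmetry of the energy form shifts it back with the opposite angle.\<close>
  have even: "I (- \<theta>) = I \<theta>" for \<theta>
  proof -
    have w\<theta>: "integrable sphere_area (\<lambda>x. w (rot q \<theta> x))"
      by (rule integrable_sphere_orthogonal[OF orthogonal_transformation_rot[OF q] w])
    have "continuous_on S2 (\<lambda>x. ?\<zeta> x * ?\<phi> (rot q (- \<theta>) x))"
      by (intro continuous_on_mult cont continuous_on_sphere_compose_rot q)
    then have "I (- \<theta>) = (LINT x|sphere_area. (\<lambda>x. ?\<zeta> x * ?\<phi> (rot q (- \<theta>) x)) (rot q \<theta> x))"
      unfolding I_def by (intro integral_rot[OF q, symmetric] borel_measurable_sphere_continuous)
    also have "\<dots> = (LINT x|sphere_area. ?\<zeta> (rot q \<theta> x) * ?\<phi> x)"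
      by (simp add: rot_add[OF q])
    also have "\<dots> = I \<theta>"
      unfolding I_def zconv_rot[OF q w, symmetric] using legendre_op_dirichlet_symmetric[OF w\<theta> w, of k]
      by (simp add: mult.commute)
    finally show ?thesis .
  qed
  have lim: "(\<lambda>n::nat. (I (t n) - I 0) / t n) \<longlonglongrightarrow> ?L" if t: "t \<longlonglongrightarrow> 0" "\<And>n. t n \<noteq> 0" for t
  proof -
    have "(LINT x|sphere_area. ?\<zeta> x * ((?\<phi> (rot q s x) - ?\<phi> x) / s)) = (I s - I 0) / s" for s
    proof -
      have "(LINT x|sphere_area. ?\<zeta> x * ((?\<phi> (rot q s x) - ?\<phi> x) / s)) =
          (LINT x|sphere_area. (?\<zeta> x * ?\<phi> (rot q s x) - ?\<zeta> x * ?\<phi> (rot q 0 x)) / s)"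
        by (simp add: right_diff_distrib)
      also have "\<dots> = (LINT x|sphere_area. ?\<zeta> x * ?\<phi> (rot q s x) - ?\<zeta> x * ?\<phi> (rot q 0 x)) / s"
        by (rule integral_divide_zero)
      also have "(LINT x|sphere_area. ?\<zeta> x * ?\<phi> (rot q s x) - ?\<zeta> x * ?\<phi> (rot q 0 x)) = I s - I 0"
        unfolding I_def
        by (intro Bochner_Integration.integral_diff integrable_sphere_continuous continuous_on_mult cont
            continuous_on_sphere_compose_rot q)
      finally show ?thesis .
    qed
    moreover have "(\<lambda>n. LINT x|sphere_area. ?\<zeta> x * ((?\<phi> (rot q (t n) x) - ?\<phi> x) / t n)) \<longlonglongrightarrow> ?L"
      using cont by (intro tendsto_integral_rot_quotient[OF q rot_deriv_zconv[OF q w]] t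
          integrable_sphere_continuous continuous_intros continuous_on_cross w)
    ultimately show ?thesis by (simp only:)
  qed
  define t where "t = (\<lambda>n. inverse (real (Suc n)))"
  have t: "t \<longlonglongrightarrow> 0" "\<And>n. t n \<noteq> 0" unfolding t_def using LIMSEQ_inverse_real_of_nat by auto
  \<comment> \<open>By evenness, the difference quotients along the negative angles are the
    negatives of those along the positive ones, so the limit equals its own negative.\<close>
  have "(\<lambda>n. (I (- t n) - I 0) / - t n) \<longlonglongrightarrow> ?L"
    using tendsto_minus[OF t(1)] t(2) by (intro lim) auto
  then have "(\<lambda>n. - ((I (t n) - I 0) / t n)) \<longlonglongrightarrow> ?L" by (simp add: even)
  moreover have "(\<lambda>n. - ((I (t n) - I 0) / t n)) \<longlonglongrightarrow> - ?L" by (intro tendsto_minus lim t)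
  ultimately have "?L = - ?L" by (rule LIMSEQ_unique)
  then show ?thesis by simp
qed

text \<open>Formally, write J for the derivative along the rotation field and u for the argument of
  \<open>g\<close>. Then g(u) J u is the derivative of a primitive and integrates to zero, and so
  does \<zeta> J \<psi>. What remains is \<beta> times the integral of \<zeta> (q \<times> x)
  \<bullet> pv, a triple product with the moment.\<close>

lemma moment_orthogonality:
  assumes q: "norm q = 1" and \<psi>: "continuous_on S2 \<psi>" and \<zeta>: "continuous_on S2 \<zeta>"
    and p: "zonal_poisson \<psi> \<zeta>" and g: "continuous_on UNIV g"
    and eq: "\<And>x. x \<in> S2 \<Longrightarrow> \<zeta> x = g (\<psi> x + \<beta> * (pv \<bullet> x))" and pv: "norm pv = 1"
  shows "\<beta> * (pv \<bullet> cross3 q (moment \<zeta>)) = 0"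
proof -
  have \<psi>i: "integrable sphere_area \<psi>" and \<zeta>i: "integrable sphere_area \<zeta>"
    using \<psi> \<zeta> by (auto intro: integrable_sphere_continuous)
  obtain C where C: "0 \<le> C" "\<And>x. x \<in> S2 \<Longrightarrow> norm (\<psi> x) \<le> C"
    using continuous_on_sphere_bounded[OF \<psi>] by metis
  \<comment> \<open>\<open>C\<close> bounds \<psi> and all its smoothings, and \<bar>\<beta>\<bar>
    bounds the linear term. The extra 1 keeps all values in the open interval, where the primitive
    \<open>G\<close> has a two-sided derivative.\<close>
  define M where "M = C + \<bar>\<beta>\<bar> + 1"
  define G where "G = (\<lambda>t. integral {-M..t} g)"
  have G: "(G has_real_derivative g t) (at t)" if "\<bar>t\<bar> < M" for t
  proof -
    have "(G has_real_derivative g t) (at t within {-M..M})"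
      unfolding G_def using that by (intro integral_has_real_derivative continuous_on_subset[OF g]) auto
    then show ?thesis using that at_within_Icc_at[of "-M" t M] by (simp add: abs_less_iff)
  qed
  let ?\<phi> = "\<lambda>n. zconv (peak n) \<psi>"
  let ?J = "\<lambda>n x. cross3 q x \<bullet> zconv_grad (peak n) \<psi> x"
  let ?u = "\<lambda>n x. ?\<phi> n x + \<beta> * (x \<bullet> pv)"
  let ?b = "\<lambda>x. cross3 q x \<bullet> pv"
  have bp: "\<bar>\<beta> * (x \<bullet> pv)\<bar> \<le> \<bar>\<beta>\<bar>" if "x \<in> S2" for x
  proof -
    have "\<bar>x \<bullet> pv\<bar> \<le> 1" using Cauchy_Schwarz_ineq2[of x pv] that pv by simp
    then have "\<bar>\<beta>\<bar> * \<bar>x \<bullet> pv\<bar> \<le> \<bar>\<beta>\<bar> * 1" by (intro mult_left_mono) auto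
    then show ?thesis by (simp add: abs_mult)
  qed
  have ub: "\<bar>?u n x\<bar> < M" if "x \<in> S2" for n x
    using zconv_peak_bound[OF \<psi>i, of C x n] C that bp[OF that] by (simp add: M_def)
  have cJ: "continuous_on S2 (?J n)" for n
    by (intro continuous_intros continuous_on_cross \<psi>i)
  have cu: "continuous_on S2 (?u n)" for n
    by (intro continuous_intros \<psi>i)
  have cgu: "continuous_on S2 (\<lambda>x. g (?u n x))" for n
    by (intro continuous_on_compose2[OF g cu]) auto
  have cb: "continuous_on S2 ?b" by (intro continuous_intros continuous_on_cross)
  have step1: "(LINT x|sphere_area. g (?u n x) * (?J n x + \<beta> * ?b x)) = 0" for n
  proof (rule integral_rot_deriv[OF q])
    have du: "((\<lambda>\<theta>. ?u n (rot q \<theta> x)) has_real_derivative ?J n x + \<beta> * ?b x) (at 0)" if "x \<in> S2" for x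
      using rot_deriv_zconv[OF q \<psi>i, of "peak n"] rot_deriv_inner[OF q, of pv] that
      unfolding rot_deriv_def by (intro DERIV_add DERIV_cmult) blast+
    show "rot_deriv q (\<lambda>x. G (?u n x)) (\<lambda>x. g (?u n x) * (?J n x + \<beta> * ?b x))"
      unfolding rot_deriv_def
    proof
      fix x assume x: "x \<in> S2"
      have "(G has_real_derivative g (?u n x)) (at (?u n (rot q 0 x)))" using G[OF ub[OF x]] by simp
      from DERIV_chain2[OF this du[OF x]]
      show "((\<lambda>\<theta>. G (?u n (rot q \<theta> x))) has_real_derivative g (?u n x) * (?J n x + \<beta> * ?b x)) (at 0)" .
    qed
    have "continuous_on {-M<..<M} G"
    proof (intro continuous_at_imp_continuous_on ballI)
      fix t assume "t \<in> {-M<..<M}"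
      then show "isCont G t" by (intro DERIV_isCont[OF G]) (auto simp: abs_less_iff)
    qed
    then show "continuous_on S2 (\<lambda>x. G (?u n x))"
    proof (rule continuous_on_compose2[OF _ cu], intro image_subsetI)
      fix x assume "x \<in> S2"
      from ub[OF this, of n] show "?u n x \<in> {-M<..<M}"
        unfolding greaterThanLessThan_iff by linarith
    qed
    show "continuous_on S2 (\<lambda>x. g (?u n x) * (?J n x + \<beta> * ?b x))"
      by (intro continuous_on_mult continuous_on_add continuous_on_const cgu cJ cb)
  qed
  \<comment> \<open>The source of the smoothed \<psi> is the smoothed \<zeta>, not \<open>g\<close>
    of the smoothed argument. Since the former is orthogonal to the rotational derivative, it may be
    subtracted, and a uniformly small factor appears.\<close>
  have step2: "\<beta> * (LINT x|sphere_area. ?b x * g (?u n x)) =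
      - (LINT x|sphere_area. (g (?u n x) - zconv (peak n) \<zeta> x) * ?J n x)" for n
  proof -
    have "(LINT x|sphere_area. zconv (peak n) \<zeta> x * ?J n x) =
        (LINT x|sphere_area. zconv (legendre_op (peak n)) \<psi> x * ?J n x)"
      using p unfolding zonal_poisson_def by (intro Bochner_Integration.integral_cong refl) simp
    then have 0: "(LINT x|sphere_area. zconv (peak n) \<zeta> x * ?J n x) = 0"
      using integral_laplacian_rot_deriv[OF q \<psi>i] by simp
    have i: "integrable sphere_area (\<lambda>x. g (?u n x) * ?J n x)" "integrable sphere_area (\<lambda>x. ?b x * g (?u n x))"
      "integrable sphere_area (\<lambda>x. zconv (peak n) \<zeta> x * ?J n x)"
      by (intro integrable_sphere_continuous continuous_on_mult cgu cJ cb continuous_on_zconv \<zeta>i)+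
    have "(LINT x|sphere_area. g (?u n x) * (?J n x + \<beta> * ?b x)) =
       (LINT x|sphere_area. g (?u n x) * ?J n x + \<beta> * (?b x * g (?u n x)))"
      by (intro Bochner_Integration.integral_cong refl) (simp add: algebra_simps)
    also have "\<dots> = (LINT x|sphere_area. g (?u n x) * ?J n x) + \<beta> * (LINT x|sphere_area. ?b x * g (?u n x))"
      using i by simp
    finally have "\<beta> * (LINT x|sphere_area. ?b x * g (?u n x)) = - (LINT x|sphere_area. g (?u n x) * ?J n x)"
      using step1[of n] by simp
    moreover have "(LINT x|sphere_area. (g (?u n x) - zconv (peak n) \<zeta> x) * ?J n x) =
        (LINT x|sphere_area. g (?u n x) * ?J n x)"
      using i 0 by (simp add: left_diff_distrib)
    ultimately show ?thesis by simp
  qed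
  have lim\<phi>: "uniform_limit S2 ?\<phi> \<psi> sequentially" and lim\<zeta>: "uniform_limit S2 (\<lambda>n. zconv (peak n) \<zeta>) \<zeta> sequentially"
    by (intro uniform_limit_zconv_peak \<psi> \<zeta>)+
  have limu: "uniform_limit S2 (\<lambda>n x. ?u n x) (\<lambda>x. \<psi> x + \<beta> * (x \<bullet> pv)) sequentially"
    by (intro uniform_limit_add lim\<phi> uniform_limit_const)
  have "uniform_limit S2 (\<lambda>n x. g (?u n x)) (g \<circ> (\<lambda>x. \<psi> x + \<beta> * (x \<bullet> pv))) sequentially"
  proof (rule uniform_limit_compose[OF limu])
    show "uniformly_continuous_on {-M..M} g"
      by (intro compact_uniformly_continuous continuous_on_subset[OF g]) auto
    show "\<forall>\<^sub>F n in sequentially. ?u n ` S2 \<subseteq> {-M..M}"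
    proof (intro always_eventually allI image_subsetI)
      fix n x assume "x \<in> S2"
      from ub[OF this, of n] show "?u n x \<in> {-M..M}"
        unfolding atLeastAtMost_iff by linarith
    qed
    show "(\<lambda>x. \<psi> x + \<beta> * (x \<bullet> pv)) ` S2 \<subseteq> {-M..M}"
    proof (rule image_subsetI)
      fix x assume "x \<in> S2"
      then show "\<psi> x + \<beta> * (x \<bullet> pv) \<in> {-M..M}" using C(2)[of x] bp[of x] by (auto simp: M_def)
    qed
  qed
  then have limg: "uniform_limit S2 (\<lambda>n x. g (?u n x)) \<zeta> sequentially"
    using eq by (subst (asm) uniform_limit_cong'[where g = "\<lambda>n x. g (?u n x)" and i = \<zeta>]) (auto simp: inner_commute)
  have "(\<lambda>n. LINT x|sphere_area. ?b x * g (?u n x)) \<longlonglongrightarrow> (LINT x|sphere_area. ?b x * \<zeta> x)"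
    by (intro tendsto_integral_uniform_limit integrable_sphere_continuous cb cgu \<zeta> limg)
  then have lhs: "(\<lambda>n. \<beta> * (LINT x|sphere_area. ?b x * g (?u n x))) \<longlonglongrightarrow> \<beta> * (LINT x|sphere_area. ?b x * \<zeta> x)"
    by (intro tendsto_intros)
  \<comment> \<open>The first factor tends to zero uniformly. The rotational derivative is at most 1
    plus the squared gradient, whose integral is the energy \<open>E n\<close>; this sequence
    converges and is therefore bounded.\<close>
  have rhs: "(\<lambda>n. - (LINT x|sphere_area. (g (?u n x) - zconv (peak n) \<zeta> x) * ?J n x)) \<longlonglongrightarrow> 0"
  proof -
    define E where "E = (\<lambda>n. LINT x|sphere_area. zconv (peak n) \<zeta> x * zconv (peak n) \<psi> x)"
    have "E \<longlonglongrightarrow> (LINT x|sphere_area. \<zeta> x * \<psi> x)"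
      unfolding E_def by (rule tendsto_integral_peak[OF \<zeta>i \<psi>])
    then have "Bseq E" by (intro convergent_imp_Bseq convergentI)
    then obtain B where B: "\<And>n. \<bar>E n\<bar> \<le> B" unfolding Bseq_def by auto
    define K where "K = measure sphere_area S2 + B"
    have J: "(LINT x|sphere_area. \<bar>?J n x\<bar>) \<le> K" for n
    proof -
      let ?N = "\<lambda>x. norm (surf_grad (?\<phi> n) x)"
      have cN: "continuous_on S2 ?N" by (rule continuous_on_norm_surf_grad_zconv[OF \<psi>i])
      have "(LINT x|sphere_area. \<bar>?J n x\<bar>) \<le> (LINT x|sphere_area. 1 + (?N x)\<^sup>2)"
      proof (rule integral_mono)
        show "integrable sphere_area (\<lambda>x. \<bar>?J n x\<bar>)"
          by (intro integrable_abs integrable_sphere_continuous cJ)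
        show "integrable sphere_area (\<lambda>x. 1 + (?N x)\<^sup>2)"
          by (intro integrable_sphere_continuous continuous_intros cN)
        fix x assume "x \<in> space sphere_area"
        then have "\<bar>?J n x\<bar> \<le> ?N x" using rot_deriv_zconv_bound[OF q \<psi>i, of x] by simp
        also have "?N x \<le> 1 + (?N x)\<^sup>2"
          using zero_le_power2[of "?N x - 1"] norm_ge_zero[of "surf_grad (?\<phi> n) x"]
          unfolding power2_diff one_power2 by linarith
        finally show "\<bar>?J n x\<bar> \<le> 1 + (?N x)\<^sup>2" .
      qed
      also have "\<dots> = measure sphere_area S2 + (LINT x|sphere_area. (?N x)\<^sup>2)"
        using integrable_sphere_continuous[OF continuous_on_power[OF cN, of 2]] by simp
      also have "(LINT x|sphere_area. (?N x)\<^sup>2) = E n"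
        unfolding E_def by (simp only: integral_surf_grad_zconv[OF \<psi>i] zonal_poisson_energy[OF p])
      finally show ?thesis using B[of n] by (simp add: K_def)
    qed
    have "0 \<le> K" using order_trans[OF integral_nonneg_AE J[of 0]] by auto
    show ?thesis
    proof (rule LIMSEQ_I)
      fix r :: real assume r: "0 < r"
      define \<epsilon> where "\<epsilon> = r / (2 * (K + 1))"
      have \<epsilon>: "0 < \<epsilon>" "2 * \<epsilon> * K < r" using r \<open>0 \<le> K\<close> by (auto simp: \<epsilon>_def field_simps)
      have "\<forall>\<^sub>F n in sequentially. (\<forall>x\<in>S2. dist (g (?u n x)) (\<zeta> x) < \<epsilon>) \<and> (\<forall>x\<in>S2. dist (zconv (peak n) \<zeta> x) (\<zeta> x) < \<epsilon>)"
        using uniform_limitD[OF limg \<epsilon>(1)] uniform_limitD[OF lim\<zeta> \<epsilon>(1)] by (rule eventually_conj)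
      then obtain N where N: "\<And>n x. N \<le> n \<Longrightarrow> x \<in> S2 \<Longrightarrow> dist (g (?u n x)) (\<zeta> x) < \<epsilon> \<and> dist (zconv (peak n) \<zeta> x) (\<zeta> x) < \<epsilon>"
        unfolding eventually_sequentially by metis
      have "norm (- (LINT x|sphere_area. (g (?u n x) - zconv (peak n) \<zeta> x) * ?J n x) - 0) < r" if n: "N \<le> n" for n
      proof -
        have "\<bar>LINT x|sphere_area. (g (?u n x) - zconv (peak n) \<zeta> x) * ?J n x\<bar> \<le>
            (LINT x|sphere_area. \<bar>(g (?u n x) - zconv (peak n) \<zeta> x) * ?J n x\<bar>)"
          by (rule integral_abs_bound)
        also have "\<dots> \<le> (LINT x|sphere_area. 2 * \<epsilon> * \<bar>?J n x\<bar>)"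
        proof (rule integral_mono)
          show "integrable sphere_area (\<lambda>x. \<bar>(g (?u n x) - zconv (peak n) \<zeta> x) * ?J n x\<bar>)"
            by (intro integrable_abs integrable_sphere_continuous continuous_on_mult continuous_on_diff cgu cJ
                continuous_on_zconv \<zeta>i)
          show "integrable sphere_area (\<lambda>x. 2 * \<epsilon> * \<bar>?J n x\<bar>)"
            by (intro integrable_mult_right integrable_abs integrable_sphere_continuous cJ)
          fix x assume "x \<in> space sphere_area"
          then have "\<bar>g (?u n x) - zconv (peak n) \<zeta> x\<bar> \<le> 2 * \<epsilon>"
            using N[OF n, of x] unfolding dist_real_def space_sphere_area by linarith
          then show "\<bar>(g (?u n x) - zconv (peak n) \<zeta> x) * ?J n x\<bar> \<le> 2 * \<epsilon> * \<bar>?J n x\<bar>"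
            unfolding abs_mult by (intro mult_right_mono) auto
        qed
        also have "\<dots> = 2 * \<epsilon> * (LINT x|sphere_area. \<bar>?J n x\<bar>)" by simp
        also have "\<dots> \<le> 2 * \<epsilon> * K" using J \<epsilon>(1) by (intro mult_left_mono) auto
        finally show ?thesis using \<epsilon>(2) by simp
      qed
      then show "\<exists>no. \<forall>n\<ge>no. norm (- (LINT x|sphere_area. (g (?u n x) - zconv (peak n) \<zeta> x) * ?J n x) - 0) < r"
        by blast
    qed
  qed
  have "\<beta> * (LINT x|sphere_area. ?b x * \<zeta> x) = 0"
    using LIMSEQ_unique[OF lhs] rhs by (simp only: step2)
  moreover have "(LINT x|sphere_area. ?b x * \<zeta> x) = pv \<bullet> cross3 q (moment \<zeta>)"
  proof -
    have *: "cross3 q x \<bullet> pv = x \<bullet> cross3 pv q" for x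
      by (simp add: cross3_simps)
    have "(LINT x|sphere_area. ?b x * \<zeta> x) = moment \<zeta> \<bullet> cross3 pv q"
      unfolding inner_moment[OF \<zeta>i] * by (simp add: mult.commute)
    then show ?thesis using *[of "moment \<zeta>"] by (simp add: inner_commute)
  qed
  ultimately show ?thesis by simp
qed

text \<open>Taking \<open>q\<close> in the direction of pv \<times> m makes the triple product minus
  the length of pv \<times> m, so this vector is zero. The double cross product formula then gives
  the multiple of \<open>pv\<close>.\<close>

lemma cross3_zero_imp_parallel:
  assumes pv: "norm pv = 1" and c: "\<And>q. norm q = 1 \<Longrightarrow> pv \<bullet> cross3 q m = 0"
  shows "m = (pv \<bullet> m) *\<^sub>R pv"
proof -
  define v where "v = cross3 pv m"
  have "v = 0"
  proof (rule ccontr)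
    assume "v \<noteq> 0"
    then have "pv \<bullet> cross3 (sgn v) m = 0" by (intro c) (simp add: norm_sgn)
    moreover have "pv \<bullet> cross3 z m = - (z \<bullet> v)" for z
      by (simp add: v_def cross3_simps)
    ultimately have "sgn v \<bullet> v = 0" by simp
    then show False using \<open>v \<noteq> 0\<close> by (simp add: sgn_div_norm)
  qed
  then show ?thesis
    using cross_cross_unit[OF pv, of m] by (simp add: v_def)
qed

section \<open>The three cases\<close>

lemma Lp_integrable:
  assumes "1 < p" "v \<in> Lp p"
  shows "integrable sphere_area v"
proof (rule Bochner_Integration.integrable_bound)
  show "integrable sphere_area (\<lambda>x. 1 + \<bar>v x\<bar> powr p)" using assms by (simp add: Lp_def)
  show "v \<in> borel_measurable sphere_area" using assms by (simp add: Lp_def)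
  have "\<bar>t\<bar> \<le> 1 + \<bar>t\<bar> powr p" for t :: real
  proof (cases "\<bar>t\<bar> \<le> 1")
    case False
    then have "\<bar>t\<bar> powr 1 \<le> \<bar>t\<bar> powr p" using assms(1) by (intro powr_mono) auto
    then show ?thesis using False by simp
  qed (use powr_ge_zero[of "\<bar>t\<bar>" p] in linarith)
  then show "AE x in sphere_area. norm (v x) \<le> norm (1 + \<bar>v x\<bar> powr p)" by (intro AE_I2) simp
qed

text \<open>The linear kernel has eigenvalue 2, so testing the equation with it shows that the
  moment of \<zeta> is twice that of \<psi>. A rotation fixing one of them fixes the other.\<close>

lemma moment_rot_diff:
  assumes p: "zonal_poisson \<psi> \<zeta>" and \<psi>: "integrable sphere_area \<psi>" and \<zeta>: "integrable sphere_area \<zeta>"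
    and q: "norm q = 1" and fix_m: "\<And>\<theta>. rot q \<theta> (moment \<zeta>) = moment \<zeta>"
  shows "moment (\<lambda>x. \<psi> (rot q \<theta> x) - \<psi> x) = 0"
proof -
  let ?w = "\<lambda>x. \<psi> (rot q \<theta> x) - \<psi> x"
  have wi: "integrable sphere_area ?w"
    using integrable_sphere_orthogonal[OF orthogonal_transformation_rot[OF q] \<psi>] \<psi> by auto
  have \<psi>m: "2 * (moment \<psi> \<bullet> y) = moment \<zeta> \<bullet> y" if "y \<in> S2" for y
  proof -
    have "legendre_op [:0, 1:] = [:0, 2:]" by (simp add: legendre_op_def pderiv_pCons)
    then have "zconv [:0, 2:] \<psi> y = zconv [:0, 1:] \<zeta> y"
      using p that unfolding zonal_poisson_def by metis
    then show ?thesis by (simp add: zconv_linear \<psi> \<zeta>)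
  qed
  have "moment ?w \<bullet> y = 0" if y: "y \<in> S2" for y
  proof -
    have "moment ?w \<bullet> y = zconv [:0, 1:] ?w y" by (simp add: zconv_linear[OF wi])
    also have "\<dots> = moment \<psi> \<bullet> rot q \<theta> y - moment \<psi> \<bullet> y"
      using integrable_sphere_orthogonal[OF orthogonal_transformation_rot[OF q] \<psi>] \<psi>
      by (simp add: zconv_diff_right zconv_rot[OF q] zconv_linear)
    finally have "2 * (moment ?w \<bullet> y) = moment \<zeta> \<bullet> rot q \<theta> y - moment \<zeta> \<bullet> y"
      using \<psi>m[OF y] \<psi>m[of "rot q \<theta> y"] y q by simp
    also have "moment \<zeta> \<bullet> rot q \<theta> y = y \<bullet> rot q (- \<theta>) (moment \<zeta>)"
      using inner_rot[OF q, of \<theta> y "moment \<zeta>"] by (simp add: inner_commute)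
    finally show ?thesis by (simp add: fix_m inner_commute)
  qed
  from this[of "sgn (moment ?w)"] show ?thesis
    by (cases "moment ?w = 0") (simp_all add: norm_sgn sgn_div_norm)
qed

lemma integral_rot_diff:
  fixes \<psi> :: "real^3 \<Rightarrow> real"
  assumes "integrable sphere_area \<psi>" and q: "norm q = 1"
  shows "(LINT x|sphere_area. \<psi> (rot q \<theta> x) - \<psi> x) = 0"
  using integrable_sphere_orthogonal[OF orthogonal_transformation_rot[OF q] assms(1), of \<theta>] assms(1)
    integral_rot[OF q borel_measurable_integrable[OF assms(1)], of \<theta>] by simp

lemma zonal_poisson_cong_AE:
  assumes "zonal_poisson w h" "integrable sphere_area h" "integrable sphere_area h'"
    "AE x in sphere_area. h x = h' x"
  shows "zonal_poisson w h'"
  using assms unfolding zonal_poisson_def by (metis zconv_cong_AE)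

text \<open>A rotation about \<open>pv\<close> fixes \<open>pv \<bullet> x\<close>, so the two
  arguments of \<open>g\<close> differ exactly by \<open>?w\<close>. Monotonicity makes the product
  of the differences nonpositive, against the lower bound 2 from the Poincare inequality.\<close>

lemma antimono_case:
  fixes g :: "real \<Rightarrow> ereal"
  assumes \<psi>: "continuous_on S2 \<psi>" and \<zeta>: "integrable sphere_area \<zeta>" and p: "zonal_poisson \<psi> \<zeta>"
    and pv: "norm pv = 1" and g: "antimono g"
    and eq: "AE x in sphere_area. ereal (\<zeta> x) = g (\<psi> x + \<beta> * (pv \<bullet> x))"
  shows "rot_invariant pv \<zeta>"
  unfolding rot_invariant_def
proof
  fix \<theta>
  have \<psi>i: "integrable sphere_area \<psi>" using \<psi> by (rule integrable_sphere_continuous)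
  have orth: "orthogonal_transformation (rot pv \<theta>)" by (rule orthogonal_transformation_rot[OF pv])
  let ?w = "\<lambda>x. \<psi> (rot pv \<theta> x) - \<psi> x" and ?h = "\<lambda>x. \<zeta> (rot pv \<theta> x) - \<zeta> x"
  have pr: "pv \<bullet> rot pv \<theta> x = pv \<bullet> x" for x
    using inner_rot[OF pv, of "- \<theta>" pv x] rot_axis[OF pv, of "- \<theta>" 1] by simp
  have ae: "AE x in sphere_area. ereal (\<zeta> (rot pv \<theta> x)) = g (\<psi> (rot pv \<theta> x) + \<beta> * (pv \<bullet> x))"
    using AE_sphere_orthogonal[OF orth eq] by (simp add: pr)
  have cw: "continuous_on S2 ?w" by (intro continuous_intros continuous_on_sphere_compose_rot pv \<psi>)
  have hi: "integrable sphere_area ?h" using integrable_sphere_orthogonal[OF orth \<zeta>] \<zeta> by auto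
  have "2 * (LINT x|sphere_area. (?w x)\<^sup>2) \<le> (LINT x|sphere_area. ?h x * ?w x)"
    by (intro poincare_inequality cw hi zonal_poisson_rot_diff p \<psi>i \<zeta> pv integral_rot_diff)
  also have "\<dots> \<le> 0"
  proof -
    have "AE x in sphere_area. 0 \<le> - (?h x * ?w x)"
      using eq ae
    proof eventually_elim
      case (elim x)
      show ?case
      proof (cases "\<psi> x \<le> \<psi> (rot pv \<theta> x)")
        case True
        then have "g (\<psi> (rot pv \<theta> x) + \<beta> * (pv \<bullet> x)) \<le> g (\<psi> x + \<beta> * (pv \<bullet> x))"
          using g by (auto simp: antimono_def)
        then have "\<zeta> (rot pv \<theta> x) \<le> \<zeta> x" by (simp only: elim[symmetric] ereal_less_eq)
        then show ?thesis using True by (simp add: mult_nonpos_nonneg)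
      next
        case False
        then have "g (\<psi> x + \<beta> * (pv \<bullet> x)) \<le> g (\<psi> (rot pv \<theta> x) + \<beta> * (pv \<bullet> x))"
          using g by (auto simp: antimono_def)
        then have "\<zeta> x \<le> \<zeta> (rot pv \<theta> x)" by (simp only: elim[symmetric] ereal_less_eq)
        then show ?thesis using False by (simp add: mult_nonneg_nonpos)
      qed
    qed
    then have "0 \<le> (LINT x|sphere_area. - (?h x * ?w x))" by (rule integral_nonneg_AE)
    then show ?thesis by simp
  qed
  finally have "?w x = 0" if "x \<in> S2" for x
    using continuous_sphere_square_zero[OF cw _ that] by simp
  \<comment> \<open>Equal arguments give equal values of \<open>g\<close>; these values are finite
    almost everywhere because they equal the real numbers \<zeta>, so the equality holds in the
    reals.\<close>
  then have "AE x in sphere_area. \<psi> (rot pv \<theta> x) = \<psi> x" by (intro AE_I2) simp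
  then show "AE x in sphere_area. \<zeta> (rot pv \<theta> x) = \<zeta> x"
    using eq ae by eventually_elim (metis ereal.inject)
qed

text \<open>A symmetry axis exists because the moment of \<open>\<zeta>\<close> is parallel to \<open>pv\<close> when \<open>\<beta> \<noteq> 0\<close>.\<close>

lemma symmetry_axis:
  assumes \<psi>: "continuous_on S2 \<psi>" and \<zeta>: "continuous_on S2 \<zeta>" and p: "zonal_poisson \<psi> \<zeta>"
    and g: "continuous_on UNIV g" and eq: "\<And>x. x \<in> S2 \<Longrightarrow> \<zeta> x = g (\<psi> x + \<beta> * (pv \<bullet> x))"
    and pv: "norm pv = 1"
  obtains q where "norm q = 1" "\<And>\<theta>. rot q \<theta> (moment \<zeta>) = moment \<zeta>" "\<beta> \<noteq> 0 \<Longrightarrow> q = pv"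
    "\<And>\<theta> x. \<beta> * (pv \<bullet> rot q \<theta> x) = \<beta> * (pv \<bullet> x)"
proof (cases "\<beta> = 0")
  case True
  show ?thesis
  proof (cases "moment \<zeta> = 0")
    case m0: True
    show ?thesis by (rule that[OF pv]) (simp_all add: True m0 rot_def)
  next
    case False
    \<comment> \<open>With \<beta> = 0 no perturbation has to be preserved, and the axis can be laid
      through the moment itself.\<close>
    define q where "q = sgn (moment \<zeta>)"
    have q: "norm q = 1" "moment \<zeta> = norm (moment \<zeta>) *\<^sub>R q" using False by (simp_all add: q_def norm_sgn sgn_div_norm)
    show ?thesis
    proof (rule that[OF q(1)])
      show "rot q \<theta> (moment \<zeta>) = moment \<zeta>" for \<theta>
        using rot_axis[OF q(1), of \<theta> "norm (moment \<zeta>)"] q(2) by simp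
    qed (use True in auto)
  qed
next
  case False
  have m: "moment \<zeta> = (pv \<bullet> moment \<zeta>) *\<^sub>R pv"
    using moment_orthogonality[OF _ \<psi> \<zeta> p g eq pv] False by (intro cross3_zero_imp_parallel[OF pv]) auto
  show ?thesis
  proof (rule that[OF pv])
    show "rot pv \<theta> (moment \<zeta>) = moment \<zeta>" for \<theta>
      using rot_axis[OF pv, of \<theta> "pv \<bullet> moment \<zeta>"] m by simp
    show "\<beta> * (pv \<bullet> rot pv \<theta> x) = \<beta> * (pv \<bullet> x)" for \<theta> x
      using inner_rot[OF pv, of "- \<theta>" pv x] rot_axis[OF pv, of "- \<theta>" 1] by simp
  qed simp
qed

text \<open>For mean zero, the convolution with \<open>quad\<close> is the quadratic form 3 x
  \<bullet> M x, where \<open>M\<close> is the matrix of second moments of \<open>w\<close>. On the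
  sphere the trace of \<open>M\<close> is the mean, hence zero, and the form lies in the span of the
  five generators.\<close>

lemma zconv_quad_E2:
  assumes w: "integrable sphere_area w" and mean: "(LINT x|sphere_area. w x) = 0"
  obtains e where "e \<in> E2" "\<And>x. x \<in> S2 \<Longrightarrow> e x = c * zconv quad w x"
proof -
  define M where "M = (\<lambda>i j. LINT y|sphere_area. y $ i * (y $ j * w y))"
  note wi = integrable_component_mult[OF w]
  have sym: "M i j = M j i" for i j by (simp add: M_def mult.left_commute)
  have "M 1 1 + M 2 2 + M 3 3 = (LINT y|sphere_area. y $ 1 * (y $ 1 * w y) + y $ 2 * (y $ 2 * w y) + y $ 3 * (y $ 3 * w y))"
    unfolding M_def using integrable_component_mult[OF wi] by simp
  also have "\<dots> = (LINT y|sphere_area. w y)"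
  proof (intro Bochner_Integration.integral_cong refl)
    fix y :: "real^3" assume "y \<in> space sphere_area"
    then have "y \<bullet> y = 1" by (simp add: dot_square_norm)
    then have "y $ 1 * y $ 1 + y $ 2 * y $ 2 + y $ 3 * y $ 3 = 1" by (simp add: inner_vec_def sum_3)
    moreover have "y $ 1 * (y $ 1 * w y) + y $ 2 * (y $ 2 * w y) + y $ 3 * (y $ 3 * w y) =
        (y $ 1 * y $ 1 + y $ 2 * y $ 2 + y $ 3 * y $ 3) * w y" by (simp add: algebra_simps)
    ultimately show "y $ 1 * (y $ 1 * w y) + y $ 2 * (y $ 2 * w y) + y $ 3 * (y $ 3 * w y) = w y" by simp
  qed
  finally have tr: "M 3 3 = - M 1 1 - M 2 2" using mean by simp
  have quad: "zconv quad w x = 3 * (\<Sum>i\<in>UNIV. \<Sum>j\<in>UNIV. x $ i * x $ j * M i j)" for x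
  proof -
    have "zconv [:0, 3:] (\<lambda>y. y $ i * w y) x = 3 * (\<Sum>j\<in>UNIV. x $ j * M i j)" for i
    proof -
      have "zconv [:3:] v x = 3 * (LINT y|sphere_area. v y)" for v
        by (simp add: zconv_def)
      then show ?thesis
        unfolding zconv_pCons[OF wi, of 0 "[:3:]" i x]
        by (simp add: M_def sum_distrib_left mult.left_commute[of _ _ "w _"] mult.left_commute[of _ 3]
            mult.left_commute[of "_ $ i" "_ $ _"])
    qed
    then show ?thesis
      using zconv_pCons[OF w, of "-1" "[:0, 3:]" x] mean
      by (simp add: sum_distrib_left mult_ac)
  qed
  \<comment> \<open>The off-diagonal entries occur twice. For trace zero and |x| = 1, the diagonal
    part M11 x1^2 + M22 x2^2 + M33 x3^2 equals (M11 - M22)/2 (x1^2 - x2^2) + M33/2 (3 x3^2 -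
    1).\<close>
  define e where "e = (\<lambda>x::real^3. (6 * c * M 1 2) * (x$1 * x$2) + (6 * c * M 1 3) * (x$1 * x$3)
     + (6 * c * M 2 3) * (x$2 * x$3) + (3 * c * (M 1 1 - M 2 2) / 2) * ((x$1)\<^sup>2 - (x$2)\<^sup>2)
     + (3 * c * M 3 3 / 2) * (3 * (x$3)\<^sup>2 - 1))"
  show ?thesis
  proof
    show "e \<in> E2" unfolding e_def E2_def by blast
    fix x :: "real^3" assume "x \<in> S2"
    then have "x \<bullet> x = 1" by (simp add: dot_square_norm)
    then have xx: "(x $ 3)\<^sup>2 = 1 - (x $ 1)\<^sup>2 - (x $ 2)\<^sup>2" by (simp add: inner_vec_def sum_3 power2_eq_square)
    have "c * zconv quad w x = (6 * c * M 1 2) * (x$1 * x$2) + (6 * c * M 1 3) * (x$1 * x$3)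
     + (6 * c * M 2 3) * (x$2 * x$3) + 3 * c * (M 1 1 * (x$1)\<^sup>2 + M 2 2 * (x$2)\<^sup>2 + M 3 3 * (x$3)\<^sup>2)"
      unfolding quad using sym[of 2 1] sym[of 3 1] sym[of 3 2]
      by (simp add: sum_3 power2_eq_square algebra_simps)
    then show "e x = c * zconv quad w x"
      unfolding e_def xx tr by (simp add: field_simps)
  qed
qed

section \<open>Differentiable nonlinearities\<close>

lemma mean_value_between:
  fixes g g' :: "real \<Rightarrow> real"
  assumes g: "\<And>t. (g has_real_derivative g' t) (at t)"
  obtains \<xi> where "g b - g a = g' \<xi> * (b - a)" "min a b \<le> \<xi>" "\<xi> \<le> max a b"
proof (cases a b rule: linorder_cases)
  case less
  then obtain z where "a < z" "z < b" "g b - g a = (b - a) * g' z" using MVT2[OF less g] by blast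
  then show ?thesis by (intro that[of z]) auto
next
  case equal
  then show ?thesis by (intro that[of a]) auto
next
  case greater
  then obtain z where "b < z" "z < a" "g a - g b = (a - b) * g' z" using MVT2[OF greater g] by blast
  then show ?thesis by (intro that[of z]) (auto simp: algebra_simps)
qed

text \<open>The common setting of the two differentiable cases. Here \<zeta> stands for the
  continuous representative, so the equation holds at every point of the sphere. The factor \<beta>
  in \<open>fix_p\<close> leaves the axis free when there is no perturbation.\<close>

locale sphere_equation =
  fixes \<psi> \<zeta> :: "real^3 \<Rightarrow> real" and g g' :: "real \<Rightarrow> real" and \<beta> :: real and pv q :: "real^3"
  assumes \<psi>: "continuous_on S2 \<psi>" and \<zeta>: "continuous_on S2 \<zeta>" and poisson: "zonal_poisson \<psi> \<zeta>"
    and mean: "(LINT x|sphere_area. \<psi> x) = 0"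
    and g: "\<And>t. (g has_real_derivative g' t) (at t)" and cg': "continuous_on UNIV g'"
    and eq: "\<And>x. x \<in> S2 \<Longrightarrow> \<zeta> x = g (\<psi> x + \<beta> * (pv \<bullet> x))"
    and q: "norm q = 1" and fix_m: "\<And>\<theta>. rot q \<theta> (moment \<zeta>) = moment \<zeta>"
    and fix_p: "\<And>\<theta> x. \<beta> * (pv \<bullet> rot q \<theta> x) = \<beta> * (pv \<bullet> x)"
begin

lemma integrable: "integrable sphere_area \<psi>" "integrable sphere_area \<zeta>"
  using \<psi> \<zeta> by (auto intro: integrable_sphere_continuous)

definition w :: "real \<Rightarrow> real^3 \<Rightarrow> real" where "w \<theta> x = \<psi> (rot q \<theta> x) - \<psi> x"

definition h :: "real \<Rightarrow> real^3 \<Rightarrow> real" where "h \<theta> x = \<zeta> (rot q \<theta> x) - \<zeta> x"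

lemma w_h:
  shows cont_w: "continuous_on S2 (w \<theta>)" and cont_h: "continuous_on S2 (h \<theta>)"
    and poisson_w: "zonal_poisson (w \<theta>) (h \<theta>)"
    and mean_w: "(LINT x|sphere_area. w \<theta> x) = 0" and moment_w: "moment (w \<theta>) = 0"
  unfolding w_def h_def
  by (intro continuous_intros continuous_on_sphere_compose_rot q \<psi> \<zeta>
      zonal_poisson_rot_diff poisson integrable integral_rot_diff moment_rot_diff[OF poisson] fix_m)+

text \<open>The rotation fixes the perturbation, so the increment of the argument of
  \<open>g\<close> is \<open>w\<close> itself. The location of the intermediate point is kept
  because the stable case has to compare slopes at nearby points.\<close>

lemma h_eq:
  assumes "x \<in> S2"
  obtains \<xi> where "h \<theta> x = g' \<xi> * w \<theta> x"
    "min (\<psi> x + \<beta> * (pv \<bullet> x)) (\<psi> (rot q \<theta> x) + \<beta> * (pv \<bullet> x)) \<le> \<xi>"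
    "\<xi> \<le> max (\<psi> x + \<beta> * (pv \<bullet> x)) (\<psi> (rot q \<theta> x) + \<beta> * (pv \<bullet> x))"
proof -
  have "h \<theta> x = g (\<psi> (rot q \<theta> x) + \<beta> * (pv \<bullet> x)) - g (\<psi> x + \<beta> * (pv \<bullet> x))"
    using assms q eq by (simp add: h_def fix_p)
  then show ?thesis
    using mean_value_between[OF g, of "\<psi> (rot q \<theta> x) + \<beta> * (pv \<bullet> x)" "\<psi> x + \<beta> * (pv \<bullet> x)"] that
    by (auto simp: w_def)
qed

text \<open>For each angle the rigidity gives \<open>h\<close> as 6 \<kappa> times the convolution
  of \<open>w\<close> with \<open>quad\<close>, with one \<kappa> for all angles. Since convolution
  commutes with rotations, this is the rotation difference of the single function 6 \<kappa>
  \<open>zconv quad \<psi>\<close>, and subtracting it from \<zeta> leaves an invariant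
  function.\<close>

lemma bounded_slope_case:
  assumes le: "\<And>t. g' t \<le> 6"
  obtains e where "e \<in> E2" "\<And>\<theta> x. x \<in> S2 \<Longrightarrow> \<zeta> (rot q \<theta> x) - e (rot q \<theta> x) = \<zeta> x - e x"
proof -
  have *: "(LINT x|sphere_area. h \<theta> x * w \<theta> x) \<le> 6 * (LINT x|sphere_area. (w \<theta> x)\<^sup>2)" for \<theta>
  proof -
    have "(LINT x|sphere_area. h \<theta> x * w \<theta> x) \<le> (LINT x|sphere_area. 6 * (w \<theta> x)\<^sup>2)"
    proof (rule integral_mono)
      fix x assume "x \<in> space sphere_area"
      then obtain \<xi> where "h \<theta> x = g' \<xi> * w \<theta> x" using h_eq[of x \<theta>] by auto
      then have "h \<theta> x * w \<theta> x = g' \<xi> * (w \<theta> x)\<^sup>2" by (simp add: power2_eq_square)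
      also have "\<dots> \<le> 6 * (w \<theta> x)\<^sup>2" using le by (intro mult_right_mono) auto
      finally show "h \<theta> x * w \<theta> x \<le> 6 * (w \<theta> x)\<^sup>2" .
    qed (intro integrable_sphere_continuous continuous_intros cont_w cont_h)+
    then show ?thesis by simp
  qed
  obtain \<kappa> where \<kappa>: "\<And>w h x. \<lbrakk>continuous_on S2 w; integrable sphere_area h; zonal_poisson w h;
      (LINT x|sphere_area. w x) = 0; moment w = 0;
      (LINT x|sphere_area. h x * w x) \<le> 6 * (LINT x|sphere_area. (w x)\<^sup>2); x \<in> S2\<rbrakk>
    \<Longrightarrow> w x = \<kappa> * zconv quad w x"
    using quadratic_rigidity by blast
  have w: "w \<theta> x = \<kappa> * zconv quad (w \<theta>) x" if "x \<in> S2" for \<theta> x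
    using that by (intro \<kappa>[of "w \<theta>" "h \<theta>"] w_h * integrable_sphere_continuous)
  have hw: "h \<theta> x = 6 * w \<theta> x" if "x \<in> S2" for \<theta> x
    using that by (intro quadratic_part_source[where \<kappa> = \<kappa>] w_h w)
  obtain e where e: "e \<in> E2" "\<And>x. x \<in> S2 \<Longrightarrow> e x = 6 * \<kappa> * zconv quad \<psi> x"
    using zconv_quad_E2[OF integrable(1) mean] by blast
  show ?thesis
  proof (rule that[OF e(1)])
    fix \<theta> x assume x: "x \<in> S2"
    then have Rx: "rot q \<theta> x \<in> S2" using q by simp
    have i: "integrable sphere_area (\<lambda>x. \<psi> (rot q \<theta> x))"
      by (rule integrable_sphere_orthogonal[OF orthogonal_transformation_rot[OF q] integrable(1)])
    have "zconv quad (w \<theta>) x = zconv quad \<psi> (rot q \<theta> x) - zconv quad \<psi> x"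
      unfolding w_def[abs_def] zconv_diff_right[OF i integrable(1)] zconv_rot[OF q integrable(1)] ..
    moreover have "h \<theta> x = 6 * \<kappa> * zconv quad (w \<theta>) x"
      using hw[OF x, of \<theta>] w[OF x, of \<theta>] by simp
    ultimately have "h \<theta> x = 6 * \<kappa> * zconv quad \<psi> (rot q \<theta> x) - 6 * \<kappa> * zconv quad \<psi> x"
      by (simp only: right_diff_distrib)
    then show "\<zeta> (rot q \<theta> x) - e (rot q \<theta> x) = \<zeta> x - e x"
      unfolding e(2)[OF x] e(2)[OF Rx] by (simp add: h_def)
  qed
qed

text \<open>For small angles the slope at the intermediate point exceeds the slope at the unrotated
  point by at most c/2. Stability then bounds c times the norm of \<open>w\<close> by c/2 times the
  same norm, so \<open>w\<close> vanishes. Arbitrary angles are products of small ones.\<close>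

lemma stable_case:
  assumes c: "0 < c"
    and stab: "\<And>\<phi>. sphere_smooth \<phi> \<Longrightarrow> (LINT x|sphere_area. \<phi> x) = 0 \<Longrightarrow> moment \<phi> = 0 \<Longrightarrow>
       c * (LINT x|sphere_area. (\<phi> x)\<^sup>2) \<le>
       (LINT x|sphere_area. (norm (surf_grad \<phi> x))\<^sup>2 - g' (\<psi> x + \<beta> * (pv \<bullet> x)) * (\<phi> x)\<^sup>2)"
    and x: "x \<in> S2"
  shows "\<zeta> (rot q \<theta> x) = \<zeta> x"
proof -
  let ?u = "\<lambda>x. \<psi> x + \<beta> * (pv \<bullet> x)"
  let ?a = "\<lambda>x. g' (?u x)"
  have cu: "continuous_on S2 ?u" by (intro continuous_intros \<psi>)
  have ca: "continuous_on S2 ?a" by (intro continuous_on_compose2[OF cg' cu]) auto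
  obtain M where M: "\<And>x. x \<in> S2 \<Longrightarrow> norm (?u x) \<le> M"
    using continuous_on_sphere_bounded[OF cu] by metis
  have "uniformly_continuous_on {-M..M} g'"
    by (intro compact_uniformly_continuous continuous_on_subset[OF cg']) auto
  then obtain \<eta> where \<eta>: "0 < \<eta>"
    "\<And>s t. s \<in> {-M..M} \<Longrightarrow> t \<in> {-M..M} \<Longrightarrow> dist s t < \<eta> \<Longrightarrow> dist (g' s) (g' t) < c / 2"
    using c unfolding uniformly_continuous_on_def by (metis half_gt_zero)
  have "uniformly_continuous_on S2 \<psi>"
    using \<psi> by (intro compact_uniformly_continuous) auto
  then obtain \<delta> where \<delta>: "0 < \<delta>"
    "\<And>x y. x \<in> S2 \<Longrightarrow> y \<in> S2 \<Longrightarrow> dist x y < \<delta> \<Longrightarrow> dist (\<psi> x) (\<psi> y) < \<eta>"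
    using \<eta>(1) unfolding uniformly_continuous_on_def by metis
  \<comment> \<open>The displacement is a combination of x, q \<times> x and (q \<bullet> x) q, all
    of length at most 1, with coefficients independent of the point. \<open>B\<close> adds up their
    absolute values and vanishes at angle 0, so the smallness is uniform on the sphere.\<close>
  have close: "\<exists>\<tau>>0. \<forall>\<theta>. \<bar>\<theta>\<bar> < \<tau> \<longrightarrow> (\<forall>x\<in>S2. dist (rot q \<theta> x) x < \<delta>)"
  proof -
    define B where "B = (\<lambda>\<theta>::real. \<bar>cos \<theta> - 1\<bar> + \<bar>sin \<theta>\<bar> + \<bar>1 - cos \<theta>\<bar>)"
    have "isCont B 0" unfolding B_def by (intro continuous_intros)
    then obtain \<tau> where \<tau>: "0 < \<tau>" "\<And>\<theta>. \<bar>\<theta>\<bar> < \<tau> \<Longrightarrow> \<bar>B \<theta>\<bar> < \<delta>"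
      using \<delta>(1) unfolding continuous_at_eps_delta by (force simp: B_def dist_real_def)
    have "dist (rot q \<theta> x) x \<le> B \<theta>" if x: "x \<in> S2" for \<theta> x
    proof -
      have 1: "norm (cross3 q x) \<le> 1" by (rule norm_cross3_le_1[OF q x])
      have 2: "\<bar>q \<bullet> x\<bar> \<le> 1" using Cauchy_Schwarz_ineq2[of q x] q x by simp
      have "rot q \<theta> x - x = (cos \<theta> - 1) *\<^sub>R x + sin \<theta> *\<^sub>R cross3 q x + ((1 - cos \<theta>) * (q \<bullet> x)) *\<^sub>R q"
        by (simp add: rot_def scaleR_diff_left)
      also have "norm \<dots> \<le> norm ((cos \<theta> - 1) *\<^sub>R x) + norm (sin \<theta> *\<^sub>R cross3 q x) + norm (((1 - cos \<theta>) * (q \<bullet> x)) *\<^sub>R q)"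
        by (intro order_trans[OF norm_triangle_ineq] add_mono norm_triangle_ineq order_refl)
      also have "\<dots> \<le> B \<theta>"
        unfolding B_def using x q mult_left_mono[OF 1, of "\<bar>sin \<theta>\<bar>"] mult_left_mono[OF 2, of "\<bar>1 - cos \<theta>\<bar>"]
        by (simp add: abs_mult)
      finally show ?thesis by (simp add: dist_norm)
    qed
    then have "dist (rot q \<theta> x) x < \<delta>" if "\<bar>\<theta>\<bar> < \<tau>" "x \<in> S2" for \<theta> x
      using \<tau>(2)[OF that(1)] that(2) by (meson abs_ge_self le_less_trans)
    then show ?thesis using \<tau>(1) by blast
  qed
  then obtain \<tau> where \<tau>: "0 < \<tau>" "\<And>\<theta> x. \<bar>\<theta>\<bar> < \<tau> \<Longrightarrow> x \<in> S2 \<Longrightarrow> dist (rot q \<theta> x) x < \<delta>" by blast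
  have small: "w \<theta> x = 0" if \<theta>: "\<bar>\<theta>\<bar> < \<tau>" and x: "x \<in> S2" for \<theta> x
  proof -
    have "c * (LINT x|sphere_area. (w \<theta> x)\<^sup>2) \<le>
        (LINT x|sphere_area. h \<theta> x * w \<theta> x) - (LINT x|sphere_area. ?a x * (w \<theta> x)\<^sup>2)"
      by (rule stability_inequality[OF cont_w integrable_sphere_continuous[OF cont_h] poisson_w mean_w moment_w ca stab])
    moreover have "(LINT x|sphere_area. h \<theta> x * w \<theta> x) \<le> (LINT x|sphere_area. ?a x * (w \<theta> x)\<^sup>2 + (c / 2) * (w \<theta> x)\<^sup>2)"
    proof (rule integral_mono)
      fix x assume "x \<in> space sphere_area"
      then have x: "x \<in> S2" by simp
      then have Rx: "rot q \<theta> x \<in> S2" using q by simp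
      have uR: "?u (rot q \<theta> x) = \<psi> (rot q \<theta> x) + \<beta> * (pv \<bullet> x)" by (simp add: fix_p)
      obtain \<xi> where \<xi>: "h \<theta> x = g' \<xi> * w \<theta> x"
        "min (?u x) (?u (rot q \<theta> x)) \<le> \<xi>" "\<xi> \<le> max (?u x) (?u (rot q \<theta> x))"
        using h_eq[OF x, of \<theta>] unfolding uR by blast
      have "\<bar>\<psi> (rot q \<theta> x) - \<psi> x\<bar> < \<eta>" using \<delta>(2)[OF Rx x \<tau>(2)[OF \<theta> x]] by (simp add: dist_real_def)
      then have "dist \<xi> (?u x) < \<eta>" using \<xi>(2,3) unfolding uR dist_real_def by linarith
      moreover have "\<xi> \<in> {-M..M}" "?u x \<in> {-M..M}"
        using \<xi>(2,3) M[OF x] M[OF Rx] unfolding real_norm_def atLeastAtMost_iff by linarith+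
      ultimately have "dist (g' \<xi>) (?a x) < c / 2" by (intro \<eta>(2))
      then have "g' \<xi> \<le> ?a x + c / 2" unfolding dist_real_def by linarith
      then have "g' \<xi> * (w \<theta> x)\<^sup>2 \<le> (?a x + c / 2) * (w \<theta> x)\<^sup>2" by (intro mult_right_mono) auto
      then show "h \<theta> x * w \<theta> x \<le> ?a x * (w \<theta> x)\<^sup>2 + (c / 2) * (w \<theta> x)\<^sup>2"
        by (simp add: \<xi>(1) power2_eq_square distrib_right mult.assoc)
    qed (intro integrable_sphere_continuous continuous_intros cont_w cont_h ca)+
    moreover have "(LINT x|sphere_area. ?a x * (w \<theta> x)\<^sup>2 + (c / 2) * (w \<theta> x)\<^sup>2) =
        (LINT x|sphere_area. ?a x * (w \<theta> x)\<^sup>2) + (LINT x|sphere_area. (c / 2) * (w \<theta> x)\<^sup>2)"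
      by (intro Bochner_Integration.integral_add integrable_sphere_continuous continuous_intros cont_w ca)
    ultimately have "c * (LINT x|sphere_area. (w \<theta> x)\<^sup>2) \<le> c / 2 * (LINT x|sphere_area. (w \<theta> x)\<^sup>2)" by simp
    then have "(LINT x|sphere_area. (w \<theta> x)\<^sup>2) \<le> 0" using c by (simp add: mult_le_cancel_left field_simps)
    then show ?thesis by (rule continuous_sphere_square_zero[OF cont_w _ x])
  qed
  \<comment> \<open>The angle is divided into \<open>n\<close> equal parts below the threshold, and
    \<psi> is unchanged under each part.\<close>
  obtain n :: nat where n: "\<bar>\<theta>\<bar> / \<tau> < real n" using reals_Archimedean2 by blast
  have "0 < real n" using n \<tau>(1) by (metis abs_ge_zero divide_nonneg_pos le_less_trans)
  define s where "s = \<theta> / real n"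
  have "\<bar>s\<bar> < \<tau>" using n \<tau>(1) \<open>0 < real n\<close> by (simp add: s_def field_simps)
  have "\<psi> (rot q (real k * s) x) = \<psi> x" for k
  proof (induction k)
    case (Suc k)
    have "rot q (real (Suc k) * s) x = rot q s (rot q (real k * s) x)"
      by (simp add: rot_add[OF q] distrib_right)
    moreover have "rot q (real k * s) x \<in> S2" using x q by simp
    ultimately show ?case using small[OF \<open>\<bar>s\<bar> < \<tau>\<close>, of "rot q (real k * s) x"] Suc by (simp add: w_def)
  qed simp
  from this[of n] have "\<psi> (rot q \<theta> x) = \<psi> x" using \<open>0 < real n\<close> by (simp add: s_def)
  moreover have "rot q \<theta> x \<in> S2" using x q by simp
  ultimately show ?thesis using x by (simp only: eq fix_p)
qed

end

theorem theorem2p7: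
  fixes p \<beta> :: real and \<zeta> \<psi> :: "real ^ 3 \<Rightarrow> real" and pv :: "real ^ 3"
  assumes "1 < p"
    and "\<zeta> \<in> Lp_mean_zero p"
    and "is_green p \<zeta> \<psi>"
    and "norm pv = 1"
  shows
    "(\<forall>g :: real \<Rightarrow> ereal.
        (AE x in sphere_area. ereal (\<zeta> x) = g (\<psi> x + \<beta> * (pv \<bullet> x))) \<and>
        antimono g
        \<longrightarrow> (\<exists>q. norm q = 1 \<and> rot_invariant q \<zeta>) \<and> (\<beta> \<noteq> 0 \<longrightarrow> rot_invariant pv \<zeta>))
   \<and> (\<forall>g :: real \<Rightarrow> real.
        (AE x in sphere_area. \<zeta> x = g (\<psi> x + \<beta> * (pv \<bullet> x))) \<and>
        g C1_differentiable_on UNIV \<and> (\<forall>s. 0 \<le> deriv g s \<and> deriv g s \<le> 6)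
        \<longrightarrow> (\<exists>\<zeta>e \<zeta>z q. \<zeta>e \<in> E2 \<and> (AE x in sphere_area. \<zeta> x = \<zeta>e x + \<zeta>z x) \<and>
                norm q = 1 \<and> rot_invariant q \<zeta>z) \<and>
            (\<beta> \<noteq> 0 \<longrightarrow> (\<exists>\<zeta>e \<zeta>z. \<zeta>e \<in> E2 \<and> (AE x in sphere_area. \<zeta> x = \<zeta>e x + \<zeta>z x) \<and>
                rot_invariant pv \<zeta>z)))
   \<and> (\<forall>g :: real \<Rightarrow> real.
        (AE x in sphere_area. \<zeta> x = g (\<psi> x + \<beta> * (pv \<bullet> x))) \<and>
        g C1_differentiable_on UNIV \<and> (\<forall>s. 0 \<le> deriv g s) \<and>
        (\<exists>c>0. \<forall>\<phi>. sphere_smooth \<phi> \<and> (LINT x|sphere_area. \<phi> x) = 0 \<and> moment \<phi> = 0 \<longrightarrow>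
            (LINT x|sphere_area. (norm (surf_grad \<phi> x))\<^sup>2
                - deriv g (\<psi> x + \<beta> * (pv \<bullet> x)) * (\<phi> x)\<^sup>2)
              \<ge> c * (LINT x|sphere_area. (\<phi> x)\<^sup>2))
        \<longrightarrow> (\<exists>q. norm q = 1 \<and> rot_invariant q \<zeta>) \<and> (\<beta> \<noteq> 0 \<longrightarrow> rot_invariant pv \<zeta>))"
proof -
  note pv = \<open>norm pv = 1\<close>
  have \<zeta>i: "integrable sphere_area \<zeta>"
    using assms(1,2) by (auto simp: Lp_mean_zero_def intro: Lp_integrable)
  have \<psi>: "continuous_on S2 \<psi>" and mean: "(LINT x|sphere_area. \<psi> x) = 0" and poisson: "zonal_poisson \<psi> \<zeta>"
    using assms(3) weak_laplacian_zonal_poisson by (auto simp: is_green_def)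
  \<comment> \<open>The given \<zeta> satisfies the equation only almost everywhere. It is replaced
    by the continuous function on the right, which has the same zonal convolutions and hence still
    solves the Poisson equation for \<psi>.\<close>
  have axis: "\<exists>q. sphere_equation \<psi> (\<lambda>x. g (\<psi> x + \<beta> * (pv \<bullet> x))) g (deriv g) \<beta> pv q \<and> (\<beta> \<noteq> 0 \<longrightarrow> q = pv)"
    if eq: "AE x in sphere_area. \<zeta> x = g (\<psi> x + \<beta> * (pv \<bullet> x))" and g: "g C1_differentiable_on UNIV" for g
  proof -
    obtain D where D: "\<And>t. (g has_real_derivative D t) (at t)" "continuous_on UNIV D"
      using g by (auto simp: C1_differentiable_on_def has_real_derivative_iff_has_vector_derivative)
    have "D = deriv g" using D(1) DERIV_imp_deriv by (metis ext)
    let ?\<zeta> = "\<lambda>x. g (\<psi> x + \<beta> * (pv \<bullet> x))"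
    have cg: "continuous_on UNIV g"
      using D(1) by (intro continuous_at_imp_continuous_on ballI DERIV_isCont)
    have c\<zeta>: "continuous_on S2 ?\<zeta>"
      by (rule continuous_on_compose2[OF cg]) (auto intro!: continuous_intros \<psi>)
    have p\<zeta>: "zonal_poisson \<psi> ?\<zeta>"
      by (rule zonal_poisson_cong_AE[OF poisson \<zeta>i integrable_sphere_continuous[OF c\<zeta>] eq])
    obtain q where "norm q = 1" "\<And>\<theta>. rot q \<theta> (moment ?\<zeta>) = moment ?\<zeta>" "\<beta> \<noteq> 0 \<Longrightarrow> q = pv"
      "\<And>\<theta> x. \<beta> * (pv \<bullet> rot q \<theta> x) = \<beta> * (pv \<bullet> x)"
      using symmetry_axis[OF \<psi> c\<zeta> p\<zeta> cg refl pv] by blast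
    then show ?thesis
      using D c\<zeta> p\<zeta> \<psi> mean unfolding \<open>D = deriv g\<close> by (intro exI[of _ q]) (auto simp: sphere_equation_def)
  qed
  \<comment> \<open>The way back from the continuous representative: rotations preserve null sets,
    so the almost everywhere equality also holds after rotation.\<close>
  have transfer: "rot_invariant q (\<lambda>x. \<zeta> x - e x)"
    if eq: "AE x in sphere_area. \<zeta> x = \<zeta>' x" and q: "norm q = 1"
      and inv: "\<And>\<theta> x. x \<in> S2 \<Longrightarrow> \<zeta>' (rot q \<theta> x) - e (rot q \<theta> x) = \<zeta>' x - e x" for q e \<zeta>'
    unfolding rot_invariant_def
  proof
    fix \<theta>
    have "AE x in sphere_area. \<zeta> (rot q \<theta> x) = \<zeta>' (rot q \<theta> x)"
      by (rule AE_sphere_orthogonal[OF orthogonal_transformation_rot[OF q] eq])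
    moreover have "AE x in sphere_area. \<zeta>' (rot q \<theta> x) - e (rot q \<theta> x) = \<zeta>' x - e x"
      using inv by (intro AE_I2) simp
    ultimately show "AE x in sphere_area. \<zeta> (rot q \<theta> x) - e (rot q \<theta> x) = \<zeta> x - e x"
      using eq by eventually_elim simp
  qed
  show ?thesis
  proof (intro conjI allI impI)
    fix g :: "real \<Rightarrow> ereal"
    assume "(AE x in sphere_area. ereal (\<zeta> x) = g (\<psi> x + \<beta> * (pv \<bullet> x))) \<and> antimono g"
    then show "rot_invariant pv \<zeta>" "\<exists>q. norm q = 1 \<and> rot_invariant q \<zeta>"
      using antimono_case[OF \<psi> \<zeta>i poisson pv] pv by blast+
  next
    fix g :: "real \<Rightarrow> real"
    assume A: "(AE x in sphere_area. \<zeta> x = g (\<psi> x + \<beta> * (pv \<bullet> x))) \<and>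
      g C1_differentiable_on UNIV \<and> (\<forall>s. 0 \<le> deriv g s \<and> deriv g s \<le> 6)"
    then obtain q where q: "sphere_equation \<psi> (\<lambda>x. g (\<psi> x + \<beta> * (pv \<bullet> x))) g (deriv g) \<beta> pv q"
      "\<beta> \<noteq> 0 \<Longrightarrow> q = pv" using axis by blast
    have nq: "norm q = 1" by (rule sphere_equation.q[OF q(1)])
    obtain e where e: "e \<in> E2" and inv: "\<And>\<theta> x. x \<in> S2 \<Longrightarrow>
        g (\<psi> (rot q \<theta> x) + \<beta> * (pv \<bullet> rot q \<theta> x)) - e (rot q \<theta> x) = g (\<psi> x + \<beta> * (pv \<bullet> x)) - e x"
      using sphere_equation.bounded_slope_case[OF q(1)] A by metis
    have "rot_invariant q (\<lambda>x. \<zeta> x - e x)"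
      using A by (intro transfer[OF _ nq inv]) auto
    moreover have "AE x in sphere_area. \<zeta> x = e x + (\<zeta> x - e x)" by simp
    ultimately have *: "e \<in> E2 \<and> (AE x in sphere_area. \<zeta> x = e x + (\<zeta> x - e x)) \<and> rot_invariant q (\<lambda>x. \<zeta> x - e x)"
      using e by blast
    show "\<exists>\<zeta>e \<zeta>z q. \<zeta>e \<in> E2 \<and> (AE x in sphere_area. \<zeta> x = \<zeta>e x + \<zeta>z x) \<and>
        norm q = 1 \<and> rot_invariant q \<zeta>z"
      using * nq by (intro exI[of _ e] exI[of _ "\<lambda>x. \<zeta> x - e x"] exI[of _ q]) simp
    show "\<exists>\<zeta>e \<zeta>z. \<zeta>e \<in> E2 \<and> (AE x in sphere_area. \<zeta> x = \<zeta>e x + \<zeta>z x) \<and> rot_invariant pv \<zeta>z"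
      if "\<beta> \<noteq> 0"
      using * q(2)[OF that] by (intro exI[of _ e] exI[of _ "\<lambda>x. \<zeta> x - e x"]) simp
  next
    fix g :: "real \<Rightarrow> real"
    assume A: "(AE x in sphere_area. \<zeta> x = g (\<psi> x + \<beta> * (pv \<bullet> x))) \<and>
        g C1_differentiable_on UNIV \<and> (\<forall>s. 0 \<le> deriv g s) \<and>
        (\<exists>c>0. \<forall>\<phi>. sphere_smooth \<phi> \<and> (LINT x|sphere_area. \<phi> x) = 0 \<and> moment \<phi> = 0 \<longrightarrow>
            (LINT x|sphere_area. (norm (surf_grad \<phi> x))\<^sup>2
                - deriv g (\<psi> x + \<beta> * (pv \<bullet> x)) * (\<phi> x)\<^sup>2)
              \<ge> c * (LINT x|sphere_area. (\<phi> x)\<^sup>2))"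
    then obtain q where q: "sphere_equation \<psi> (\<lambda>x. g (\<psi> x + \<beta> * (pv \<bullet> x))) g (deriv g) \<beta> pv q"
      "\<beta> \<noteq> 0 \<Longrightarrow> q = pv" using axis by blast
    have nq: "norm q = 1" by (rule sphere_equation.q[OF q(1)])
    have "g (\<psi> (rot q \<theta> x) + \<beta> * (pv \<bullet> rot q \<theta> x)) = g (\<psi> x + \<beta> * (pv \<bullet> x))" if "x \<in> S2" for \<theta> x
      using A sphere_equation.stable_case[OF q(1) _ _ that] by blast
    then have "rot_invariant q (\<lambda>x. \<zeta> x - 0)"
      using A by (intro transfer[OF _ nq, where e = "\<lambda>_. 0"
            and \<zeta>' = "\<lambda>x. g (\<psi> x + \<beta> * (pv \<bullet> x))"]) auto
    then show "\<exists>q. norm q = 1 \<and> rot_invariant q \<zeta>" "\<beta> \<noteq> 0 \<Longrightarrow> rot_invariant pv \<zeta>"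
      using nq q(2) by auto
  qed
qed

end
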